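(* Let $$Q(n)=\frac{q(n-1)q(n+1)}{q(n)^2}$$ and $$E_Q(n):=1-\frac{\pi^4}{36\,\nu(n)^3}+\frac{\pi^4}{12\,\nu(n)^4}-\frac{\pi^4}{32\,\nu(n)^5}.$$ Then for every positive integer $n$ with $\nu(n)\geq 67$, $$E_Q(n)-\frac{135}{\nu(n)^6}<Q(n)<E_Q(n)+\frac{126+\frac{\pi^8}{1296}}{\nu(n)^6}.$$
   Context: For an integer $n\ge 0$, $q(n)$ is the number of partitions of $n$ into distinct parts, with generating function $\sum_{n\ge 0}q(n)x^n=\prod_{j=1}^{\infty}(1+x^j)$. Define $$\nu(n)=\frac{\pi\sqrt{24n+1}}{6\sqrt{2}}.$$ *)

theory Defs
  imports "HOL-Analysis.Analysis"
begin

text \<open>A partition into distinct parts is determined by its finite set of (positive) parts.\<close>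
definition distinct_partitions :: "nat \<Rightarrow> nat set set" where
  "distinct_partitions n = {A. finite A \<and> 0 \<notin> A \<and> \<Sum>A = n}"

definition q :: "nat \<Rightarrow> nat" where
  "q n = card (distinct_partitions n)"

lemma finite_distinct_partitions: "finite (distinct_partitions n)"
proof (rule finite_subset)
  show "distinct_partitions n \<subseteq> Pow {..n}"
    by (auto simp: distinct_partitions_def intro: member_le_sum[of _ _ "\<lambda>x. x", simplified])
qed simp

definition \<nu> :: "nat \<Rightarrow> real" where
  "\<nu> n = pi * sqrt (24 * real n + 1) / (6 * sqrt 2)"

text \<open>Only meant for \<open>n \<ge> 1\<close>: at \<open>n = 0\<close> the subtraction truncates.\<close>
definition Q :: "nat \<Rightarrow> real" where
  "Q n = real (q (n - 1)) * real (q (n + 1)) / (real (q n))\<^sup>2"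

definition E\<^sub>Q :: "nat \<Rightarrow> real" where
  "E\<^sub>Q n = 1 - pi ^ 4 / (36 * \<nu> n ^ 3) + pi ^ 4 / (12 * \<nu> n ^ 4) - pi ^ 4 / (32 * \<nu> n ^ 5)"

end

(*
With N = n + 1/24, a = pi^2/12 and nu = 2 sqrt(a N), the generating function prod (1 + x^j) is,
up to an elementary factor, Weber's modular function f_2. Its transformation under tau -> -1/tau
shows that on a vertical line with real part pi^2/(6 nu) it is e^(a/t)/sqrt 2 up to a bounded
error near the real axis; elsewhere reduction to the fundamental domain bounds it by e^(nu/18),
because cusps of even denominator contribute O(1) and the next odd denominator is 3. Cauchy's
formula then gives sqrt 2 q(n) = a G(N) + O(e^(5 nu/9)) with the Bessel-type function
G(N) = 2 I_1(nu)/nu, so q(n) may be replaced by G(N) at a relative cost of at most 20/nu^6.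

Finally log G has the second derivative (4 a^2/nu^2) (1 - 4 rho/nu - rho^2), where
rho = I_2/I_1 satisfies the Riccati equation rho' = 1 - 3 rho/nu - rho^2. Comparison with
polynomial sub- and supersolutions in 1/nu yields its expansion, and integrating it over a
second difference yields log Q(n) up to O(nu^-6).
*)
theory Submission
  imports Defs "HOL-Complex_Analysis.Complex_Analysis"
begin

section \<open>The modular transformation of the generating function\<close>

text \<open>The modular transformation comes from one double series over \<open>k\<close> and
  \<open>m\<close>, built from the partial fractions of the cotangent: summed in the two orders it
  gives the logarithms of both sides. Since only sizes matter away from the real axis, the reduction
  to the fundamental domain follows absolute values and parities of matrix entries, and the
  multiplier system of roots of unity drops out.

  The constants are the delicate point. Passing from \<open>q\<close> to the Bessel term costs
  103/nu^6 in \<open>Q\<close>, expanding the Bessel term at most 15/nu^6. The former rests on a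
  relative error of order nu^(3/2) exp(-4 nu/9), which with the constants obtained here falls below
  20/nu^6 shortly before nu = 67. At \<open>n - 1\<close> the value of nu is slightly smaller, hence
  the thresholds 66 and 66.9 on the way.

  Bounding the second derivative of log G separately at N + s and N - s would lose an order: its
  leading term nu^-3 varies by order nu^-5 over a unit step, while the sum of the two values varies
  only by order nu^-7. Hence the symmetric pairs at the end.\<close>

lemma cot_partial_fractions:
  fixes z :: complex
  assumes z: "z \<notin> \<int>"
  shows "(\<lambda>n. 2 * z / (z\<^sup>2 - (of_nat (Suc n))\<^sup>2)) sums (pi * cot (pi * z) - 1 / z)"
proof -
  have ni: "z \<notin> \<int>\<^sub>\<le>\<^sub>0" "1 - z \<notin> \<int>\<^sub>\<le>\<^sub>0" "1 + z \<notin> \<int>\<^sub>\<le>\<^sub>0"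
    using z nonpos_Ints_Int Ints_diff[of 1 "1 - z"] Ints_diff[of "1 + z" 1] by fastforce+
  have z0: "z \<noteq> 0" using z by auto
  have n0: "z \<noteq> 0" "1 - z \<noteq> 0" "1 + z \<noteq> 0" using ni by auto
  have s0: "sin (pi * z) \<noteq> 0"
    using z by (auto simp: sin_eq_0)
  \<comment> \<open>Euler's reflection formula is differentiated: dividing the result by the formula
    itself expresses the cotangent as a difference of two values of \<open>Digamma\<close>, whose
    defining series then yields the partial fractions.\<close>
  have "((\<lambda>z. Gamma z * Gamma (1 - z)) has_field_derivative
      (Gamma z * Digamma z * Gamma (1 - z) + Gamma z * (Gamma (1 - z) * Digamma (1 - z) * (-1)))) (at z)"
    by (rule derivative_eq_intros refl ni | simp)+
  moreover have "((\<lambda>z. of_real pi / sin (of_real pi * z)) has_field_derivative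
      (- (of_real pi * (cos (of_real pi * z) * of_real pi) / (sin (of_real pi * z))\<^sup>2))) (at z)"
    by (rule derivative_eq_intros refl s0 | simp add: power2_eq_square)+
  ultimately have "Gamma z * Digamma z * Gamma (1 - z) + Gamma z * (Gamma (1 - z) * Digamma (1 - z) * (-1))
    = - (of_real pi * (cos (of_real pi * z) * of_real pi) / (sin (of_real pi * z))\<^sup>2)"
    unfolding Gamma_reflection_complex using DERIV_unique by blast
  hence "(Gamma z * Gamma (1 - z)) * (Digamma (1 - z) - Digamma z)
    = of_real pi / sin (of_real pi * z) * (pi * cot (pi * z))"
    by (simp add: algebra_simps cot_def power2_eq_square)
  hence refl: "Digamma (1 - z) - Digamma z = pi * cot (pi * z)"
    unfolding Gamma_reflection_complex using s0 by simp
  have "(\<lambda>n. (inverse (of_nat (Suc n)) - inverse ((1 - z) + of_nat n)) -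
      (inverse (of_nat (Suc n)) - inverse ((1 + z) + of_nat n)))
     sums ((Digamma (1 - z) + euler_mascheroni) - (Digamma (1 + z) + euler_mascheroni))"
    unfolding Digamma_def
    using sums_diff[OF summable_sums[OF summable_Digamma[OF n0(2)]] summable_sums[OF summable_Digamma[OF n0(3)]]]
    by simp
  moreover have "(inverse (of_nat (Suc n)) - inverse ((1 - z) + of_nat n)) -
      (inverse (of_nat (Suc n)) - inverse ((1 + z) + of_nat n)) = 2 * z / (z\<^sup>2 - (of_nat (Suc n))\<^sup>2)" for n
  proof -
    define m where "m = (of_nat (Suc n) :: complex)"
    have "z \<noteq> m" "z \<noteq> -m" using z unfolding m_def
      by (metis Ints_of_nat, metis Ints_minus Ints_of_nat)
    hence "m - z \<noteq> 0" "m + z \<noteq> 0" "z\<^sup>2 - m\<^sup>2 \<noteq> 0"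
      by (auto simp: power2_eq_iff algebra_simps eq_neg_iff_add_eq_0)
    hence "inverse (m + z) - inverse (m - z) = 2 * z / (z\<^sup>2 - m\<^sup>2)"
      by (simp add: field_simps power2_eq_square)
    thus ?thesis by (simp add: m_def algebra_simps)
  qed
  ultimately have "(\<lambda>n. 2 * z / (z\<^sup>2 - (of_nat (Suc n))\<^sup>2)) sums
      (Digamma (1 - z) - Digamma (1 + z))" by simp
  also have "Digamma (1 - z) - Digamma (1 + z) = pi * cot (pi * z) - 1 / z"
    using refl Digamma_plus1[OF z0] by (simp add: algebra_simps)
  finally show ?thesis .
qed

text \<open>Half the hyperbolic cotangent of \<open>u / 2\<close> is
  \<open>1 / (exp u - 1) + 1 / 2\<close>, so this is the cotangent series at
  \<open>z = u / (2 * pi * \<i>)\<close>; \<open>Re u > 0\<close> keeps \<open>z\<close> away from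
  the integers.\<close>

lemma bose_partial_fractions:
  fixes u :: complex
  assumes u: "Re u > 0"
  shows "(\<lambda>n. 2 * u / (u\<^sup>2 + 4 * pi\<^sup>2 * (of_nat (Suc n))\<^sup>2)) sums (1 / (exp u - 1) - 1 / u + 1 / 2)"
proof -
  define z where "z = u / (2 * pi * \<i>)"
  have zu: "u = 2 * pi * \<i> * z" by (simp add: z_def)
  have "z \<notin> \<int>"
  proof
    assume "z \<in> \<int>"
    then obtain k where "z = of_int k" by (auto elim: Ints_cases)
    with zu have "Re u = 0" by simp
    with u show False by simp
  qed
  from cot_partial_fractions[OF this]
  have "(\<lambda>n. 1 / (2 * pi * \<i>) * (2 * z / (z\<^sup>2 - (of_nat (Suc n))\<^sup>2))) sums
        (1 / (2 * pi * \<i>) * (pi * cot (pi * z) - 1 / z))"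
    by (rule sums_mult)
  moreover have "1 / (2 * pi * \<i>) * (2 * z / (z\<^sup>2 - (of_nat (Suc n))\<^sup>2))
      = 2 * u / (u\<^sup>2 + 4 * pi\<^sup>2 * (of_nat (Suc n))\<^sup>2)" for n
  proof -
    have "u\<^sup>2 + 4 * pi\<^sup>2 * (of_nat (Suc n))\<^sup>2 = - 4 * pi\<^sup>2 * (z\<^sup>2 - (of_nat (Suc n))\<^sup>2)"
      unfolding zu by (simp add: algebra_simps power2_eq_square)
    thus ?thesis unfolding zu
      by (simp add: divide_simps power2_eq_square) 
  qed
  moreover have "1 / (2 * pi * \<i>) * (pi * cot (pi * z) - 1 / z) = 1 / (exp u - 1) - 1 / u + 1 / 2"
  proof -
    have e1: "exp u \<noteq> 1" using u norm_exp_eq_Re[of u] by (metis exp_zero exp_inj_iff less_irrefl norm_one)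
    define w where "w = exp (\<i> * (pi * z))"
    have w0: "w \<noteq> 0" by (simp add: w_def)
    have w2: "w\<^sup>2 = exp u" unfolding w_def zu by (simp add: exp_double[symmetric] algebra_simps)
    have wi: "exp (- (\<i> * (pi * z))) = 1 / w" by (simp add: w_def exp_minus inverse_eq_divide)
    have "sin (pi * z) = (w - 1 / w) / (2 * \<i>)" "cos (pi * z) = (w + 1 / w) / 2"
      using wi by (simp_all add: sin_exp_eq cos_exp_eq w_def)
    hence "cot (pi * z) = \<i> * (w + 1 / w) / (w - 1 / w)"
      unfolding cot_def by (simp only:) (simp add: divide_simps)
    also have "\<dots> = \<i> * (exp u + 1) / (exp u - 1)"
      using w0 e1 unfolding w2[symmetric] by (simp add: divide_simps power2_eq_square)
    finally have c: "cot (pi * z) = \<i> * (exp u + 1) / (exp u - 1)" .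
    have "1 / (2 * pi * \<i>) * (1 / z) = 1 / u" unfolding zu by (simp add: field_simps)
    moreover have "1 / (2 * pi * \<i>) * (pi * cot (pi * z)) = 1 / (exp u - 1) + 1 / 2"
      unfolding c using e1 by (simp add: field_simps)
    ultimately show ?thesis by (simp add: algebra_simps)
  qed
  ultimately show ?thesis by simp
qed

text \<open>An alternating series is the full series minus twice its terms of odd index. Those have
  \<open>Suc n\<close> even, and doubled they form the full series at \<open>v / 2\<close>.\<close>

lemma csch_partial_fractions:
  fixes v :: complex
  assumes v: "Re v > 0"
  shows "(\<lambda>n. (-1) ^ n * (2 * v / (v\<^sup>2 + 4 * pi\<^sup>2 * (of_nat (Suc n))\<^sup>2))) sums
     (1 / v - 1 / (exp (v / 2) - exp (- (v / 2))))"
proof -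
  define a where "a n = 2 * v / (v\<^sup>2 + 4 * pi\<^sup>2 * (of_nat (Suc n))\<^sup>2)" for n
  have 1: "a sums (1 / (exp v - 1) - 1 / v + 1 / 2)"
    unfolding a_def by (rule bose_partial_fractions[OF v])
  have "(\<lambda>n. 2 * (v/2) / ((v/2)\<^sup>2 + 4 * pi\<^sup>2 * (of_nat (Suc n))\<^sup>2)) sums
      (1 / (exp (v/2) - 1) - 1 / (v/2) + 1 / 2)"
    by (rule bose_partial_fractions) (use v in simp)
  moreover have "2 * (v/2) / ((v/2)\<^sup>2 + 4 * pi\<^sup>2 * (of_nat (Suc n))\<^sup>2) = 2 * a (2 * n + 1)" for n
  proof -
    have e: "v\<^sup>2 + 4 * pi\<^sup>2 * (of_nat (Suc (2*n+1)))\<^sup>2 = 4 * ((v/2)\<^sup>2 + 4 * pi\<^sup>2 * (of_nat (Suc n))\<^sup>2)"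
      by (simp add: algebra_simps power2_eq_square)
    have "2 * (2 * v / (4 * y)) = 2 * (v / 2) / y" for y :: complex by (cases "y = 0") (simp_all add: field_simps)
    thus ?thesis unfolding a_def e by (rule sym)
  qed
  ultimately have "(\<lambda>n. 2 * a (2 * n + 1)) sums (1 / (exp (v/2) - 1) - 2 / v + 1 / 2)" by simp
  hence "(\<lambda>n. if odd (2*n+1) then 2 * a (2 * n + 1) else 0) sums (1 / (exp (v/2) - 1) - 2 / v + 1 / 2)" by simp
  hence "(\<lambda>n. if odd n then 2 * a n else 0) sums (1 / (exp (v/2) - 1) - 2 / v + 1 / 2)"
    by (subst (asm) sums_mono_reindex[where f = "\<lambda>n. if odd n then 2 * a n else 0"])
       (auto simp: strict_mono_def image_def elim: oddE)
  from sums_diff[OF 1 this]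
  have "(\<lambda>n. a n - (if odd n then 2 * a n else 0)) sums
     (1 / (exp v - 1) - 1 / v + 1 / 2 - (1 / (exp (v/2) - 1) - 2 / v + 1 / 2))" .
  moreover have "a n - (if odd n then 2 * a n else 0) = (-1) ^ n * a n" for n by auto
  moreover have "1 / (exp v - 1) - 1 / v + 1 / 2 - (1 / (exp (v/2) - 1) - 2 / v + 1 / 2)
    = 1 / v - 1 / (exp (v / 2) - exp (- (v / 2)))"
  proof -
    define w where "w = exp (v/2)"
    have "cmod w > 1" using v by (simp add: w_def)
    hence w: "w \<noteq> 0" "w\<^sup>2 \<noteq> 1" "w \<noteq> 1" by (auto simp: power2_eq_1_iff)
    have "exp v = w\<^sup>2" by (simp add: w_def exp_double[symmetric])
    moreover have "exp (- (v / 2)) = 1 / w" by (simp add: w_def exp_minus inverse_eq_divide)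
    moreover have "1 / (w\<^sup>2 - 1) - 1 / (w - 1) = - (1 / (w - 1 / w))"
    proof -
      have "w - 1 / w = (w\<^sup>2 - 1) / w" using w by (simp add: field_simps power2_eq_square)
      moreover have "w\<^sup>2 - 1 = (w - 1) * (w + 1)" by (simp add: algebra_simps power2_eq_square)
      moreover have "w + 1 \<noteq> 0" using w by (auto simp: power2_eq_1_iff eq_neg_iff_add_eq_0)
      ultimately show ?thesis using w by (simp add: divide_simps)
    qed
    ultimately show ?thesis unfolding w_def[symmetric] by (simp add: algebra_simps)
  qed
  ultimately show ?thesis by (simp add: a_def)
qed

text \<open>Domination by a product of two summable sequences makes the family absolutely summable
  over pairs, so both iterated sums agree. It serves the modular transformation and the logarithm of
  an infinite product alike.\<close>

lemma sums_swap:
  fixes f :: "nat \<Rightarrow> nat \<Rightarrow> complex"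
  assumes bd: "\<And>l m. norm (f l m) \<le> g l * h m"
    and g: "summable g" "\<And>l. g l \<ge> 0" and h: "summable h" "\<And>m. h m \<ge> 0"
    and A: "\<And>l. f l sums A l" and B: "\<And>m. (\<lambda>l. f l m) sums B m"
  obtains s where "A sums s" "B sums s"
proof -
  have bd': "norm (f l m) \<le> norm (g l) * norm (h m)" for l m
    using bd[of l m] by (metis abs_ge_self abs_mult order_trans real_norm_def)
  have gs: "summable (\<lambda>l. \<bar>g l\<bar>)" and hs: "summable (\<lambda>l. \<bar>h l\<bar>)"
    using g h by simp_all
  have "(\<lambda>(l,m). \<bar>g l\<bar> * \<bar>h m\<bar>) summable_on (UNIV \<times> UNIV)"
  proof (rule summable_on_SigmaI)
    show "((\<lambda>m. case (l, m) of (l, m) \<Rightarrow> \<bar>g l\<bar> * \<bar>h m\<bar>) has_sum (\<bar>g l\<bar> * (\<Sum>m. \<bar>h m\<bar>))) UNIV" for l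
      by (auto intro!: sums_nonneg_imp_has_sum sums_mult summable_sums hs)
    show "(\<lambda>l. \<bar>g l\<bar> * (\<Sum>m. \<bar>h m\<bar>)) summable_on UNIV"
      by (intro summable_on_cmult_left norm_summable_imp_summable_on) (use gs in simp)
  qed auto
  hence "(\<lambda>x. norm (case x of (l,m) \<Rightarrow> f l m)) summable_on (UNIV \<times> UNIV)"
    by (rule summable_on_comparison_test) (use bd' in \<open>auto simp: case_prod_unfold\<close>)
  hence "(\<lambda>(l,m). f l m) summable_on (UNIV \<times> UNIV)" by (rule abs_summable_summable)
  then obtain s where s: "((\<lambda>(l,m). f l m) has_sum s) (UNIV \<times> UNIV)"
    by (auto simp: summable_on_def)
  have Al: "((\<lambda>m. f l m) has_sum A l) UNIV" for l
  proof (rule norm_summable_imp_has_sum[OF _ A])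
    show "summable (\<lambda>m. norm (f l m))"
      by (rule summable_comparison_test[OF _ summable_mult[OF hs, of "\<bar>g l\<bar>"]]) (use bd' in auto)
  qed
  have Bm: "((\<lambda>l. f l m) has_sum B m) UNIV" for m
  proof (rule norm_summable_imp_has_sum[OF _ B])
    show "summable (\<lambda>l. norm (f l m))"
      by (rule summable_comparison_test[OF _ summable_mult2[OF gs, of "\<bar>h m\<bar>"]]) (use bd' in auto)
  qed
  have "(A has_sum s) UNIV"
    by (rule has_sum_SigmaD[OF s]) (use Al in simp)
  moreover have "(B has_sum s) UNIV"
    by (rule has_sum_SigmaD[OF iffD1[OF has_sum_swap s]]) (use Bm in simp)
  ultimately show ?thesis using that has_sum_imp_sums by blast
qed

text \<open>The form splits into the two linear factors
  \<open>k * t \<plusminus> 2 * pi * \<i> * m\<close>. The real part of a factor controls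
  \<open>k\<close>, and the triangle inequality then controls \<open>m\<close>; \<open>c\<close>
  takes half of each bound so that the two can be added.\<close>

lemma quadratic_lower_bound:
  fixes t :: complex
  assumes t: "Re t > 0"
  obtains c :: real where "c > 0" "\<And>k m. k \<ge> 1 \<Longrightarrow> m \<ge> 1 \<Longrightarrow>
    norm ((of_nat k)\<^sup>2 * t\<^sup>2 + 4 * pi\<^sup>2 * (of_nat m)\<^sup>2) \<ge> c * (real k + real m)\<^sup>2"
proof -
  define x where "x = Re t"
  define c where "c = min (x / 2) (pi * x / (x + cmod t))"
  have x: "x > 0" using t by (simp add: x_def)
  have c0: "c > 0" using x by (simp add: c_def add_pos_nonneg)
  have lin: "cmod (of_nat k * t + 2 * pi * e * \<i> * of_nat m) \<ge> c * (real k + real m)"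
    if "\<bar>e\<bar> = 1" for k m and e :: real
  proof -
    let ?w = "of_nat k * t + 2 * pi * e * \<i> * of_nat m"
    have 1: "cmod ?w \<ge> k * x"
      using complex_Re_le_cmod[of ?w] by (simp add: x_def)
    have "cmod (2 * pi * e * \<i> * of_nat m) \<le> cmod ?w + cmod (of_nat k * t)"
      using norm_triangle_ineq4[of ?w "of_nat k * t"] by simp
    hence "2 * pi * m \<le> cmod ?w + k * cmod t"
      using that by (simp add: norm_mult abs_mult)
    also have "k * cmod t \<le> (cmod ?w / x) * cmod t"
      using 1 x by (intro mult_right_mono) (auto simp: field_simps)
    finally have "2 * pi * m * x \<le> cmod ?w * (x + cmod t)" using x by (simp add: field_simps)
    hence 2: "cmod ?w \<ge> 2 * (pi * x / (x + cmod t)) * m"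
      using x by (simp add: add_pos_nonneg divide_le_eq algebra_simps)
    have "c \<le> x / 2" "c \<le> pi * x / (x + cmod t)"
      unfolding c_def by (rule min.cobounded1, rule min.cobounded2)
    hence 3: "c * k \<le> x / 2 * k" and 4: "c * m \<le> (pi * x / (x + cmod t)) * m"
      by (intro mult_right_mono; simp)+
    have "2 * (c * k) \<le> cmod ?w" using 1 3 by (simp add: algebra_simps)
    moreover have "2 * (c * m) \<le> cmod ?w" using 2 4 by linarith
    ultimately show ?thesis unfolding distrib_left by linarith
  qed
  show ?thesis
  proof (rule that[of "c\<^sup>2"])
    fix k m :: nat
    have "(of_nat k)\<^sup>2 * t\<^sup>2 + 4 * pi\<^sup>2 * (of_nat m)\<^sup>2 = (of_nat k * t + 2 * pi * (1::real) * \<i> * of_nat m) *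
       (of_nat k * t + 2 * pi * (-1::real) * \<i> * of_nat m)"
      by (simp add: algebra_simps power2_eq_square)
    hence "norm ((of_nat k)\<^sup>2 * t\<^sup>2 + 4 * pi\<^sup>2 * (of_nat m)\<^sup>2) =
      cmod (of_nat k * t + 2 * pi * (1::real) * \<i> * of_nat m) *
      cmod (of_nat k * t + 2 * pi * (-1::real) * \<i> * of_nat m)"
      by (simp only: norm_mult)
    also have "\<dots> \<ge> (c * (real k + real m)) * (c * (real k + real m))"
      by (intro mult_mono lin) (use c0 in auto)
    finally show "c\<^sup>2 * (real k + real m)\<^sup>2 \<le> norm ((of_nat k)\<^sup>2 * t\<^sup>2 + 4 * pi\<^sup>2 * (of_nat m)\<^sup>2)"
      by (simp add: power2_eq_square algebra_simps)
  qed (use c0 in simp)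
qed

text \<open>The double series behind the modular transformation converges only conditionally; pairing
  consecutive terms in the alternating index makes it absolutely convergent.\<close>
lemma paired_term_bound:
  fixes t :: complex
  assumes t: "Re t > 0"
  defines "\<phi> \<equiv> \<lambda>k m. 2 * t / ((of_nat k)\<^sup>2 * t\<^sup>2 + 4 * pi\<^sup>2 * (of_nat m)\<^sup>2)"
  obtains C :: real where "C > 0" "\<And>l m. norm (\<phi> (2*l+1) (Suc m) - \<phi> (2*l+2) (Suc m)) \<le>
    (C * Suc l powr (-3/2)) * Suc m powr (-3/2)"
proof -
  obtain c :: real where c: "c > 0" and cb: "\<And>k m. k \<ge> 1 \<Longrightarrow> m \<ge> 1 \<Longrightarrow>
    norm ((of_nat k)\<^sup>2 * t\<^sup>2 + 4 * pi\<^sup>2 * (of_nat m)\<^sup>2) \<ge> c * (real k + real m)\<^sup>2"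
    using quadratic_lower_bound[OF t] by metis
  define C where "C = 4 * cmod t ^ 3 / c\<^sup>2"
  have t0: "t \<noteq> 0" using t by auto
  have C0: "C > 0" using c t0 by (simp add: C_def)
  show ?thesis
  proof (rule that[of C])
    fix l m :: nat
    define k where "k = 2 * l + 1"
    define M where "M = Suc m"
    define D where "D j = (of_nat j)\<^sup>2 * t\<^sup>2 + 4 * pi\<^sup>2 * (of_nat M)\<^sup>2" for j :: nat
    define r where "r = real k + real M"
    have r: "r \<ge> 2" by (simp add: r_def k_def M_def)
    have D1: "norm (D k) \<ge> c * r\<^sup>2" unfolding D_def r_def by (rule cb) (auto simp: k_def M_def)
    have "norm (D (Suc k)) \<ge> c * (real (Suc k) + real M)\<^sup>2"
      unfolding D_def r_def by (rule cb) (auto simp: k_def M_def)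
    moreover have "c * (real (Suc k) + real M)\<^sup>2 \<ge> c * r\<^sup>2"
      using c by (intro mult_left_mono power_mono) (auto simp: r_def)
    ultimately have D2: "norm (D (Suc k)) \<ge> c * r\<^sup>2" by simp
    have cr: "c * r\<^sup>2 > 0" using c r by simp
    have Dnz: "D k \<noteq> 0" "D (Suc k) \<noteq> 0" using D1 D2 cr by auto
    have "\<phi> (2*l+1) M - \<phi> (2*l+2) M = 2 * t / D k - 2 * t / D (Suc k)"
      by (simp add: \<phi>_def D_def k_def)
    also have "\<dots> = 2 * t * (D (Suc k) - D k) / (D k * D (Suc k))"
      using Dnz by (simp add: divide_simps algebra_simps)
    also have "D (Suc k) - D k = of_nat (2 * k + 1) * t\<^sup>2"
      by (simp add: D_def algebra_simps power2_eq_square)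
    finally have "norm (\<phi> (2*l+1) M - \<phi> (2*l+2) M) = 2 * cmod t ^ 3 * real (2*k+1) / (norm (D k) * norm (D (Suc k)))"
      by (simp add: norm_mult norm_divide norm_power power2_eq_square power3_eq_cube del: of_nat_mult of_nat_add of_nat_Suc)
    also have "\<dots> \<le> 2 * cmod t ^ 3 * (2 * r) / ((c * r\<^sup>2) * (c * r\<^sup>2))"
    proof (intro frac_le mult_mono D1 D2)
      show "real (2*k+1) \<le> 2 * r" by (simp add: r_def M_def)
    qed (use cr r in auto)
    also have "\<dots> = C / r ^ 3"
      using c r by (simp add: C_def field_simps power2_eq_square power3_eq_cube)
    \<comment> \<open>Pairing has gained one power of \<open>r\<close>, so that the bound is of
      order \<open>r\<close> to the power -3. As \<open>r\<^sup>2\<close> dominates the product of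
      the two indices, this splits into two summable factors, as \<open>sums_swap\<close>
      requires.\<close>
    also have "\<dots> \<le> C / (Suc l powr (3/2) * Suc m powr (3/2))"
    proof (rule divide_left_mono)
      have "real (Suc l) * real (Suc m) \<le> r * r"
        by (intro mult_mono) (auto simp: r_def k_def M_def)
      hence "real (Suc l) * real (Suc m) \<le> r\<^sup>2"
        by (simp add: power2_eq_square)
      hence "(real (Suc l) * real (Suc m)) powr (3/2) \<le> (r\<^sup>2) powr (3/2)"
        by (intro powr_mono2) auto
      also have "(r\<^sup>2) powr (3/2) = r ^ 3"
      proof -
        have "(r powr 2) powr (3/2) = r powr 3" unfolding powr_powr by simp
        thus ?thesis using r by (simp only: powr_numeral)
      qed
      finally show "real (Suc l) powr (3/2) * real (Suc m) powr (3/2) \<le> r ^ 3"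
        by (simp add: powr_mult)
    qed (use C0 r in simp_all)
    also have "\<dots> = (C * Suc l powr (-3/2)) * Suc m powr (-3/2)"
      by (simp only: minus_divide_left[symmetric] powr_minus) (simp only: divide_inverse inverse_mult_distrib mult.assoc)
    finally show "norm (\<phi> (2*l+1) (Suc m) - \<phi> (2*l+2) (Suc m)) \<le> (C * Suc l powr (-3/2)) * Suc m powr (-3/2)"
      by (simp add: M_def)
  qed (rule C0)
qed

lemma sums_pair: "f sums s \<Longrightarrow> (\<lambda>n. f (2*n) + f (2*n+1)) sums s"
  using sums_group[of f s 2] by (simp add: mult.commute numeral_2_eq_2)

lemma summable_powr_minus: "summable (\<lambda>n. real (Suc n) powr (-3/2))"
proof -
  have "summable (\<lambda>n. real n powr (-3/2))" by (subst summable_real_powr_iff) simp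
  thus ?thesis by (subst summable_Suc_iff)
qed

text \<open>Both sides are the sum of \<open>(-1) ^ k * \<phi> (Suc k) (Suc m)\<close>. Summing over
  \<open>m\<close> first gives \<open>T\<close>, whose elementary parts produce the alternating sums
  \<open>pi\<^sup>2 / 12\<close> and \<open>ln 2\<close>; summing over \<open>k\<close> first gives
  \<open>U\<close>, whose elementary part produces \<open>pi\<^sup>2 / 6\<close>, divided by
  \<open>t'\<close>.\<close>

lemma lambert_modular:
  fixes t :: complex
  assumes t: "Re t > 0"
  assumes A: "(\<lambda>k. (-1)^k / of_nat (Suc k) * (1 / (exp (of_nat (Suc k) * t) - 1))) sums LA"
  defines "t' \<equiv> 4 * pi\<^sup>2 / t"
  assumes B: "(\<lambda>m. 1 / of_nat (Suc m) * (1 / (exp (of_nat (Suc m) * t' / 2) - exp (- (of_nat (Suc m) * t' / 2))))) sums LB"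
  shows "LA - pi\<^sup>2 / (12 * t) + of_real (ln 2) / 2 = t / 24 - LB"
proof -
  have t0: "t \<noteq> 0" using t by auto
  define \<phi> where "\<phi> k m = 2 * t / ((of_nat k)\<^sup>2 * t\<^sup>2 + 4 * pi\<^sup>2 * (of_nat m)\<^sup>2)" for k m :: nat
  define T where "T k = 1 / of_nat k * (1 / (exp (of_nat k * t) - 1) - 1 / (of_nat k * t) + 1 / 2)" for k :: nat
  define U where "U m = 1 / of_nat m * (1 / (of_nat m * t') - 1 / (exp (of_nat m * t' / 2) - exp (- (of_nat m * t' / 2))))" for m :: nat
  have T: "(\<lambda>m. \<phi> k (Suc m)) sums T k" if "k \<ge> 1" for k
  proof -
    have "(\<lambda>m. 1 / of_nat k * (2 * (of_nat k * t) / ((of_nat k * t)\<^sup>2 + 4 * pi\<^sup>2 * (of_nat (Suc m))\<^sup>2))) sums T k"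
      unfolding T_def by (intro sums_mult bose_partial_fractions) (use that t in auto)
    thus ?thesis using that by (simp add: \<phi>_def power_mult_distrib)
  qed
  have U: "(\<lambda>k. (-1)^k * \<phi> (Suc k) m) sums U m" if "m \<ge> 1" for m
  proof -
    define v where "v = of_nat m * t'"
    have Rt': "Re t' > 0" using t by (simp add: t'_def Re_divide complex_neq_0[symmetric] t0 del: of_real_mult of_real_power)
    have "Re v > 0" using that Rt' by (simp add: v_def)
    from sums_mult[OF csch_partial_fractions[OF this], of "1 / of_nat m"]
    have "(\<lambda>n. 1 / of_nat m * ((-1) ^ n * (2 * v / (v\<^sup>2 + 4 * pi\<^sup>2 * (of_nat (Suc n))\<^sup>2)))) sums U m"
      by (simp add: U_def v_def)
    moreover have "1 / of_nat m * ((-1) ^ n * (2 * v / (v\<^sup>2 + 4 * pi\<^sup>2 * (of_nat (Suc n))\<^sup>2)))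
      = (-1)^n * \<phi> (Suc n) m" for n
    proof -
      \<comment> \<open>Replacing \<open>t\<close> by \<open>t' = 4 * pi\<^sup>2 / t\<close>
        exchanges the two indices in the quadratic form, up to the factor \<open>c\<close>.\<close>
      define y where "y = (of_nat (Suc n))\<^sup>2 * t\<^sup>2 + 4 * pi\<^sup>2 * (of_nat m)\<^sup>2"
      define c where "c = 4 * (of_real pi)\<^sup>2 / t\<^sup>2"
      have c0: "c \<noteq> 0" using t0 by (simp add: c_def)
      have "v\<^sup>2 + 4 * pi\<^sup>2 * (of_nat (Suc n))\<^sup>2 = c * y"
        using t0 by (simp add: y_def c_def v_def t'_def field_simps power2_eq_square del: of_nat_Suc)
      moreover have "2 * v = c * (of_nat m * 2 * t)"
        using t0 by (simp add: c_def v_def t'_def field_simps power2_eq_square)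
      ultimately have "2 * v / (v\<^sup>2 + 4 * pi\<^sup>2 * (of_nat (Suc n))\<^sup>2) = of_nat m * 2 * t / y"
        using c0 by simp
      thus ?thesis using that by (simp add: \<phi>_def y_def)
    qed
    ultimately show ?thesis by simp
  qed
  obtain C where C: "C > 0" "\<And>l m. norm (\<phi> (2*l+1) (Suc m) - \<phi> (2*l+2) (Suc m)) \<le>
    (C * Suc l powr (-3/2)) * Suc m powr (-3/2)"
    using paired_term_bound[OF t] unfolding \<phi>_def by metis
  obtain s where s: "(\<lambda>l. T (2*l+1) - T (2*l+2)) sums s" "(\<lambda>m. U (Suc m)) sums s"
  proof (rule sums_swap[OF C(2)])
    show "summable (\<lambda>l. C * real (Suc l) powr (-3/2))" by (intro summable_mult summable_powr_minus)
    show "(\<lambda>m. \<phi> (2 * l + 1) (Suc m) - \<phi> (2 * l + 2) (Suc m)) sums (T (2 * l + 1) - T (2 * l + 2))" for l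
      by (intro sums_diff T) auto
    show "(\<lambda>l. \<phi> (2 * l + 1) (Suc m) - \<phi> (2 * l + 2) (Suc m)) sums U (Suc m)" for m
      using sums_pair[OF U[of "Suc m"]] by (simp add: power_mult)
  qed (use C summable_powr_minus in auto)
  have 1: "(\<lambda>k. (-1)^k * T (Suc k)) sums (LA - pi\<^sup>2 / (12 * t) + of_real (ln 2) / 2)"
  proof -
    have "(\<lambda>k. of_real ((-1)^k / real (Suc k))) sums (of_real (ln 2) :: complex)"
      by (subst sums_of_real_iff) (rule alternating_harmonic_series_sums)
    from sums_divide[OF this, of 2]
    have a: "(\<lambda>k. (-1)^k / of_nat (Suc k) / 2) sums (of_real (ln 2) / 2 :: complex)" by simp
    have sq: "(\<lambda>n. 1 / (real (Suc n))\<^sup>2) sums (pi\<^sup>2 / 6)" using inverse_squares_sums by (simp add: add.commute)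
    \<comment> \<open>The even denominators make up a quarter of \<open>pi\<^sup>2 / 6\<close>;
      subtracting them twice leaves the alternating sum \<open>pi\<^sup>2 / 12\<close>.\<close>
    have "(\<lambda>n. 2 * (1 / (real (Suc (2*n+1)))\<^sup>2)) sums (1 / 2 * (pi\<^sup>2 / 6))"
    proof -
      have "2 * (1 / (real (Suc (2*n+1)))\<^sup>2) = 1 / 2 * (1 / (real (Suc n))\<^sup>2)" for n
      proof -
        have "real (Suc (2*n+1)) = 2 * real (Suc n)" by simp
        thus ?thesis by (simp only: power_mult_distrib) simp
      qed
      thus ?thesis by (simp only:) (rule sums_mult[OF sq])
    qed
    hence "(\<lambda>n. if odd (2*n+1) then 2 * (1 / (real (Suc (2*n+1)))\<^sup>2) else 0) sums (1 / 2 * (pi\<^sup>2 / 6))" by simp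
    hence "(\<lambda>n. if odd n then 2 * (1 / (real (Suc n))\<^sup>2) else 0) sums (1 / 2 * (pi\<^sup>2 / 6))"
      by (subst (asm) sums_mono_reindex[where f = "\<lambda>n. if odd n then 2 * (1 / (real (Suc n))\<^sup>2) else 0"])
         (auto simp: strict_mono_def image_def, presburger)
    from sums_diff[OF sq this]
    have "(\<lambda>n. 1 / (real (Suc n))\<^sup>2 - (if odd n then 2 * (1 / (real (Suc n))\<^sup>2) else 0)) sums (pi\<^sup>2 / 12)" by simp
    moreover have "1 / (real (Suc n))\<^sup>2 - (if odd n then 2 * (1 / (real (Suc n))\<^sup>2) else 0) = (-1)^n / (real (Suc n))\<^sup>2" for n
      by auto
    ultimately have "(\<lambda>n. (-1)^n / (real (Suc n))\<^sup>2) sums (pi\<^sup>2 / 12)" by simp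
    hence "(\<lambda>n. of_real ((-1)^n / (real (Suc n))\<^sup>2)) sums (of_real (pi\<^sup>2 / 12) :: complex)"
      by (subst sums_of_real_iff)
    from sums_divide[OF this, of t]
    have b: "(\<lambda>n. (-1)^n / (of_nat (Suc n))\<^sup>2 / t) sums (pi\<^sup>2 / (12 * t))" by simp
    have "(-1)^k * T (Suc k) = (-1)^k / of_nat (Suc k) * (1 / (exp (of_nat (Suc k) * t) - 1))
        - (-1)^k / (of_nat (Suc k))\<^sup>2 / t + (-1)^k / of_nat (Suc k) / 2" for k
      unfolding T_def using t0 by (simp add: ring_distribs power2_eq_square del: of_nat_Suc)
    thus ?thesis using sums_add[OF sums_diff[OF A b] a] by simp
  qed
  have "(\<lambda>l. T (2*l+1) - T (2*l+2)) sums (LA - pi\<^sup>2 / (12 * t) + of_real (ln 2) / 2)"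
    using sums_pair[OF 1] by (simp add: power_mult)
  with s(1) have sA: "s = LA - pi\<^sup>2 / (12 * t) + of_real (ln 2) / 2" using sums_unique2 by blast
  have 2: "(\<lambda>m. U (Suc m)) sums (t / 24 - LB)"
  proof -
    have sq: "(\<lambda>n. 1 / (real (Suc n))\<^sup>2) sums (pi\<^sup>2 / 6)" using inverse_squares_sums by (simp add: add.commute)
    hence "(\<lambda>n. of_real (1 / (real (Suc n))\<^sup>2)) sums (of_real (pi\<^sup>2 / 6) :: complex)"
      by (subst sums_of_real_iff)
    from sums_divide[OF this, of t']
    have b: "(\<lambda>n. 1 / (of_nat (Suc n))\<^sup>2 / t') sums (t / 24)" 
      using t0 by (simp add: t'_def)
    have "U (Suc m) = 1 / (of_nat (Suc m))\<^sup>2 / t' - 1 / of_nat (Suc m) * (1 / (exp (of_nat (Suc m) * t' / 2) - exp (- (of_nat (Suc m) * t' / 2))))" for m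
      unfolding U_def by (simp add: ring_distribs power2_eq_square del: of_nat_Suc)
    thus ?thesis using sums_diff[OF b B] by simp
  qed
  with s(2) have "s = t / 24 - LB" using sums_unique2 by blast
  with sA show ?thesis by simp
qed

section \<open>Infinite products and their logarithms\<close>

lemma LIMSEQ_prodinf_one_plus:
  fixes w :: "nat \<Rightarrow> complex"
  assumes "summable (\<lambda>j. norm (w j))"
  shows "(\<lambda>n. \<Prod>j<n. 1 + w j) \<longlonglongrightarrow> (\<Prod>j. 1 + w j)"
proof -
  have "abs_convergent_prod (\<lambda>j. 1 + w j)"
    using assms by (simp add: abs_convergent_prod_conv_summable)
  hence "convergent_prod (\<lambda>j. 1 + w j)" by (rule abs_convergent_prod_imp_convergent_prod)
  from convergent_prod_LIMSEQ[OF this] show ?thesis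
    by (subst LIMSEQ_lessThan_iff_atMost)
qed

lemma norm_prodinf_minus_one_le:
  fixes w :: "nat \<Rightarrow> complex"
  assumes "(\<lambda>j. norm (w j)) sums s"
  shows "norm ((\<Prod>j. 1 + w j) - 1) \<le> exp s - 1"
proof (rule LIMSEQ_le_const2)
  show "(\<lambda>n. norm ((\<Prod>j<n. 1 + w j) - 1)) \<longlonglongrightarrow> norm ((\<Prod>j. 1 + w j) - 1)"
    by (intro tendsto_intros LIMSEQ_prodinf_one_plus sums_summable[OF assms])
  have "norm ((\<Prod>j<n. 1 + w j) - 1) \<le> exp s - 1" for n
  proof -
    have "norm ((\<Prod>j<n. 1 + w j) - 1) \<le> (\<Prod>j<n. 1 + norm (w j)) - 1"
      by (rule norm_prod_minus1_le_prod_minus1)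
    also have "(\<Prod>j<n. 1 + norm (w j)) \<le> exp (\<Sum>j<n. norm (w j))"
      by (rule prod_le_exp_sum) auto
    also have "(\<Sum>j<n. norm (w j)) \<le> s"
      using sum_le_suminf[OF sums_summable[OF assms]] sums_unique[OF assms] by simp
    finally show ?thesis by simp
  qed
  thus "\<exists>N. \<forall>n\<ge>N. norm ((\<Prod>j<n. 1 + w j) - 1) \<le> exp s - 1" by blast
qed

lemma norm_prodinf_le:
  fixes w :: "nat \<Rightarrow> complex"
  assumes "(\<lambda>j. norm (w j)) sums s"
  shows "norm (\<Prod>j. 1 + w j) \<le> exp s"
  using norm_prodinf_minus_one_le[OF assms] norm_triangle_sub[of "\<Prod>j. 1 + w j" 1] by simp

text \<open>Each \<open>ln (1 + w j)\<close> is expanded and the sum over \<open>j\<close> is taken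
  first, which turns the product into a Lambert series. The conclusion is exponentiated, so no
  branch of the logarithm of the product has to be chosen.\<close>

lemma prodinf_log_series:
  fixes w :: "nat \<Rightarrow> complex"
  assumes w: "\<And>j. norm (w j) \<le> r ^ Suc j" and r: "0 < r" "r < 1"
    and S: "\<And>k. (\<lambda>j. w j ^ Suc k) sums S k"
  obtains s where "(\<lambda>k. (-1)^k / of_nat (Suc k) * S k) sums s" "(\<Prod>j. 1 + w j) = exp s"
proof -
  have w1: "norm (w j) < 1" for j
    using w[of j] power_Suc_less_one[OF r, of j] by simp
  have r1: "norm r < 1" using r by simp
  have sw: "summable (\<lambda>j. norm (w j))"
    by (rule summable_comparison_test[OF _ summable_mult[OF summable_geometric[OF r1], of r]]) (use w in auto)
  obtain s where s: "(\<lambda>j. ln (1 + w j)) sums s" "(\<lambda>k. (-1)^k / of_nat (Suc k) * S k) sums s"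
  proof (rule sums_swap[where g = "\<lambda>j. r ^ j" and h = "\<lambda>j. r ^ j" and f = "\<lambda>j k. (-1)^k / of_nat (Suc k) * w j ^ Suc k"])
    show "norm ((-1)^k / of_nat (Suc k) * w j ^ Suc k) \<le> r ^ j * r ^ k" for j k
    proof -
      have "norm ((-1)^k / of_nat (Suc k) * w j ^ Suc k) = norm (w j) ^ Suc k / real (Suc k)"
        by (simp add: norm_mult norm_divide norm_power del: of_nat_Suc power_Suc)
      also have "\<dots> \<le> norm (w j) ^ Suc k / 1"
        by (intro divide_left_mono) auto
      also have "\<dots> \<le> (r ^ Suc j) ^ Suc k" by (simp only: div_by_1) (intro power_mono w norm_ge_zero)
      also have "\<dots> = r ^ (Suc j * Suc k)" by (rule power_mult[symmetric])
      also have "\<dots> \<le> r ^ (j + k)" using r by (intro power_decreasing) auto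
      finally show ?thesis by (simp add: power_add)
    qed
    show "(\<lambda>k. (-1)^k / of_nat (Suc k) * w j ^ Suc k) sums ln (1 + w j)" for j
    proof -
      have "(\<lambda>n. (-1)^Suc n / of_nat n * w j ^ n) sums ln (1 + w j)" by (rule Ln_series[OF w1])
      thus ?thesis using sums_Suc_iff[of "\<lambda>n. (-1)^Suc n / of_nat n * w j ^ n" "ln (1 + w j)"] by simp
    qed
    show "(\<lambda>j. (-1)^k / of_nat (Suc k) * w j ^ Suc k) sums ((-1)^k / of_nat (Suc k) * S k)" for k
      by (intro sums_mult S)
  qed (use r r1 in \<open>auto intro!: summable_geometric\<close>)
  have "(\<lambda>n. exp (\<Sum>j<n. ln (1 + w j))) \<longlonglongrightarrow> exp s"
    using s(1) unfolding sums_def by (rule tendsto_exp)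
  moreover have "exp (\<Sum>j<n. ln (1 + w j)) = (\<Prod>j<n. 1 + w j)" for n
  proof -
    have "exp (ln (1 + w j)) = 1 + w j" for j
    proof (rule exp_Ln)
      show "1 + w j \<noteq> 0" using w1[of j] by (metis add.commute add_eq_0_iff2 norm_minus_cancel norm_one order_less_irrefl)
    qed
    thus ?thesis by (simp add: exp_sum)
  qed
  ultimately have "(\<lambda>n. \<Prod>j<n. 1 + w j) \<longlonglongrightarrow> exp s" by simp
  hence "(\<Prod>j. 1 + w j) = exp s" using LIMSEQ_prodinf_one_plus[OF sw] LIMSEQ_unique by blast
  with s(2) show ?thesis using that by blast
qed

text \<open>Weber's modular functions; \<open>\<ff>\<^sub>2\<close> is the generating function of \<open>q\<close> up to an elementary factor.\<close>
definition \<ff>\<^sub>2 :: "complex \<Rightarrow> complex" where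
  "\<ff>\<^sub>2 \<tau> = sqrt 2 * exp (\<i> * pi * \<tau> / 12) * (\<Prod>n. 1 + exp (2 * \<i> * pi * \<tau>) ^ Suc n)"

text \<open>Factors are written \<open>1 + - x\<close> to match the lemmas on products of
  \<open>1 + w j\<close>.\<close>

definition \<ff>\<^sub>1 :: "complex \<Rightarrow> complex" where
  "\<ff>\<^sub>1 \<tau> = exp (- (\<i> * pi * \<tau> / 24)) * (\<Prod>n. 1 + - (exp (\<i> * pi * \<tau>) ^ (2 * n + 1)))"

definition \<ff> :: "complex \<Rightarrow> complex" where
  "\<ff> \<tau> = exp (- (\<i> * pi * \<tau> / 24)) * (\<Prod>n. 1 + exp (\<i> * pi * \<tau>) ^ (2 * n + 1))"

lemma norm_nome: "norm (exp (\<i> * pi * \<tau>)) = exp (- pi * Im \<tau>)"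
  by (simp add: mult_ac)

lemma geometric_sums_Suc:
  fixes z :: "'a :: real_normed_field"
  assumes "norm z < 1"
  shows "(\<lambda>n. z ^ Suc n) sums (z / (1 - z))"
  using sums_mult[OF geometric_sums[OF assms], of z] by (simp add: divide_inverse)

lemma geometric_sums_odd:
  fixes z :: "'a :: real_normed_field"
  assumes "norm z < 1"
  shows "(\<lambda>n. z ^ (2 * n + 1)) sums (z / (1 - z\<^sup>2))"
proof -
  have "norm (z\<^sup>2) < 1" using assms by (simp add: norm_power power_less_one_iff)
  from sums_mult[OF geometric_sums[OF this], of z] show ?thesis
    by (simp add: divide_inverse power_mult)
qed

lemma prod_lessThan_double: "(\<Prod>n<2*M. f n) = (\<Prod>n<M. f (2*n) * f (2*n+1))" for f :: "nat \<Rightarrow> 'a::comm_monoid_mult"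
  by (induction M) (simp_all add: mult_ac)

text \<open>This is Euler's identity between partitions into distinct and into odd parts.\<close>
lemma weber_product:
  assumes \<tau>: "Im \<tau> > 0"
  shows "\<ff> \<tau> * \<ff>\<^sub>1 \<tau> * \<ff>\<^sub>2 \<tau> = sqrt 2"
proof -
  define p where "p = exp (\<i> * pi * \<tau>)"
  define z where "z = p\<^sup>2"
  have p: "norm p < 1" using \<tau> by (simp add: p_def norm_nome)
  have z: "norm z < 1" using p by (simp add: z_def norm_power power_less_one_iff)
  have zp: "exp (2 * \<i> * pi * \<tau>) = z" by (simp add: z_def p_def exp_double[symmetric] mult_ac)
  have so: "summable (\<lambda>n. norm (p ^ (2 * n + 1)))"
    unfolding norm_power by (rule sums_summable[OF geometric_sums_odd]) (use p in simp)
  have se: "summable (\<lambda>n. norm (z ^ Suc n))"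
    unfolding norm_power by (rule sums_summable[OF geometric_sums_Suc]) (use z in simp)
  \<comment> \<open>The finite products collapse only after multiplication by this one, so its limit
    must be nonzero to be cancelled at the end; it is nonzero because it is an exponential.\<close>
  define D where "D n = (\<Prod>j<n. 1 + - (z ^ Suc j))" for n
  obtain d where d: "D \<longlonglongrightarrow> d" "d \<noteq> 0"
  proof -
    have zk: "norm (z ^ Suc k) < 1" for k using z power_le_one[of "norm z" k]
      by (simp add: norm_mult norm_power) (metis mult_left_le norm_ge_zero order_le_less_trans)
    have S: "(\<lambda>j. (- (z ^ Suc j)) ^ Suc k) sums ((-1) ^ Suc k * (z ^ Suc k / (1 - z ^ Suc k)))" for k
    proof -
      have "(- (z ^ Suc j)) ^ Suc k = (-1) ^ Suc k * (z ^ Suc k) ^ Suc j" for j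
        unfolding power_minus[of "z ^ Suc j"] by (simp only: power_mult[symmetric] mult.commute)
      thus ?thesis by (simp only:) (intro sums_mult geometric_sums_Suc zk)
    qed
    have "norm (- (z ^ Suc j)) \<le> norm z ^ Suc j" for j by (simp add: norm_power norm_mult)
    then obtain s where "(\<Prod>j. 1 + - (z ^ Suc j)) = exp s"
      using prodinf_log_series[OF _ _ z S] by (auto simp: z_def p_def)
    moreover have "D \<longlonglongrightarrow> (\<Prod>j. 1 + - (z ^ Suc j))"
      unfolding D_def by (rule LIMSEQ_prodinf_one_plus) (use se in simp)
    ultimately show ?thesis using that by simp
  qed
  have fin: "(\<Prod>n<M. 1 + p ^ (2*n+1)) * (\<Prod>n<M. 1 + - (p ^ (2*n+1))) * (\<Prod>n<M. 1 + z ^ Suc n) * D M = D (2 * M)" for M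
  proof -
    have "(1 + p ^ (2*n+1)) * (1 + - (p ^ (2*n+1))) * (1 + z ^ Suc n) * (1 + - (z ^ Suc n))
       = (1 + - (z ^ Suc (2*n))) * (1 + - (z ^ Suc (2*n+1)))" for n
    proof -
      have "(1 + p ^ (2*n+1)) * (1 + - (p ^ (2*n+1))) = 1 + - ((p ^ (2*n+1)) * (p ^ (2*n+1)))"
        by (simp only: ring_distribs) simp
      also have "(p ^ (2*n+1)) * (p ^ (2*n+1)) = z ^ Suc (2*n)"
        unfolding z_def power_mult[symmetric] power_add[symmetric] by (rule arg_cong[of _ _ "power p"]) simp
      finally have 1: "(1 + p ^ (2*n+1)) * (1 + - (p ^ (2*n+1))) = 1 + - (z ^ Suc (2*n))" .
      have "(1 + z ^ Suc n) * (1 + - (z ^ Suc n)) = 1 + - (z ^ Suc n * z ^ Suc n)"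
        by (simp only: ring_distribs) simp
      also have "z ^ Suc n * z ^ Suc n = z ^ Suc (2*n+1)"
        unfolding power_add[symmetric] by (rule arg_cong[of _ _ "power z"]) simp
      finally show ?thesis using 1 by (simp only: mult.assoc)
    qed
    thus ?thesis unfolding D_def prod_lessThan_double by (simp only: prod.distrib[symmetric])
  qed
  define P where "P = (\<Prod>n. 1 + p ^ (2*n+1)) * (\<Prod>n. 1 + - (p ^ (2*n+1))) * (\<Prod>n. 1 + z ^ Suc n)"
  have "(\<lambda>M. (\<Prod>n<M. 1 + p ^ (2*n+1)) * (\<Prod>n<M. 1 + - (p ^ (2*n+1))) * (\<Prod>n<M. 1 + z ^ Suc n) * D M)
      \<longlonglongrightarrow> P * d"
    unfolding P_def by (intro tendsto_mult LIMSEQ_prodinf_one_plus d se so) (use so in simp)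
  moreover have "(\<lambda>M. D (2 * M)) \<longlonglongrightarrow> d"
    using LIMSEQ_subseq_LIMSEQ[OF d(1), of "\<lambda>M. 2 * M"] by (simp add: strict_mono_def o_def)
  ultimately have "P * d = d" unfolding fin by (rule LIMSEQ_unique)
  hence "P = 1" using d by simp
  moreover have "exp (- (\<i> * pi * \<tau> / 24)) * exp (- (\<i> * pi * \<tau> / 24)) * exp (\<i> * pi * \<tau> / 12) = 1"
    unfolding exp_add[symmetric] by simp
  moreover have "\<ff> \<tau> * \<ff>\<^sub>1 \<tau> * \<ff>\<^sub>2 \<tau> = sqrt 2 * (exp (- (\<i> * pi * \<tau> / 24)) * exp (- (\<i> * pi * \<tau> / 24)) * exp (\<i> * pi * \<tau> / 12)) * P"
    unfolding \<ff>_def \<ff>\<^sub>1_def \<ff>\<^sub>2_def P_def p_def[symmetric] zp by (simp only: mult_ac)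
  ultimately show ?thesis by simp
qed

text \<open>The translation negates \<open>exp (\<i> * pi * \<tau>)\<close>, which exchanges the two
  products over odd powers. The prefactors change by roots of unity, which the norms
  suppress.\<close>

lemma \<ff>_plus_one: "norm (\<ff> (\<tau> + 1)) = norm (\<ff>\<^sub>1 \<tau>)"
  and \<ff>\<^sub>1_plus_one: "norm (\<ff>\<^sub>1 (\<tau> + 1)) = norm (\<ff> \<tau>)"
  and \<ff>\<^sub>2_plus_one: "norm (\<ff>\<^sub>2 (\<tau> + 1)) = norm (\<ff>\<^sub>2 \<tau>)"
proof -
  have e: "exp (\<i> * pi * (\<tau> + 1)) = - exp (\<i> * pi * \<tau>)"
    by (simp add: distrib_left exp_add)
  have dbl: "exp (2 * \<i> * pi * x) = (exp (\<i> * pi * x))\<^sup>2" for x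
    by (metis exp_double mult.assoc)
  have e2: "exp (2 * \<i> * pi * (\<tau> + 1)) = exp (2 * \<i> * pi * \<tau>)"
    unfolding dbl e by simp
  show "norm (\<ff> (\<tau> + 1)) = norm (\<ff>\<^sub>1 \<tau>)" "norm (\<ff>\<^sub>1 (\<tau> + 1)) = norm (\<ff> \<tau>)"
    "norm (\<ff>\<^sub>2 (\<tau> + 1)) = norm (\<ff>\<^sub>2 \<tau>)"
    unfolding \<ff>_def \<ff>\<^sub>1_def \<ff>\<^sub>2_def e e2 by (simp_all add: norm_mult)
qed

text \<open>With \<open>t = 2 * \<i> * pi / \<tau>\<close> both products become exponentials of the
  two Lambert series, and \<open>lambert_modular\<close> equates the exponents. The term
  \<open>ln 2 / 2\<close> there is the logarithm of the factor \<open>sqrt 2\<close> in the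
  definition of \<open>\<ff>\<^sub>2\<close>.\<close>

lemma \<ff>\<^sub>2_neg_inverse:
  assumes \<tau>: "Im \<tau> > 0"
  shows "\<ff>\<^sub>2 (-1 / \<tau>) = \<ff>\<^sub>1 \<tau>"
proof -
  have \<tau>0: "\<tau> \<noteq> 0" using \<tau> by auto
  define t where "t = 2 * \<i> * pi / \<tau>"
  define t' where "t' = 4 * pi\<^sup>2 / t"
  have t'\<tau>: "t' = - (2 * \<i> * pi * \<tau>)"
    using \<tau>0 by (simp add: t'_def t_def field_simps power2_eq_square)
  have Ret: "Re t > 0"
    using \<tau> \<tau>0 by (auto simp: t_def Re_divide complex_neq_0[symmetric] cmod_power2[symmetric] intro!: divide_pos_pos)
  have Ret': "Re t' > 0" using \<tau> by (simp add: t'\<tau>)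
  define p where "p = exp (- (t' / 2))"
  define r where "r = norm p"
  have r: "0 < r" "r < 1" using Ret' by (simp_all add: r_def p_def)
  define z where "z = exp (- t)"
  have z: "0 < norm z" "norm z < 1" using Ret by (simp_all add: z_def)
  obtain LA where LA: "(\<lambda>k. (-1)^k / of_nat (Suc k) * (1 / (exp (of_nat (Suc k) * t) - 1))) sums LA"
    "(\<Prod>j. 1 + z ^ Suc j) = exp LA"
  proof (rule prodinf_log_series)
    show "(\<lambda>j. (z ^ Suc j) ^ Suc k) sums (1 / (exp (of_nat (Suc k) * t) - 1))" for k
    proof -
      have "norm (z ^ Suc k) < 1"
        unfolding norm_power using power_Suc_less_one[OF z] .
      from geometric_sums_Suc[OF this]
      have "(\<lambda>j. (z ^ Suc j) ^ Suc k) sums (z ^ Suc k / (1 - z ^ Suc k))"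
        by (simp only: power_mult[symmetric] mult.commute)
      also have "z ^ Suc k / (1 - z ^ Suc k) = 1 / (exp (of_nat (Suc k) * t) - 1)"
      proof -
        define w where "w = exp (of_nat (Suc k) * t)"
        have eq: "z ^ Suc k = 1 / w"
          by (simp add: z_def w_def exp_of_nat_mult exp_minus inverse_eq_divide power_divide del: power_Suc of_nat_Suc)
        have "w \<noteq> 0" by (simp add: w_def)
        moreover have "w \<noteq> 1" using \<open>norm (z ^ Suc k) < 1\<close> eq by auto
        ultimately show ?thesis unfolding w_def[symmetric] eq by (simp add: divide_simps)
      qed
      finally show ?thesis .
    qed
  qed (use z in \<open>auto simp: norm_power norm_mult\<close>)
  obtain LB where LB: "(\<lambda>k. (-1)^k / of_nat (Suc k) * ((-1)^Suc k * (1 / (exp (of_nat (Suc k) * t' / 2) - exp (- (of_nat (Suc k) * t' / 2)))))) sums LB"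
    "(\<Prod>j. 1 + - (p ^ (2 * j + 1))) = exp LB"
  proof (rule prodinf_log_series)
    show "norm (- (p ^ (2 * j + 1))) \<le> r ^ Suc j" for j
      using r by (auto simp: norm_power norm_mult r_def[symmetric] intro!: mult_left_mono power_decreasing)
    show "(\<lambda>j. (- (p ^ (2 * j + 1))) ^ Suc k) sums ((-1)^Suc k * (1 / (exp (of_nat (Suc k) * t' / 2) - exp (- (of_nat (Suc k) * t' / 2)))))" for k
    proof -
      have pk: "norm (p ^ Suc k) < 1"
        unfolding norm_power using power_Suc_less_one[of r k] r by (simp add: r_def)
      have "(- (p ^ (2 * j + 1))) ^ Suc k = (-1) ^ Suc k * (p ^ Suc k) ^ (2 * j + 1)" for j
        unfolding power_minus[of "p ^ (2 * j + 1)"] by (simp only: power_mult[symmetric] mult.commute)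
      moreover have "(\<lambda>j. (-1) ^ Suc k * (p ^ Suc k) ^ (2 * j + 1)) sums ((-1) ^ Suc k * (p ^ Suc k / (1 - (p ^ Suc k)\<^sup>2)))"
        by (intro sums_mult geometric_sums_odd pk)
      moreover have "p ^ Suc k / (1 - (p ^ Suc k)\<^sup>2) = 1 / (exp (of_nat (Suc k) * t' / 2) - exp (- (of_nat (Suc k) * t' / 2)))"
      proof -
        define w where "w = exp (of_nat (Suc k) * t' / 2)"
        have e: "p ^ Suc k = exp (- (of_nat (Suc k) * t' / 2))"
          by (simp only: p_def exp_of_nat_mult[symmetric] mult_minus_right times_divide_eq_right)
        have e': "exp (- (of_nat (Suc k) * t' / 2)) = 1 / w"
          by (simp only: w_def exp_minus inverse_eq_divide)
        have w0: "w \<noteq> 0" by (simp add: w_def)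
        have "w\<^sup>2 \<noteq> 1"
        proof
          assume "w\<^sup>2 = 1"
          hence "norm w ^ 2 = 1" by (metis norm_one norm_power)
          thus False using pk unfolding e e' using norm_ge_zero[of w] by (auto simp: norm_divide power2_eq_1_iff)
        qed
        moreover have "w - 1 / w = (w\<^sup>2 - 1) / w" using w0 by (simp add: field_simps power2_eq_square)
        ultimately show ?thesis unfolding e e' w_def[symmetric] using w0
          by (simp add: divide_simps power2_eq_square)
      qed
      ultimately show ?thesis by (simp only:)
    qed
  qed (use r in auto)
  have LB': "(\<lambda>k. 1 / of_nat (Suc k) * (1 / (exp (of_nat (Suc k) * t' / 2) - exp (- (of_nat (Suc k) * t' / 2))))) sums (- LB)"
  proof -
    have "- ((-1)^k / of_nat (Suc k) * ((-1)^Suc k * X)) = 1 / of_nat (Suc k) * X" for k and X :: complex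
      by (simp add: power_mult_distrib[symmetric] flip: power_add mult.assoc)
    with sums_minus[OF LB(1)] show ?thesis by simp
  qed
  have "LA - pi\<^sup>2 / (12 * t) + of_real (ln 2) / 2 = t / 24 - (- LB)"
    by (rule lambert_modular[OF Ret LA(1)]) (use LB' in \<open>simp only: t'_def\<close>)
  hence key: "of_real (ln 2 / 2) + - (t / 24) + LA = pi\<^sup>2 / (12 * t) + LB"
    by (simp add: algebra_simps)
  have "\<ff>\<^sub>2 (-1 / \<tau>) = exp (of_real (ln 2 / 2)) * exp (- (t / 24)) * exp LA"
  proof -
    have "exp (2 * \<i> * pi * (-1 / \<tau>)) = z" "\<i> * pi * (-1 / \<tau>) / 12 = - (t / 24)" by (simp_all add: z_def t_def)
    moreover have "exp (ln 2 / 2) = sqrt 2"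
      by (metis exp_ln exp_ge_zero powr_def powr_half_sqrt rel_simps(51) mult.commute zero_less_numeral zero_le_numeral times_divide_eq_right mult.right_neutral zero_neq_numeral)
    hence "exp (complex_of_real (ln 2 / 2)) = sqrt 2" by (metis exp_of_real)
    ultimately show ?thesis unfolding \<ff>\<^sub>2_def LA(2)[symmetric] by (simp only:)
  qed
  also have "\<dots> = exp (pi\<^sup>2 / (12 * t) + LB)" unfolding key[symmetric] exp_add ..
  also have "\<dots> = \<ff>\<^sub>1 \<tau>"
  proof -
    have "pi\<^sup>2 / (12 * t) = - (\<i> * pi * \<tau> / 24)"
      using \<tau>0 by (simp add: t_def field_simps power2_eq_square)
    moreover have "exp (\<i> * pi * \<tau>) = p" by (simp add: p_def t'\<tau> mult.assoc)
    ultimately show ?thesis unfolding \<ff>\<^sub>1_def exp_add LB(2)[symmetric] by (simp only:)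
  qed
  finally show ?thesis .
qed

lemma Im_neg_inverse: "Im (-1 / \<tau>) = Im \<tau> / (norm \<tau>)\<^sup>2"
  by (simp add: Im_divide cmod_power2)

lemma \<ff>\<^sub>1_neg_inverse:
  assumes "Im \<tau> > 0"
  shows "\<ff>\<^sub>1 (-1 / \<tau>) = \<ff>\<^sub>2 \<tau>"
proof -
  have "Im (-1 / \<tau>) > 0" using assms unfolding Im_neg_inverse by (intro divide_pos_pos) auto
  from \<ff>\<^sub>2_neg_inverse[OF this] show ?thesis by simp
qed

text \<open>The product of the three functions is a nonzero constant and the inversion exchanges the
  other two, so the third is invariant.\<close>

lemma \<ff>_neg_inverse:
  assumes "Im \<tau> > 0"
  shows "\<ff> (-1 / \<tau>) = \<ff> \<tau>"
proof -
  have "Im (-1 / \<tau>) > 0" using assms unfolding Im_neg_inverse by (intro divide_pos_pos) auto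
  from weber_product[OF this, unfolded \<ff>\<^sub>2_neg_inverse[OF assms] \<ff>\<^sub>1_neg_inverse[OF assms]] weber_product[OF assms]
  have "\<ff> (-1 / \<tau>) * (\<ff>\<^sub>1 \<tau> * \<ff>\<^sub>2 \<tau>) = \<ff> \<tau> * (\<ff>\<^sub>1 \<tau> * \<ff>\<^sub>2 \<tau>)"
    by (simp only: mult_ac)
  moreover have "\<ff>\<^sub>1 \<tau> * \<ff>\<^sub>2 \<tau> \<noteq> 0" using weber_product[OF assms] by auto
  ultimately show ?thesis by simp
qed

section \<open>Reduction to the fundamental domain\<close>

lemma norm_\<ff>\<^sub>2_plus_int: "norm (\<ff>\<^sub>2 (\<tau> + of_int n)) = norm (\<ff>\<^sub>2 \<tau>)"
proof (induction n arbitrary: \<tau> rule: int_induct[where k = 0])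
  case (step1 i)
  from step1(2)[of "\<tau> + 1"] \<ff>\<^sub>2_plus_one[of \<tau>] show ?case by (simp add: add_ac)
next
  case (step2 i)
  from step2(2)[of "\<tau> - 1"] \<ff>\<^sub>2_plus_one[of "\<tau> - 1"] show ?case by (simp add: algebra_simps)
qed auto

lemma norm_\<ff>_plus_int:
  "norm (\<ff> (\<tau> + of_int n)) = (if even n then norm (\<ff> \<tau>) else norm (\<ff>\<^sub>1 \<tau>)) \<and>
   norm (\<ff>\<^sub>1 (\<tau> + of_int n)) = (if even n then norm (\<ff>\<^sub>1 \<tau>) else norm (\<ff> \<tau>))"
proof (induction n arbitrary: \<tau> rule: int_induct[where k = 0])
  case (step1 i)
  from step1(2)[of "\<tau> + 1"] \<ff>_plus_one[of \<tau>] \<ff>\<^sub>1_plus_one[of \<tau>] show ?case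
    by (simp add: add_ac)
next
  case (step2 i)
  from step2(2)[of "\<tau> - 1"] \<ff>_plus_one[of "\<tau> - 1"] \<ff>\<^sub>1_plus_one[of "\<tau> - 1"] show ?case
    by (simp add: algebra_simps)
qed auto

text \<open>Up to absolute value, \<open>SL\<^sub>2(\<int>)\<close> permutes the three Weber functions, and the parities of \<open>c\<close> and \<open>a\<close>
  tell which one \<open>\<ff>\<^sub>2\<close> becomes under \<open>\<tau>' = (a * \<tau> + b) / (c * \<tau> + d)\<close>.\<close>
definition \<ff>\<^sub>2_transport :: "complex \<Rightarrow> int \<Rightarrow> int \<Rightarrow> int \<Rightarrow> int \<Rightarrow> complex \<Rightarrow> bool" where
  "\<ff>\<^sub>2_transport \<tau> a b c d \<tau>' \<longleftrightarrow> a * d - b * c = 1 \<and> Im \<tau>' > 0 \<and>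
     \<tau>' * (of_int c * \<tau> + of_int d) = of_int a * \<tau> + of_int b \<and>
     norm (\<ff>\<^sub>2 \<tau>) = (if even c then norm (\<ff>\<^sub>2 \<tau>') else if even a then norm (\<ff>\<^sub>1 \<tau>') else norm (\<ff> \<tau>'))"

lemma \<ff>\<^sub>2_transport_translate:
  assumes "\<ff>\<^sub>2_transport \<tau> a b c d \<tau>'"
  shows "\<ff>\<^sub>2_transport \<tau> (a + n * c) (b + n * d) c d (\<tau>' + of_int n)"
  using assms norm_\<ff>\<^sub>2_plus_int[of \<tau>' n] norm_\<ff>_plus_int[of \<tau>' n]
  unfolding \<ff>\<^sub>2_transport_def by (auto simp: algebra_simps)

lemma \<ff>\<^sub>2_transport_invert:
  assumes "\<ff>\<^sub>2_transport \<tau> a b c d \<tau>'"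
  shows "\<ff>\<^sub>2_transport \<tau> (-c) (-d) a b (-1 / \<tau>')"
proof -
  have pos: "Im \<tau>' > 0" using assms by (simp add: \<ff>\<^sub>2_transport_def)
  have "\<tau>' \<noteq> 0" using pos by auto
  moreover have "Im (-1 / \<tau>') > 0" using pos unfolding Im_neg_inverse by (intro divide_pos_pos) auto
  \<comment> \<open>The old and the new case distinction would disagree only for \<open>a\<close>
    and \<open>c\<close> both even, which determinant 1 excludes.\<close>
  moreover have "even a \<Longrightarrow> odd c"
    using assms unfolding \<ff>\<^sub>2_transport_def by (metis dvd_diff dvd_mult dvd_mult2 odd_one)
  ultimately show ?thesis using assms
    unfolding \<ff>\<^sub>2_transport_def \<ff>\<^sub>2_neg_inverse[OF pos] \<ff>\<^sub>1_neg_inverse[OF pos] \<ff>_neg_inverse[OF pos]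
    by (auto simp: field_simps) 
qed

lemma \<ff>\<^sub>2_transport_Im:
  assumes "\<ff>\<^sub>2_transport \<tau> a b c d \<tau>'" "Im \<tau> > 0"
  shows "of_int c * \<tau> + of_int d \<noteq> 0" "Im \<tau>' = Im \<tau> / (norm (of_int c * \<tau> + of_int d))\<^sup>2"
proof -
  have det: "a * d - b * c = 1" and eq: "\<tau>' * (of_int c * \<tau> + of_int d) = of_int a * \<tau> + of_int b"
    using assms by (auto simp: \<ff>\<^sub>2_transport_def)
  show nz: "of_int c * \<tau> + of_int d \<noteq> 0"
  proof
    assume 0: "of_int c * \<tau> + of_int d = 0"
    hence "Im (of_int c * \<tau> + of_int d) = 0" by simp
    hence "c = 0" using assms(2) by simp
    with 0 have "d = 0" by simp
    with \<open>c = 0\<close> det show False by simp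
  qed
  have "\<tau>' = (of_int a * \<tau> + of_int b) / (of_int c * \<tau> + of_int d)" using eq nz by (simp add: field_simps)
  hence "Im \<tau>' = (Im \<tau> * of_int (a * d - b * c)) / (norm (of_int c * \<tau> + of_int d))\<^sup>2"
    by (simp add: Im_divide cmod_power2 algebra_simps)
  thus "Im \<tau>' = Im \<tau> / (norm (of_int c * \<tau> + of_int d))\<^sup>2" using det by simp
qed

text \<open>Finiteness lets the reduction to the fundamental domain choose a pair of least norm. The
  imaginary part bounds \<open>c\<close>, and then the triangle inequality bounds
  \<open>d\<close>.\<close>

lemma finite_lattice_points_in_disc:
  assumes "Im \<tau> > 0"
  shows "finite {(c :: int, d :: int). norm (of_int c * \<tau> + of_int d) \<le> 1}"
proof (rule finite_subset)
  define K where "K = \<lceil>1 / Im \<tau>\<rceil>"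
  define L where "L = \<lceil>1 + K * norm \<tau>\<rceil>"
  show "{(c, d). norm (of_int c * \<tau> + of_int d) \<le> 1} \<subseteq> {-K..K} \<times> {-L..L}"
  proof safe
    fix c d :: int assume le: "norm (of_int c * \<tau> + of_int d) \<le> 1"
    have "\<bar>Im (of_int c * \<tau> + of_int d)\<bar> \<le> 1" using abs_Im_le_cmod le order_trans by blast
    hence "\<bar>of_int c\<bar> \<le> 1 / Im \<tau>" using assms by (simp add: abs_mult field_simps)
    hence c: "\<bar>c\<bar> \<le> K" unfolding K_def by linarith
    have "norm (of_int d :: complex) \<le> norm (of_int c * \<tau> + of_int d) + norm (of_int c * \<tau>)"
      by (metis add.commute norm_triangle_sub add_diff_cancel_left' norm_minus_commute add_diff_cancel_right')
    also have "norm (of_int c * \<tau>) \<le> K * norm \<tau>" unfolding norm_mult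
      by (intro mult_right_mono) (use c in auto)
    finally have "\<bar>of_int d\<bar> \<le> 1 + K * norm \<tau>" using le by simp
    hence d: "\<bar>d\<bar> \<le> L" unfolding L_def by linarith
    show "c \<in> {-K..K}" "d \<in> {-L..L}" using c d by auto
  qed
qed auto

text \<open>Since \<open>Im \<tau>'\<close> is \<open>Im \<tau>\<close> divided by the squared norm
  of \<open>c * \<tau> + d\<close>, a reachable pair of least norm gives the highest image. A
  translation moves the real part into [-1/2, 1/2] and keeps \<open>c\<close> and \<open>d\<close>;
  if the result lay inside the unit disc, an inversion would reach the pair \<open>(a', b')\<close>
  of smaller norm. Outside the disc, the height is at least \<open>sqrt 3 / 2\<close>.\<close>

lemma fundamental_domain_transport:
  assumes \<tau>: "Im \<tau> > 0"
  obtains a b c d \<tau>' where "\<ff>\<^sub>2_transport \<tau> a b c d \<tau>'" "Im \<tau>' \<ge> sqrt 3 / 2"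
proof -
  define S where "S = {(c :: int, d :: int). norm (of_int c * \<tau> + of_int d) \<le> 1 \<and> (\<exists>a b \<tau>'. \<ff>\<^sub>2_transport \<tau> a b c d \<tau>')}"
  define g where "g = (\<lambda>(c :: int, d :: int). norm (of_int c * \<tau> + of_int d))"
  have "\<ff>\<^sub>2_transport \<tau> 1 0 0 1 \<tau>" using \<tau> by (simp add: \<ff>\<^sub>2_transport_def)
  hence S01: "(0, 1) \<in> S" by (auto simp: S_def)
  have fin: "finite S" by (rule finite_subset[OF _ finite_lattice_points_in_disc[OF \<tau>]]) (auto simp: S_def)
  define m where "m = arg_min_on g S"
  have mS: "m \<in> S" using arg_min_if_finite(1)[OF fin] S01 by (auto simp: m_def)
  have min: "g m \<le> g v" if "v \<in> S" for v
    using arg_min_least[OF fin _ that] that by (auto simp: m_def)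
  obtain c d where m: "m = (c, d)" by (cases m)
  obtain a b \<tau>1 where 1: "\<ff>\<^sub>2_transport \<tau> a b c d \<tau>1" using mS by (auto simp: S_def m)
  have le1: "norm (of_int c * \<tau> + of_int d) \<le> 1" using mS by (auto simp: S_def m)
  define n where "n = - round (Re \<tau>1)"
  define \<tau>2 where "\<tau>2 = \<tau>1 + of_int n"
  define a' where "a' = a + n * c"
  define b' where "b' = b + n * d"
  have 2: "\<ff>\<^sub>2_transport \<tau> a' b' c d \<tau>2" unfolding a'_def b'_def \<tau>2_def by (rule \<ff>\<^sub>2_transport_translate[OF 1])
  have Re2: "\<bar>Re \<tau>2\<bar> \<le> 1 / 2"
    using of_int_round_abs_le[of "Re \<tau>1"] by (simp add: \<tau>2_def n_def abs_minus_commute)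
  have nz: "norm (of_int c * \<tau> + of_int d) > 0" using \<ff>\<^sub>2_transport_Im(1)[OF 2 \<tau>] by simp
  have "norm \<tau>2 \<ge> 1"
  proof (rule ccontr)
    assume "\<not> norm \<tau>2 \<ge> 1"
    have "norm (of_int a' * \<tau> + of_int b') = norm \<tau>2 * norm (of_int c * \<tau> + of_int d)"
      using 2 unfolding \<ff>\<^sub>2_transport_def by (metis norm_mult)
    also have "\<dots> < 1 * norm (of_int c * \<tau> + of_int d)"
      using \<open>\<not> norm \<tau>2 \<ge> 1\<close> nz by (intro mult_strict_right_mono) auto
    finally have lt: "norm (of_int a' * \<tau> + of_int b') < norm (of_int c * \<tau> + of_int d)" by simp
    hence "(a', b') \<in> S" using le1 \<ff>\<^sub>2_transport_invert[OF 2] by (auto simp: S_def)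
    from min[OF this] lt show False by (simp add: g_def m)
  qed
  hence "1 \<le> (norm \<tau>2)\<^sup>2" by (simp add: one_le_power)
  also have "\<dots> = (Re \<tau>2)\<^sup>2 + (Im \<tau>2)\<^sup>2" by (simp add: cmod_power2)
  also have "(Re \<tau>2)\<^sup>2 \<le> (1/2)\<^sup>2" using power_mono[OF Re2, of 2] by simp
  finally have "(sqrt 3 / 2)\<^sup>2 \<le> (Im \<tau>2)\<^sup>2" by (simp add: power_divide)
  moreover have "Im \<tau>2 > 0" using 2 by (simp add: \<ff>\<^sub>2_transport_def)
  ultimately have "Im \<tau>2 \<ge> sqrt 3 / 2" by (meson less_eq_real_def power2_le_imp_le)
  with 2 show ?thesis using that by blast
qed

section \<open>Numerical bounds at height \<open>sqrt 3 / 2\<close>\<close>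

lemma exp_minus_27_le: "exp (- (27 / 10)) \<le> (1 / 14 :: real)"
proof -
  have "(14::real) \<le> (1 + 27/100 + (27/100)\<^sup>2 / 2) ^ 10" by (simp add: power2_eq_square power_divide field_simps)
  also have "\<dots> \<le> exp (27/100) ^ 10"
    by (intro power_mono exp_lower_Taylor_quadratic) auto
  also have "\<dots> = exp (27/10)" by (simp flip: exp_of_nat_mult)
  finally show ?thesis by (simp add: exp_minus field_simps)
qed

text \<open>The exponent \<open>27 / 10\<close> lies just below \<open>pi * sqrt 3 / 2\<close>, the
  decay of the nome at the lowest height allowed.\<close>

lemma nome_bound:
  assumes "Im \<tau> \<ge> sqrt 3 / 2"
  shows "norm (exp (\<i> * pi * \<tau>)) \<le> 1 / 14"
proof -
  have "(27 / 10 :: real) \<le> 3.14 * (1.72 / 2)" by simp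
  also have "\<dots> \<le> pi * (sqrt 3 / 2)"
  proof (intro mult_mono divide_right_mono)
    show "(1.72::real) \<le> sqrt 3" by (rule real_le_rsqrt) (simp add: power2_eq_square)
    show "3.14 \<le> pi" using pi_approx by simp
  qed auto
  also have "\<dots> \<le> pi * Im \<tau>" using assms by (intro mult_left_mono) auto
  finally have "exp (- pi * Im \<tau>) \<le> exp (- (27 / 10))" by simp
  with exp_minus_27_le show ?thesis unfolding norm_nome by linarith
qed

text \<open>\<open>14 / 195\<close> is \<open>r / (1 - r\<^sup>2)\<close> at
  \<open>r = 1 / 14\<close>, the sum of the odd powers of the largest nome.\<close>

lemma exp_le_27_25: "x \<le> 14 / 195 \<Longrightarrow> exp x \<le> (1.08 :: real)"
proof -
  assume "x \<le> 14 / 195"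
  hence "exp x \<le> exp (14 / 195)" by simp
  also have "\<dots> \<le> 1 / (1 - 14 / 195)" 
    using exp_ge_add_one_self[of "- (14/195) :: real"] by (simp add: exp_minus field_simps)
  also have "\<dots> \<le> 1.08" by simp
  finally show ?thesis .
qed

lemma norm_nome_products:
  fixes p :: complex
  assumes "norm p \<le> 1 / 14"
  shows "norm (\<Prod>n. 1 + p ^ (2 * n + 1)) \<le> 1.08" "norm (\<Prod>n. 1 + - (p ^ (2 * n + 1))) \<le> 1.08"
    "norm (\<Prod>n. 1 + (p\<^sup>2) ^ Suc n) \<le> 1.08"
proof -
  have p: "norm p < 1" using assms by simp
  define r where "r = norm p"
  have r: "0 \<le> r" "r \<le> 1 / 14" using assms by (simp_all add: r_def)
  hence r2: "r\<^sup>2 \<le> (1 / 14)\<^sup>2" by (intro power_mono)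
  have s: "(\<lambda>n. norm (p ^ (2 * n + 1))) sums (r / (1 - r\<^sup>2))"
    unfolding norm_power r_def by (rule geometric_sums_odd) (use p in simp)
  have "r / (1 - r\<^sup>2) \<le> (1 / 14) / (1 - (1 / 14)\<^sup>2)"
    using r r2 by (intro frac_le) (auto simp: power2_eq_square)
  hence b: "exp (r / (1 - r\<^sup>2)) \<le> 1.08" by (intro exp_le_27_25) (simp add: power2_eq_square)
  show "norm (\<Prod>n. 1 + p ^ (2 * n + 1)) \<le> 1.08"
    using norm_prodinf_le[OF s] b by linarith
  have s': "(\<lambda>n. norm (- (p ^ (2 * n + 1)))) sums (r / (1 - r\<^sup>2))" using s by simp
  show "norm (\<Prod>n. 1 + - (p ^ (2 * n + 1))) \<le> 1.08"
    using norm_prodinf_le[OF s'] b by linarith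
  have p2: "norm (p\<^sup>2) < 1" using p by (simp add: norm_power power_less_one_iff)
  have s2: "(\<lambda>n. norm ((p\<^sup>2) ^ Suc n)) sums (r\<^sup>2 / (1 - r\<^sup>2))"
    unfolding norm_power[of "p\<^sup>2"] r_def norm_power[of p 2, symmetric] by (rule geometric_sums_Suc) (use p2 in simp)
  have "r\<^sup>2 / (1 - r\<^sup>2) \<le> (1 / 14)\<^sup>2 / (1 - (1 / 14)\<^sup>2)"
    using r r2 by (intro frac_le) (auto simp: power2_eq_square)
  hence "exp (r\<^sup>2 / (1 - r\<^sup>2)) \<le> 1.08" by (intro exp_le_27_25) (simp add: power2_eq_square)
  thus "norm (\<Prod>n. 1 + (p\<^sup>2) ^ Suc n) \<le> 1.08"
    using norm_prodinf_le[OF s2] by linarith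
qed

lemma exp_two_i_pi: "exp (2 * \<i> * pi * x) = (exp (\<i> * pi * x))\<^sup>2"
  by (metis exp_double mult.assoc)

lemma norm_weber_bounds:
  assumes \<tau>: "Im \<tau> \<ge> sqrt 3 / 2"
  shows "norm (\<ff> \<tau>) \<le> 1.08 * exp (pi * Im \<tau> / 24)" "norm (\<ff>\<^sub>1 \<tau>) \<le> 1.08 * exp (pi * Im \<tau> / 24)"
    "norm (\<ff>\<^sub>2 \<tau>) \<le> 2"
proof -
  have e: "norm (exp (- (\<i> * pi * \<tau> / 24))) = exp (pi * Im \<tau> / 24)" by simp
  note b = norm_nome_products[OF nome_bound[OF \<tau>]]
  show "norm (\<ff> \<tau>) \<le> 1.08 * exp (pi * Im \<tau> / 24)" "norm (\<ff>\<^sub>1 \<tau>) \<le> 1.08 * exp (pi * Im \<tau> / 24)"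
    unfolding \<ff>_def \<ff>\<^sub>1_def norm_mult e using b
    by (simp_all only: mult.commute[of "exp (pi * Im \<tau> / 24)"]) (intro mult_right_mono; simp)+
  have Im: "Im \<tau> \<ge> 0" using \<tau> by (rule order_trans[rotated]) simp
  have "norm (\<ff>\<^sub>2 \<tau>) = sqrt 2 * exp (- (pi * Im \<tau> / 12)) * norm (\<Prod>n. 1 + exp (2 * \<i> * pi * \<tau>) ^ Suc n)"
    unfolding \<ff>\<^sub>2_def norm_mult by (simp del: power_Suc)
  also have "\<dots> \<le> 1.5 * 1 * 1.08"
  proof (intro mult_mono)
    show "sqrt 2 \<le> 1.5" by (rule real_le_lsqrt) (auto simp: power2_eq_square)
    show "exp (- (pi * Im \<tau> / 12)) \<le> 1" using Im by simp
    show "norm (\<Prod>n. 1 + exp (2 * \<i> * pi * \<tau>) ^ Suc n) \<le> 1.08"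
      unfolding exp_two_i_pi using b(3) .
  qed auto
  finally show "norm (\<ff>\<^sub>2 \<tau>) \<le> 2" by simp
qed

text \<open>Off the major arc at the cusp 0, the cusp nearest to \<open>\<tau>\<close> has denominator \<open>c\<close> even (where
  \<open>\<ff>\<^sub>2\<close> is small) or odd with \<open>\<bar>c\<bar> \<ge> 3\<close> (where its exponential growth rate drops by a factor 9).\<close>
lemma \<ff>\<^sub>2_minor_arc:
  assumes \<tau>: "0 < Im \<tau>" "Im \<tau> < 1 / 5" and Re: "\<bar>Re \<tau>\<bar> \<le> 1 / 2"
    and off: "Im \<tau> / (norm \<tau>)\<^sup>2 < sqrt 3 / 2"
  shows "norm (\<ff>\<^sub>2 \<tau>) \<le> max 2 (1.08 * exp (pi / (216 * Im \<tau>)))"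
proof -
  obtain a b c d \<tau>' where T: "\<ff>\<^sub>2_transport \<tau> a b c d \<tau>'" and Y: "Im \<tau>' \<ge> sqrt 3 / 2"
    using fundamental_domain_transport[OF \<tau>(1)] by blast
  have s3: "sqrt 3 / 2 > 4 / 5"
  proof -
    have "1.6 < sqrt 3" by (rule real_less_rsqrt) (simp add: power2_eq_square)
    thus ?thesis by simp
  qed
  note Im = \<ff>\<^sub>2_transport_Im[OF T \<tau>(1)]
  define D where "D = (norm (of_int c * \<tau> + of_int d))\<^sup>2"
  have D0: "D > 0" using Im(1) by (simp add: D_def)
  have DY: "D * Im \<tau>' = Im \<tau>" using Im(2) D0 by (simp add: D_def[symmetric])
  \<comment> \<open>\<open>D\<close> is the quotient of a height below \<open>1 / 5\<close> by one
    above \<open>4 / 5\<close>. This will exclude \<open>\<bar>c\<bar> = 1\<close> with nonzero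
    \<open>d\<close>, where \<open>\<bar>Re \<tau>\<bar> \<le> 1 / 2\<close> forces
    \<open>D \<ge> 1 / 4\<close>.\<close>
  have D14: "D < 1 / 4"
  proof (rule ccontr)
    assume "\<not> D < 1 / 4"
    hence "1 / 4 * Im \<tau>' \<le> D * Im \<tau>'" using Y s3 by (intro mult_right_mono) auto
    thus False using DY \<tau>(2) Y s3 by linarith
  qed
  show ?thesis
  proof (cases "even c")
    case True
    hence "norm (\<ff>\<^sub>2 \<tau>) \<le> 2" using T norm_weber_bounds(3)[OF Y] by (simp add: \<ff>\<^sub>2_transport_def)
    thus ?thesis by simp
  next
    case False
    have "\<bar>c\<bar> \<noteq> 1"
    proof
      assume c1: "\<bar>c\<bar> = 1"
      have D_eq: "D = (of_int c * Re \<tau> + of_int d)\<^sup>2 + (of_int c * Im \<tau>)\<^sup>2"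
        by (simp add: D_def cmod_power2)
      show False
      proof (cases "d = 0")
        case True
        \<comment> \<open>Here \<open>\<tau>'\<close> has the same height as
          \<open>-1 / \<tau>\<close>, and \<open>off\<close> keeps that below
          \<open>sqrt 3 / 2\<close>.\<close>
        have "\<bar>real_of_int c\<bar> = 1" using c1 by linarith
        hence "D = (norm \<tau>)\<^sup>2" by (simp add: D_def True norm_mult)
        thus False using off Im(2) Y by (simp add: D_def)
      next
        case False
        have "1 \<le> \<bar>of_int d :: real\<bar>" using False by linarith
        moreover have "\<bar>of_int c * Re \<tau>\<bar> \<le> 1 / 2" using Re c1 by (auto simp: abs_if split: if_splits)
        ultimately have "1 / 2 \<le> \<bar>of_int c * Re \<tau> + of_int d\<bar>" by linarith
        from power_mono[OF this, of 2] have "(1 / 2)\<^sup>2 \<le> (of_int c * Re \<tau> + of_int d)\<^sup>2"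
          by (simp add: power2_eq_square)
        also have "\<dots> \<le> D" unfolding D_eq by simp
        finally show False using D14 by (simp add: power2_eq_square)
      qed
    qed
    with False have "\<bar>c\<bar> \<ge> 3" by presburger
    hence "3 \<le> \<bar>of_int c :: real\<bar>" by (metis of_int_abs of_int_le_iff of_int_numeral)
    hence "9 \<le> (of_int c :: real)\<^sup>2" using power_mono[of 3 "\<bar>of_int c :: real\<bar>" 2] by simp
    hence "9 * (Im \<tau>)\<^sup>2 \<le> (of_int c * Im \<tau>)\<^sup>2" by (simp add: power_mult_distrib mult_right_mono)
    also have "\<dots> \<le> D" by (simp add: D_def cmod_power2)
    finally have "9 * (Im \<tau>)\<^sup>2 * Im \<tau>' \<le> Im \<tau>" using DY Y s3
      by (metis dual_order.trans less_eq_real_def linorder_not_le mult_right_mono order_less_le_trans zero_less_divide_iff zero_less_numeral)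
    \<comment> \<open>The growth rate \<open>pi / 24\<close> of the Weber functions together with
      this 9 gives the 216 of the claim.\<close>
    hence "Im \<tau>' \<le> 1 / (9 * Im \<tau>)" using \<tau>(1) by (simp add: field_simps power2_eq_square)
    hence "exp (pi * Im \<tau>' / 24) \<le> exp (pi / (216 * Im \<tau>))"
      using mult_left_mono[of "Im \<tau>'" "1 / (9 * Im \<tau>)" "pi / 24"] by (simp add: field_simps)
    hence "1.08 * exp (pi * Im \<tau>' / 24) \<le> 1.08 * exp (pi / (216 * Im \<tau>))" by simp
    moreover have "norm (\<ff>\<^sub>2 \<tau>) \<le> 1.08 * exp (pi * Im \<tau>' / 24)"
      using T False norm_weber_bounds(1,2)[OF Y] by (auto simp: \<ff>\<^sub>2_transport_def split: if_splits)
    ultimately have "norm (\<ff>\<^sub>2 \<tau>) \<le> 1.08 * exp (pi / (216 * Im \<tau>))" by (rule order_trans[rotated])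
    thus ?thesis by (rule max.coboundedI2)
  qed
qed

section \<open>The main term as a contour integral\<close>

text \<open>The Bessel-Clifford function: \<open>clifford (z\<^sup>2 / 4) = 2 * I\<^sub>1(z) / z\<close> for the modified Bessel function \<open>I\<^sub>1\<close>.\<close>
definition clifford :: "real \<Rightarrow> real" where
  "clifford y = (\<Sum>k. y ^ k / (fact k * fact (Suc k)))"

text \<open>The shift \<open>m\<close> covers \<open>clifford\<close> and its first two derivatives
  at once.\<close>

lemma summable_clifford_general: "summable (\<lambda>k. 1 / (fact k * fact (k + m)) * y ^ k :: real)"
proof (rule summable_comparison_test)
  show "summable (\<lambda>k. \<bar>y\<bar> ^ k / fact k)"
    using summable_exp_generic[of "\<bar>y\<bar>"] by (simp add: field_simps)
  have "norm (1 / (fact k * fact (k + m)) * y ^ k :: real) \<le> \<bar>y\<bar> ^ k / fact k" for k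
  proof -
    have "\<bar>y\<bar> ^ k / (fact k * fact (k + m)) \<le> \<bar>y\<bar> ^ k / (fact k * 1)"
      by (intro divide_left_mono mult_left_mono) (auto simp del: fact_Suc)
    thus ?thesis by (simp add: abs_mult power_abs del: fact_Suc)
  qed
  thus "\<exists>N. \<forall>k\<ge>N. norm (1 / (fact k * fact (k + m)) * y ^ k :: real) \<le> \<bar>y\<bar> ^ k / fact k" by blast
qed

lemma clifford_sums: "(\<lambda>k. y ^ k / (fact k * fact (Suc k))) sums clifford y"
  using summable_sums[OF summable_clifford_general[of 1 y]] by (simp add: clifford_def del: fact_Suc)

lemma higher_deriv_exp_mult: "(deriv ^^ k) (\<lambda>z. exp (c * z)) = (\<lambda>z. c ^ k * exp (c * z))" for c :: complex
proof (induction k)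
  case (Suc k)
  have "deriv (\<lambda>z. c ^ k * exp (c * z)) z = c ^ Suc k * exp (c * z)" for z
    by (rule DERIV_imp_deriv) (auto intro!: derivative_eq_intros)
  thus ?case using Suc by auto
qed auto

lemma exp_mult_circle_integral:
  fixes c :: complex
  shows "((\<lambda>u. exp (c * u) / u ^ Suc k) has_contour_integral (2 * pi * \<i> / fact k * c ^ k)) (circlepath 0 1)"
proof -
  have h: "(\<lambda>u. exp (c * u)) holomorphic_on A" for A by (intro holomorphic_intros)
  have "((\<lambda>u. exp (c * u) / (u - 0) ^ Suc k) has_contour_integral
      2 * pi * \<i> / fact k * (deriv ^^ k) (\<lambda>u. exp (c * u)) 0) (circlepath 0 1)"
    by (rule Cauchy_has_contour_integral_higher_derivative_circlepath)
       (use h holomorphic_on_imp_continuous_on[OF h] in auto)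
  thus ?thesis unfolding higher_deriv_exp_mult by (simp only: diff_zero mult_zero_right exp_zero mult_1_right)
qed

text \<open>Only \<open>exp (a / t)\<close> is expanded, uniformly on the circle. Its term of index
  \<open>Suc j\<close> has a pole of that order, and Cauchy's formula picks the coefficient of index
  \<open>j\<close> of \<open>exp (N * t)\<close>; the term of index 0 is entire and contributes
  nothing, whence the shifted factorials.\<close>

lemma clifford_circle_integral:
  fixes a N :: real
  shows "contour_integral (circlepath 0 1) (\<lambda>t. exp (of_real a / t + of_real N * t))
     = 2 * pi * \<i> * a * clifford (a * N)"
proof -
  define F where "F n t = exp (of_real N * t) * (\<Sum>k<n. (of_real a / t) ^ k /\<^sub>R fact k)" for n :: nat and t :: complex
  define I where "I k = (case k of 0 \<Rightarrow> 0 | Suc j \<Rightarrow> 2 * pi * \<i> * a * of_real ((a * N) ^ j / (fact j * fact (Suc j))))" for k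
  have tm: "((\<lambda>t. exp (of_real N * t) * ((of_real a / t) ^ k /\<^sub>R fact k)) has_contour_integral I k) (circlepath 0 1)" for k
  proof (cases k)
    case 0
    have "((\<lambda>t. exp (of_real N * t)) has_contour_integral 0) (circlepath 0 1)"
      by (rule Cauchy_theorem_convex_simple[of _ UNIV]) (auto intro!: holomorphic_intros)
    thus ?thesis using 0 by (simp add: I_def)
  next
    case (Suc j)
    have "((\<lambda>t. of_real (a ^ Suc j / fact (Suc j)) * (exp (of_real N * t) / t ^ Suc j)) has_contour_integral
       (of_real (a ^ Suc j / fact (Suc j)) * (2 * pi * \<i> / fact j * of_real N ^ j))) (circlepath 0 1)"
      by (intro has_contour_integral_lmul exp_mult_circle_integral)
    moreover have "of_real (a ^ Suc j / fact (Suc j)) * (exp (of_real N * t) / t ^ Suc j) =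
       exp (of_real N * t) * ((of_real a / t) ^ k /\<^sub>R fact k)" for t :: complex
      by (simp add: Suc power_divide scaleR_conv_of_real field_simps del: fact_Suc power_Suc)
    moreover have "of_real (a ^ Suc j / fact (Suc j)) * (2 * pi * \<i> / fact j * of_real N ^ j) = I k"
      by (simp add: I_def Suc power_mult_distrib mult_ac del: fact_Suc)
    ultimately show ?thesis by simp
  qed
  have F: "(F n has_contour_integral (\<Sum>k<n. I k)) (circlepath 0 1)" for n
    unfolding F_def sum_distrib_left by (intro has_contour_integral_sum tm) auto
  have lim: "uniform_limit (sphere 0 1) F (\<lambda>t. exp (of_real a / t + of_real N * t)) sequentially"
  proof -
    have "uniform_limit (sphere 0 1) (\<lambda>n t. \<Sum>k<n. (of_real a / t :: complex) ^ k /\<^sub>R fact k) (\<lambda>t. \<Sum>k. (of_real a / t) ^ k /\<^sub>R fact k) sequentially"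
    proof (rule Weierstrass_m_test)
      show "norm ((of_real a / t :: complex) ^ k /\<^sub>R fact k) \<le> \<bar>a\<bar> ^ k /\<^sub>R fact k" if "t \<in> sphere 0 1" for k t
        using that by (simp add: norm_power norm_divide)
      show "summable (\<lambda>k. \<bar>a\<bar> ^ k /\<^sub>R fact k)" by (rule summable_exp_generic)
    qed
    hence "uniform_limit (sphere 0 1) (\<lambda>n t. \<Sum>k<n. (of_real a / t :: complex) ^ k /\<^sub>R fact k) (\<lambda>t. exp (of_real a / t)) sequentially"
      by (simp add: exp_def)
    hence "uniform_limit (sphere 0 1) (\<lambda>n t. exp (of_real N * t) * (\<Sum>k<n. (of_real a / t :: complex) ^ k /\<^sub>R fact k))
        (\<lambda>t. exp (of_real N * t) * exp (of_real a / t)) sequentially"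
    proof (rule uniform_lim_mult[OF uniform_limit_const])
      show "bounded ((\<lambda>t. exp (of_real N * t :: complex)) ` sphere 0 1)"
        by (intro compact_imp_bounded compact_continuous_image continuous_intros) auto
      show "bounded ((\<lambda>t. exp (of_real a / t :: complex)) ` sphere 0 1)"
        by (intro compact_imp_bounded compact_continuous_image continuous_intros) auto
    qed
    thus ?thesis unfolding F_def by (simp add: exp_add mult.commute)
  qed
  have "((\<lambda>n. contour_integral (circlepath 0 1) (F n)) \<longlongrightarrow> contour_integral (circlepath 0 1) (\<lambda>t. exp (of_real a / t + of_real N * t))) sequentially"
    by (rule contour_integral_uniform_limit_circlepath(2)[OF _ lim])
       (use F in \<open>auto simp: contour_integrable_on_def intro!: always_eventually\<close>)
  hence "(\<lambda>n. \<Sum>k<n. I k) \<longlonglongrightarrow> contour_integral (circlepath 0 1) (\<lambda>t. exp (of_real a / t + of_real N * t))"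
    using contour_integral_unique[OF F] by simp
  hence "I sums contour_integral (circlepath 0 1) (\<lambda>t. exp (of_real a / t + of_real N * t))" by (simp add: sums_def)
  moreover have "I sums (2 * pi * \<i> * a * clifford (a * N))"
  proof -
    have "(\<lambda>j. 2 * pi * \<i> * a * of_real ((a * N) ^ j / (fact j * fact (Suc j)))) sums (2 * pi * \<i> * a * clifford (a * N))"
      by (intro sums_mult) (subst sums_of_real_iff, rule clifford_sums)
    hence "(\<lambda>j. I (Suc j)) sums (2 * pi * \<i> * a * clifford (a * N))" by (simp add: I_def)
    hence "I sums (2 * pi * \<i> * a * clifford (a * N) + I 0)" by (rule sums_Suc)
    thus ?thesis by (simp add: I_def)
  qed
  ultimately show ?thesis by (rule sums_unique2)
qed

text \<open>The segment is closed up to a rectangle around the essential singularity 0.\<close>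
lemma clifford_segment_integral:
  fixes a N x \<delta> :: real
  assumes a: "a \<ge> 0" and N: "N \<ge> 0" and x: "x > 0" and \<delta>: "\<delta> > 0"
  shows "norm (integral {-\<delta>..\<delta>} (\<lambda>y. exp (of_real a / Complex x y + of_real N * Complex x y)) - 2 * pi * a * clifford (a * N))
     \<le> exp (N * x) * (4 * x * exp (a * x / \<delta>\<^sup>2) + 2 * \<delta>)"
proof -
  define g where "g t = exp (of_real a / t + of_real N * t)" for t :: complex
  define z1 z2 z3 z4 where "z1 = Complex (-x) (-\<delta>)" and "z2 = Complex x (-\<delta>)" and "z3 = Complex x \<delta>" and "z4 = Complex (-x) \<delta>"
  have hol: "g holomorphic_on UNIV - {0}" unfolding g_def by (intro holomorphic_intros) auto
  have box: "0 \<in> box z1 z3" using x \<delta> by (simp add: z1_def z3_def in_box_complex_iff)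
  have pim: "path_image (rectpath z1 z3) \<subseteq> UNIV - {0}"
    using path_image_rectpath_inter_box[of z1 z3] box x \<delta> by (auto simp: z1_def z3_def)
  have "contour_integral (rectpath z1 z3) g = 2 * pi * \<i> * (\<Sum>p\<in>{0}. winding_number (rectpath z1 z3) p * residue g p)"
    by (rule Residue_theorem) (use hol pim in auto)
  also have "\<dots> = 2 * pi * \<i> * residue g 0" using winding_number_rectpath[OF box] by simp
  also have "\<dots> = contour_integral (circlepath 0 1) g"
    by (rule contour_integral_unique[symmetric], rule base_residue[of UNIV]) (use hol in auto)
  also have "\<dots> = 2 * pi * \<i> * a * clifford (a * N)"
    unfolding g_def by (rule clifford_circle_integral)
  finally have rect: "contour_integral (rectpath z1 z3) g = 2 * pi * \<i> * a * clifford (a * N)" .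
  have seg0: "0 \<notin> closed_segment z1 z2" "0 \<notin> closed_segment z2 z3" "0 \<notin> closed_segment z3 z4" "0 \<notin> closed_segment z4 z1"
    using x \<delta> by (auto simp: z1_def z2_def z3_def z4_def closed_segment_same_Im closed_segment_same_Re)
  have int: "(g has_contour_integral contour_integral (linepath u v) g) (linepath u v)" if "0 \<notin> closed_segment u v" for u v
    by (intro has_contour_integral_integral contour_integrable_continuous_linepath holomorphic_on_imp_continuous_on holomorphic_on_subset[OF hol])
       (use that in auto)
  define J where "J u v = contour_integral (linepath u v) g" for u v
  have "(g has_contour_integral (J z1 z2 + (J z2 z3 + (J z3 z4 + J z4 z1)))) (rectpath z1 z3)"
    unfolding rectpath_def Let_def J_def
    using int[OF seg0(1)] int[OF seg0(2)] int[OF seg0(3)] int[OF seg0(4)]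
    by (intro has_contour_integral_join valid_path_join) (auto simp: z1_def z2_def z3_def z4_def)
  from contour_integral_unique[OF this] rect
  have eq: "J z2 z3 = 2 * pi * \<i> * a * clifford (a * N) - J z1 z2 - J z3 z4 - J z4 z1" by (simp add: algebra_simps)
  have J23: "J z2 z3 = \<i> * integral {-\<delta>..\<delta>} (\<lambda>y. g (Complex x y))"
    unfolding J_def by (rule contour_integral_linepath_same_Re) (use \<delta> in \<open>auto simp: z2_def z3_def\<close>)
  \<comment> \<open>The real part of \<open>a / t\<close> is at most
    \<open>a * x / \<delta>\<^sup>2\<close> on the horizontal sides, where
    \<open>norm t \<ge> \<delta>\<close>, and negative or zero on the left side.\<close>
  have ng: "norm (g t) = exp (a * Re t / (norm t)\<^sup>2 + N * Re t)" for t
    by (simp add: g_def Re_divide cmod_power2)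
  have hor: "norm (g t) \<le> exp (a * x / \<delta>\<^sup>2) * exp (N * x)" if "\<bar>Im t\<bar> = \<delta>" "\<bar>Re t\<bar> \<le> x" for t
  proof -
    have d2: "\<delta>\<^sup>2 \<le> (norm t)\<^sup>2" using that(1) by (auto simp: cmod_power2)
    have "a * Re t / (norm t)\<^sup>2 \<le> a * x / (norm t)\<^sup>2"
      using that a by (intro divide_right_mono mult_left_mono) auto
    also have "\<dots> \<le> a * x / \<delta>\<^sup>2"
      using d2 a x \<delta> by (intro divide_left_mono) (auto intro!: mult_pos_pos simp: zero_less_power2 intro: less_le_trans[OF _ d2])
    finally have "a * Re t / (norm t)\<^sup>2 \<le> a * x / \<delta>\<^sup>2" .
    moreover have "N * Re t \<le> N * x" using that N by (intro mult_left_mono) auto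
    ultimately show ?thesis unfolding ng exp_add[symmetric] by simp
  qed
  have len: "norm (z2 - z1) = 2 * x" "norm (z4 - z3) = 2 * x" "norm (z1 - z4) = 2 * \<delta>"
    using x \<delta> by (simp_all add: z1_def z2_def z3_def z4_def cmod_def real_sqrt_mult)
  have J12: "norm (J z1 z2) \<le> exp (a * x / \<delta>\<^sup>2) * exp (N * x) * (2 * x)"
    unfolding J_def len(1)[symmetric]
  proof (rule has_contour_integral_bound_linepath[OF int[OF seg0(1)]])
    show "norm (g t) \<le> exp (a * x / \<delta>\<^sup>2) * exp (N * x)" if "t \<in> closed_segment z1 z2" for t
      by (rule hor) (use that x \<delta> in \<open>auto simp: z1_def z2_def closed_segment_same_Im closed_segment_eq_real_ivl\<close>)
  qed simp
  have J34: "norm (J z3 z4) \<le> exp (a * x / \<delta>\<^sup>2) * exp (N * x) * (2 * x)"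
    unfolding J_def len(2)[symmetric]
  proof (rule has_contour_integral_bound_linepath[OF int[OF seg0(3)]])
    show "norm (g t) \<le> exp (a * x / \<delta>\<^sup>2) * exp (N * x)" if "t \<in> closed_segment z3 z4" for t
      by (rule hor) (use that x \<delta> in \<open>auto simp: z3_def z4_def closed_segment_same_Im closed_segment_eq_real_ivl\<close>)
  qed simp
  have ver: "norm (g t) \<le> exp (N * x)" if "Re t = -x" for t
  proof -
    have "a * Re t / (norm t)\<^sup>2 \<le> 0" using that a x by (simp add: divide_nonpos_nonneg)
    moreover have "N * Re t \<le> N * x" using that N x by (intro mult_left_mono) auto
    ultimately show ?thesis unfolding ng by simp
  qed
  have J41: "norm (J z4 z1) \<le> exp (N * x) * (2 * \<delta>)"
    unfolding J_def len(3)[symmetric]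
  proof (rule has_contour_integral_bound_linepath[OF int[OF seg0(4)]])
    show "norm (g t) \<le> exp (N * x)" if "t \<in> closed_segment z4 z1" for t
      by (rule ver) (use that in \<open>auto simp: z4_def z1_def closed_segment_same_Re\<close>)
  qed simp
  have "norm (integral {-\<delta>..\<delta>} (\<lambda>y. g (Complex x y)) - 2 * pi * a * clifford (a * N))
     = norm (\<i> * (integral {-\<delta>..\<delta>} (\<lambda>y. g (Complex x y)) - 2 * pi * a * clifford (a * N)))"
    by (simp only: norm_mult norm_ii mult_1)
  also have "\<i> * (integral {-\<delta>..\<delta>} (\<lambda>y. g (Complex x y)) - 2 * pi * a * clifford (a * N)) = - (J z1 z2 + J z3 z4 + J z4 z1)"
    using eq unfolding J23 by (simp add: algebra_simps)
  also have "norm \<dots> \<le> norm (J z1 z2) + norm (J z3 z4) + norm (J z4 z1)"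
    unfolding norm_minus_cancel by (intro order_trans[OF norm_triangle_ineq] add_right_mono norm_triangle_ineq)
  also have "\<dots> \<le> exp (N * x) * (4 * x * exp (a * x / \<delta>\<^sup>2) + 2 * \<delta>)"
    using J12 J34 J41 by (simp add: algebra_simps)
  finally show ?thesis by (simp add: g_def)
qed

section \<open>The circle method\<close>

lemma has_integral_exp_int:
  "((\<lambda>y. exp (\<i> * of_int k * of_real y)) has_integral (if k = 0 then 2 * pi else 0)) {-pi..pi}"
proof (cases "k = 0")
  case True
  thus ?thesis using has_integral_const_real[of "1::complex" "-pi" pi]
    by (simp add: scaleR_conv_of_real)
next
  case False
  have "((\<lambda>y. exp (\<i> * of_int k * of_real y)) has_integral
      (exp (\<i> * of_int k * of_real pi) / (\<i> * of_int k) - exp (\<i> * of_int k * of_real (-pi)) / (\<i> * of_int k))) {-pi..pi}"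
    by (rule fundamental_theorem_of_calculus)
       (use False in \<open>auto intro!: derivative_eq_intros has_vector_derivative_real_field\<close>)
  moreover have "exp (\<i> * of_int k * of_real pi) = exp (\<i> * of_int k * of_real (-pi))"
    unfolding exp_eq by (rule exI[of _ k]) simp
  ultimately show ?thesis using False by simp
qed

lemma prod_one_plus_power:
  fixes z :: "'a :: comm_semiring_1"
  shows "(\<Prod>j<M. 1 + z ^ Suc j) = (\<Sum>X\<in>Pow {1..M}. z ^ \<Sum>X)"
proof -
  have "(\<Prod>j<M. 1 + z ^ Suc j) = (\<Prod>j\<in>{1..M}. z ^ j + 1)"
    by (rule prod.reindex_bij_witness[of _ "\<lambda>j. j - 1" Suc]) (auto simp: add.commute)
  also have "\<dots> = (\<Sum>X\<in>Pow {1..M}. z ^ \<Sum>X)"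
    by (subst prod_add) (auto simp: power_sum)
  finally show ?thesis .
qed

lemma distinct_partitions_altdef:
  assumes "n \<le> M"
  shows "distinct_partitions n = {X \<in> Pow {1..M}. \<Sum>X = n}"
proof -
  have "x \<le> \<Sum>A" if "finite A" "x \<in> A" for x :: nat and A
    using member_le_sum[of x A "\<lambda>x. x"] that by simp
  note le = this
  show ?thesis
  proof (intro set_eqI iffI)
    fix A assume A: "A \<in> distinct_partitions n"
    have "x \<in> {1..M}" if "x \<in> A" for x
    proof -
      have "x \<le> n" using A that le[of A x] unfolding distinct_partitions_def by auto
      moreover have "x \<noteq> 0" using A that unfolding distinct_partitions_def by (metis (no_types, lifting) CollectD)
      ultimately show ?thesis using assms by simp
    qed
    thus "A \<in> {X \<in> Pow {1..M}. \<Sum>X = n}" using A unfolding distinct_partitions_def by blast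
  next
    fix A assume "A \<in> {X \<in> Pow {1..M}. \<Sum>X = n}"
    thus "A \<in> distinct_partitions n"
      unfolding distinct_partitions_def using finite_subset[of A "{1..M}"] by auto
  qed
qed

text \<open>Truncating the product at any \<open>M \<ge> n\<close> keeps the coefficient of index
  \<open>n\<close>, so the value is already exact. The infinite product then follows by dominated
  convergence from a constant sequence of integrals.\<close>

lemma q_finite_integral:
  assumes "n \<le> M"
  shows "((\<lambda>y. exp (of_nat n * Complex x y) * (\<Prod>j<M. 1 + exp (- Complex x y) ^ Suc j)) has_integral (2 * pi * q n)) {-pi..pi}"
proof -
  have 1: "((\<lambda>y. exp (of_nat n * Complex x y) * exp (- Complex x y) ^ m) has_integral (if m = n then 2 * pi else 0)) {-pi..pi}" for m
  proof -
    have "exp (of_nat n * Complex x y) * exp (- Complex x y) ^ m = exp ((real n - real m) * x) * exp (\<i> * of_int (int n - int m) * of_real y)" for y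
      unfolding exp_of_nat_mult[symmetric] exp_add[symmetric] exp_of_real[symmetric]
      by (simp add: Complex_eq algebra_simps)
    moreover have "((\<lambda>y. exp ((real n - real m) * x) * exp (\<i> * of_int (int n - int m) * of_real y)) has_integral
       (exp ((real n - real m) * x) * (if int n - int m = 0 then 2 * pi else 0))) {-pi..pi}"
      using has_integral_mult_right[OF has_integral_exp_int[of "int n - int m"], of "complex_of_real (exp ((real n - real m) * x))"]
      by (cases "n = m") simp_all
    ultimately show ?thesis by (auto split: if_splits)
  qed
  have "((\<lambda>y. \<Sum>X\<in>Pow {1..M}. exp (of_nat n * Complex x y) * exp (- Complex x y) ^ \<Sum>X) has_integral
     (\<Sum>X\<in>Pow {1..M}. if \<Sum>X = n then 2 * pi else 0)) {-pi..pi}"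
    unfolding of_real_sum by (intro has_integral_sum 1) auto
  moreover have "(\<Sum>X\<in>Pow {1..M}. if \<Sum>X = n then 2 * pi else 0) = 2 * pi * real (q n)"
    unfolding q_def distinct_partitions_altdef[OF assms] by (simp add: sum.If_cases Int_def)
  ultimately show ?thesis unfolding prod_one_plus_power sum_distrib_left by (simp only:)
qed

lemma q_integral:
  fixes n :: nat
  assumes x: "x > 0"
  defines "f \<equiv> \<lambda>y. exp (of_nat n * Complex x y) * (\<Prod>j. 1 + exp (- Complex x y) ^ Suc j)"
  shows "(f has_integral (2 * pi * q n)) {-pi..pi}"
proof -
  define r where "r = exp (- x)"
  have r: "0 < r" "r < 1" using x by (simp_all add: r_def)
  define s where "s = r / (1 - r)"
  have nz: "norm (exp (- Complex x y)) = r" for y by (simp add: r_def)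
  have gs: "(\<lambda>j. norm (exp (- Complex x y) ^ Suc j)) sums s" for y
    unfolding norm_power nz s_def by (rule geometric_sums_Suc) (use r in simp)
  \<comment> \<open>The offset \<open>n\<close> makes every truncation long enough for
    \<open>q_finite_integral\<close>.\<close>
  define g where "g M y = exp (of_nat n * Complex x y) * (\<Prod>j<M+n. 1 + exp (- Complex x y) ^ Suc j)" for M y
  have gi: "(g M has_integral (2 * pi * q n)) {-pi..pi}" for M
    unfolding g_def by (rule q_finite_integral) simp
  have bd: "norm (g M y) \<le> exp (n * x) * exp s" for M y
  proof -
    have "norm (\<Prod>j<M+n. 1 + exp (- Complex x y) ^ Suc j) \<le> (\<Prod>j<M+n. 1 + norm (exp (- Complex x y) ^ Suc j))"
      unfolding prod_norm[symmetric] by (intro prod_mono conjI norm_ge_zero order_trans[OF norm_triangle_ineq]) simp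
    also have "\<dots> \<le> exp (\<Sum>j<M+n. norm (exp (- Complex x y) ^ Suc j))" by (rule prod_le_exp_sum) auto
    also have "\<dots> \<le> exp s"
      using sum_le_suminf[OF sums_summable[OF gs], of "{..<M+n}"] sums_unique[OF gs] by simp
    finally show ?thesis unfolding g_def norm_mult by (intro mult_mono) auto
  qed
  have lim: "(\<lambda>M. g M y) \<longlonglongrightarrow> f y" for y
  proof -
    have "(\<lambda>M. \<Prod>j<M+n. 1 + exp (- Complex x y) ^ Suc j) \<longlonglongrightarrow> (\<Prod>j. 1 + exp (- Complex x y) ^ Suc j)"
      by (rule LIMSEQ_ignore_initial_segment[OF LIMSEQ_prodinf_one_plus[OF sums_summable[OF gs]]])
    thus ?thesis unfolding g_def f_def by (intro tendsto_mult tendsto_const)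
  qed
  have "f integrable_on {-pi..pi}" "(\<lambda>M. integral {-pi..pi} (g M)) \<longlonglongrightarrow> integral {-pi..pi} f"
    using dominated_convergence[of g "{-pi..pi}" "\<lambda>_. exp (n * x) * exp s" f] gi bd lim
    by (auto simp: has_integral_integrable)
  moreover have "integral {-pi..pi} (g M) = 2 * pi * q n" for M using gi integral_unique by blast
  ultimately have "(\<lambda>M::nat. complex_of_real (2 * pi * q n)) \<longlonglongrightarrow> integral {-pi..pi} f" by simp
  hence "integral {-pi..pi} f = 2 * pi * q n" by (simp only: LIMSEQ_const_iff)
  with \<open>f integrable_on {-pi..pi}\<close> show ?thesis by (metis integrable_integral)
qed

text \<open>At \<open>\<i> * t / (2 * pi)\<close> the prefactor of \<open>\<ff>\<^sub>2\<close> is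
  \<open>sqrt 2 * exp (- t / 24)\<close>; compensating it is the origin of the shift by
  \<open>1 / 24\<close>.\<close>

lemma q_weber_integral:
  fixes n :: nat
  assumes x: "x > 0"
  shows "((\<lambda>y. exp ((n + 1/24) * Complex x y) * \<ff>\<^sub>2 (\<i> * Complex x y / (2 * pi))) has_integral (2 * pi * (sqrt 2 * q n))) {-pi..pi}"
proof -
  have "exp ((n + 1/24) * Complex x y) * \<ff>\<^sub>2 (\<i> * Complex x y / (2 * pi))
      = sqrt 2 * (exp (of_nat n * Complex x y) * (\<Prod>j. 1 + exp (- Complex x y) ^ Suc j))" for y
  proof -
    define t where "t = Complex x y"
    have 1: "\<i> * pi * (\<i> * t / (2 * pi)) / 12 = - t / 24" "2 * \<i> * pi * (\<i> * t / (2 * pi)) = - t"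
      by (simp_all add: field_simps)
    have "exp ((n + 1/24) * t) * exp (- t / 24) = exp (of_nat n * t)"
      unfolding exp_add[symmetric] by (simp add: algebra_simps)
    moreover have "A * (c * B * P) = c * ((A * B) * P)" for A B c P :: complex
      by (simp only: mult_ac)
    ultimately have "exp ((n + 1/24) * t) * (sqrt 2 * exp (- t / 24) * P) = sqrt 2 * (exp (of_nat n * t) * P)" for P :: complex
      by (simp only:)
    thus ?thesis unfolding \<ff>\<^sub>2_def t_def[symmetric] 1 .
  qed
  moreover have "2 * pi * (sqrt 2 * q n) = complex_of_real (sqrt 2) * complex_of_real (2 * pi * q n)"
    by simp
  ultimately show ?thesis using has_integral_mult_right[OF q_integral[OF x], of "complex_of_real (sqrt 2)"]
    by (simp only:)
qed

text \<open>The main term has size \<open>exp (pi * Im \<sigma> / 24)\<close>, but the product that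
  multiplies it differs from 1 by at most twice the nome, whose size is
  \<open>exp (- pi * Im \<sigma>)\<close>. Hence the absolute error stays bounded although the main
  term does not.\<close>

lemma major_arc_term:
  fixes t :: complex
  assumes t: "Re t > 0" and R: "Re (2 * pi / t) \<ge> sqrt 3 / 2"
  shows "norm (\<ff>\<^sub>2 (\<i> * t / (2 * pi)) - exp (pi\<^sup>2 / 12 / t)) \<le> 1"
proof -
  have t0: "t \<noteq> 0" using t by auto
  define \<sigma> where "\<sigma> = 2 * pi * \<i> / t"
  have Im: "Im \<sigma> \<ge> sqrt 3 / 2" using R by (simp add: \<sigma>_def Im_divide Re_divide)
  hence Im0: "Im \<sigma> > 0" by (rule less_le_trans[rotated]) simp
  define p where "p = exp (\<i> * pi * \<sigma>)"
  define P where "P = (\<Prod>n. 1 + - (p ^ (2 * n + 1)))"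
  define r where "r = norm p"
  have r14: "r \<le> 1 / 14" unfolding r_def p_def by (rule nome_bound[OF Im])
  have r0: "r > 0" by (simp add: r_def p_def)
  have "-1 / \<sigma> = \<i> * t / (2 * pi)" using t0 by (simp add: \<sigma>_def field_simps)
  moreover have "\<ff>\<^sub>1 \<sigma> = exp (pi\<^sup>2 / 12 / t) * P"
  proof -
    have "- (\<i> * pi * \<sigma> / 24) = pi\<^sup>2 / 12 / t" by (simp add: \<sigma>_def power2_eq_square mult_ac)
    thus ?thesis unfolding \<ff>\<^sub>1_def P_def p_def by (simp only:)
  qed
  ultimately have "\<ff>\<^sub>2 (\<i> * t / (2 * pi)) - exp (pi\<^sup>2 / 12 / t) = exp (pi\<^sup>2 / 12 / t) * (P - 1)"
    using \<ff>\<^sub>2_neg_inverse[OF Im0] by (simp add: algebra_simps)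
  moreover have "norm (exp (pi\<^sup>2 / 12 / t)) = exp (pi * Im \<sigma> / 24)"
  proof -
    have "Re (of_real c / t) = c * Re t / (norm t)\<^sup>2" for c
      by (simp add: Re_divide cmod_power2)
    moreover have "Im \<sigma> = 2 * pi * Re t / (norm t)\<^sup>2"
      by (simp add: \<sigma>_def Im_divide cmod_power2)
    ultimately show ?thesis by (simp only: norm_exp_eq_Re) (simp add: power2_eq_square)
  qed
  moreover have "norm (P - 1) \<le> 2 * r"
  proof -
    have "(\<lambda>n. norm (- (p ^ (2 * n + 1)))) sums (r / (1 - r\<^sup>2))"
      unfolding norm_minus_cancel norm_power r_def by (rule geometric_sums_odd) (use r14 in \<open>simp add: r_def\<close>)
    hence "norm (P - 1) \<le> exp (r / (1 - r\<^sup>2)) - 1" unfolding P_def by (rule norm_prodinf_minus_one_le)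
    also have "r / (1 - r\<^sup>2) \<le> r * (14 / 13)"
    proof -
      have "r\<^sup>2 \<le> (1 / 14)\<^sup>2" using r0 r14 by (intro power_mono) auto
      hence "1 - r\<^sup>2 \<ge> 13 / 14" by (simp add: power2_eq_square)
      hence "r / (1 - r\<^sup>2) \<le> r / (13 / 14)" using r0 by (intro divide_left_mono) auto
      thus ?thesis by simp
    qed
    also have "exp (r * (14 / 13)) \<le> 1 / (1 - r * (14 / 13))"
      using exp_ge_add_one_self[of "- (r * (14/13))"] r14 by (simp add: exp_minus field_simps)
    also have "\<dots> - 1 \<le> 2 * r"
    proof -
      have "1 \<le> (1 + 2 * r) * (1 - r * (14 / 13))"
      proof -
        have "r * r \<le> r * (1 / 14)" using r0 r14 by (intro mult_left_mono) auto
        thus ?thesis using r0 by (simp add: algebra_simps)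
      qed
      thus ?thesis using r14 by (simp add: field_simps)
    qed
    finally show ?thesis by simp
  qed
  ultimately have "norm (\<ff>\<^sub>2 (\<i> * t / (2 * pi)) - exp (pi\<^sup>2 / 12 / t)) = exp (pi * Im \<sigma> / 24) * norm (P - 1)"
    and "norm (P - 1) \<le> 2 * r" by (simp_all only: norm_mult)
  hence "norm (\<ff>\<^sub>2 (\<i> * t / (2 * pi)) - exp (pi\<^sup>2 / 12 / t)) \<le> exp (pi * Im \<sigma> / 24) * (2 * r)"
    by (simp del: norm_exp_eq_Re)
  \<comment> \<open>The rate \<open>1 / 24\<close> is weakened to \<open>1 / 2\<close> because the
    product then becomes twice the square root of \<open>r\<close>.\<close>
  also have "\<dots> \<le> exp (pi * Im \<sigma> / 2) * (2 * r)"
    using Im0 r0 by (intro mult_right_mono) (auto simp: field_simps)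
  also have "exp (pi * Im \<sigma> / 2) * r = exp (- (pi * Im \<sigma>) / 2)"
    unfolding r_def p_def norm_nome exp_add[symmetric] by (simp add: field_simps)
  hence "exp (pi * Im \<sigma> / 2) * (2 * r) = 2 * exp (- (pi * Im \<sigma>) / 2)" by simp
  also have "\<dots> \<le> 1"
  proof -
    have "exp (- (pi * Im \<sigma>) / 2) ^ 2 = r"
      unfolding r_def p_def norm_nome by (simp add: exp_double[symmetric])
    hence "exp (- (pi * Im \<sigma>) / 2) ^ 2 \<le> (1/2) ^ 2" using r14 by (simp add: power2_eq_square)
    hence "exp (- (pi * Im \<sigma>) / 2) \<le> 1/2" by (rule power2_le_imp_le) simp
    thus ?thesis by simp
  qed
  finally show ?thesis .
qed

text \<open>The vertical line at \<open>x = pi\<^sup>2 / (6 * v)\<close> passes through the saddle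
  point of \<open>a / t + N * t\<close>, where both summands equal \<open>v / 2\<close>. The factor
  \<open>exp (N * t)\<close> contributes 1/2 to the error exponent 5/9, and the growth of
  \<open>\<ff>\<^sub>2\<close> on the minor arc contributes 1/18.\<close>

lemma q_clifford_approx:
  fixes n :: nat
  defines "a \<equiv> pi\<^sup>2 / 12"
  assumes v66: "\<nu> n \<ge> 66"
  shows "\<bar>sqrt 2 * q n - a * clifford (a * (n + 1/24))\<bar> \<le> 1.2 * exp (5 * \<nu> n / 9)"
proof -
  define N where "N = real n + 1/24"
  define v where "v = \<nu> n"
  define x where "x = pi\<^sup>2 / (6 * v)"
  have v: "v \<ge> 66" using v66 by (simp add: v_def)
  have pi: "3.14 \<le> pi" "pi \<le> 3.15" using pi_approx by auto
  have a01: "0 < a" "a \<le> 1"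
    using power_mono[of pi "3.15" 2] pi by (auto simp: a_def power2_eq_square)
  have N0: "N > 0" by (simp add: N_def add_nonneg_pos)
  have v2: "v\<^sup>2 = pi\<^sup>2 * N / 3"
    unfolding v_def \<nu>_def N_def by (simp add: power_divide power_mult_distrib field_simps)
  have x0: "x > 0" using v by (simp add: x_def)
  have x1: "x \<le> 0.026"
  proof -
    have "pi\<^sup>2 \<le> 0.026 * (6 * 66)" using power_mono[of pi "3.15" 2] pi by (simp add: power2_eq_square)
    also have "\<dots> \<le> 0.026 * (6 * v)" using v by simp
    finally show ?thesis using v by (simp add: x_def divide_le_eq)
  qed
  have Nx: "N * x = v / 2"
  proof -
    have "N = 3 * v\<^sup>2 / pi\<^sup>2" by (simp add: v2)
    thus ?thesis using v by (simp add: x_def power2_eq_square)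
  qed
  have s3: "1.73 \<le> sqrt 3" "sqrt 3 \<le> 1.74"
    by (rule real_le_rsqrt real_le_lsqrt; simp add: power2_eq_square)+
  \<comment> \<open>\<open>x\<^sup>2 + y\<^sup>2 \<le> D\<close> says that the inversion lifts the
    point to height at least \<open>sqrt 3 / 2\<close>. So
    \<open>\<bar>y\<bar> \<le> \<delta>\<close> is exactly where \<open>major_arc_term\<close>
    applies, and its complement where \<open>\<ff>\<^sub>2_minor_arc\<close> does.\<close>
  define D where "D = 4 * pi * x / sqrt 3"
  have D7: "7 * x \<le> D"
  proof -
    have "7 * x * sqrt 3 \<le> 7 * x * 1.74" using s3 x0 by (intro mult_left_mono) auto
    also have "\<dots> \<le> 4 * pi * x" using pi x0 by simp
    finally show ?thesis by (simp add: D_def field_simps)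
  qed
  have D1: "D \<le> 1"
  proof -
    have "4 * pi * x \<le> 4 * 3.15 * 0.026" using pi x1 x0 by (intro mult_mono) auto
    also have "\<dots> \<le> sqrt 3" using s3 by simp
    finally show ?thesis by (simp add: D_def)
  qed
  define \<delta> where "\<delta> = sqrt (D - x\<^sup>2)"
  have xx: "x\<^sup>2 \<le> x" using x0 x1 by (simp add: power2_eq_square mult_le_cancel_left1)
  have \<delta>2: "\<delta>\<^sup>2 = D - x\<^sup>2" unfolding \<delta>_def using D7 xx x0 by simp
  have \<delta>0: "\<delta> > 0" unfolding \<delta>_def using D7 xx x0 by simp
  have \<delta>1: "\<delta> \<le> 1" 
  proof -
    have "D - x\<^sup>2 \<le> 1" using D1 zero_le_power2[of x] by linarith
    thus ?thesis by (simp add: \<delta>_def)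
  qed
  define g where "g y = exp (of_real a / Complex x y + of_real N * Complex x y)" for y
  define h where "h y = exp ((n + 1/24) * Complex x y) * \<ff>\<^sub>2 (\<i> * Complex x y / (2 * pi))" for y
  have h: "(h has_integral (2 * pi * (sqrt 2 * q n))) {-pi..pi}"
    unfolding h_def by (rule q_weber_integral[OF x0])
  have near_iff: "sqrt 3 / 2 \<le> 2 * pi * x / (x\<^sup>2 + y\<^sup>2) \<longleftrightarrow> \<bar>y\<bar> \<le> \<delta>" for y
  proof -
    have "x\<^sup>2 + y\<^sup>2 > 0" using x0 by (simp add: add_pos_nonneg)
    hence "sqrt 3 / 2 \<le> 2 * pi * x / (x\<^sup>2 + y\<^sup>2) \<longleftrightarrow> x\<^sup>2 + y\<^sup>2 \<le> D"
      by (simp add: D_def field_simps)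
    also have "\<dots> \<longleftrightarrow> y\<^sup>2 \<le> \<delta>\<^sup>2" unfolding \<delta>2 by auto
    also have "\<dots> \<longleftrightarrow> \<bar>y\<bar> \<le> \<delta>" using \<delta>0 by (simp add: abs_le_square_iff[symmetric])
    finally show ?thesis .
  qed
  define B where "B = 1.08 * exp (v / 18) * exp (v / 2)"
  have e10: "exp (v / 18) \<ge> 10"
  proof -
    have "1 + v / 18 + (v / 18)\<^sup>2 / 2 \<le> exp (v / 18)" using v by (intro exp_lower_Taylor_quadratic) auto
    moreover have "(66/18)\<^sup>2 \<le> (v / 18)\<^sup>2" using v by (intro power_mono) auto
    ultimately show ?thesis using v by (simp add: power2_eq_square)
  qed
  have nE: "norm (exp ((n + 1/24) * Complex x y)) = exp (v / 2)" for y
    using Nx by (simp add: N_def)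
  have bd: "norm (h y - (if y \<in> {-\<delta>..\<delta>} then g y else 0)) \<le> B" if y: "y \<in> {-pi..pi}" for y
  proof (cases "\<bar>y\<bar> \<le> \<delta>")
    case True
    have "Re (2 * pi / Complex x y) = 2 * pi * x / (x\<^sup>2 + y\<^sup>2)" by (simp add: Re_divide)
    hence "Re (2 * pi / Complex x y) \<ge> sqrt 3 / 2" using near_iff True by simp
    from major_arc_term[OF _ this] x0
    have "norm (\<ff>\<^sub>2 (\<i> * Complex x y / (2 * pi)) - exp (pi\<^sup>2 / 12 / Complex x y)) \<le> 1" by simp
    moreover have "h y - g y = exp ((n + 1/24) * Complex x y) * (\<ff>\<^sub>2 (\<i> * Complex x y / (2 * pi)) - exp (pi\<^sup>2 / 12 / Complex x y))"
      unfolding h_def g_def exp_add a_def N_def by (simp add: algebra_simps)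
    moreover have "norm (h y - g y) = exp (v / 2) * norm (\<ff>\<^sub>2 (\<i> * Complex x y / (2 * pi)) - exp (pi\<^sup>2 / 12 / Complex x y))"
      by (simp only: calculation(2) norm_mult nE)
    ultimately have "norm (h y - g y) \<le> exp (v / 2)" by simp
    also have "\<dots> \<le> B" using e10 by (simp add: B_def)
    finally show ?thesis using True by (auto simp: abs_le_iff)
  next
    case False
    define \<tau> where "\<tau> = \<i> * Complex x y / (2 * pi)"
    have t: "Re \<tau> = - y / (2 * pi)" "Im \<tau> = x / (2 * pi)"
      by (simp_all add: \<tau>_def Re_divide Im_divide power2_eq_square)
    have "(norm \<tau>)\<^sup>2 = (x\<^sup>2 + y\<^sup>2) / (2 * pi)\<^sup>2"
      by (simp add: cmod_power2 t power_divide add_divide_distrib)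
    hence "Im \<tau> / (norm \<tau>)\<^sup>2 = 2 * pi * x / (x\<^sup>2 + y\<^sup>2)"
      by (simp add: t power2_eq_square)
    hence off: "Im \<tau> / (norm \<tau>)\<^sup>2 < sqrt 3 / 2" using near_iff[of y] False by simp
    have "x < 2 * pi / 5" using x1 pi by simp
    hence "norm (\<ff>\<^sub>2 \<tau>) \<le> max 2 (1.08 * exp (pi / (216 * Im \<tau>)))"
      using x0 y pi by (intro \<ff>\<^sub>2_minor_arc off) (auto simp: t field_simps abs_le_iff)
    also have "pi / (216 * Im \<tau>) = v / 18"
      using v by (simp add: t x_def power2_eq_square)
    also have "max 2 (1.08 * exp (v / 18)) = 1.08 * exp (v / 18)" using e10 by simp
    finally have "norm (h y) \<le> B"
      unfolding h_def \<tau>_def[symmetric] norm_mult nE[of y] B_def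
      by (subst mult.commute) (intro mult_right_mono; simp)
    thus ?thesis using False by (auto simp: abs_le_iff)
  qed
  have "continuous_on {-\<delta>..\<delta>} g"
  proof -
    have "x \<noteq> 0" using x0 by simp
    hence "of_real x + \<i> * of_real y \<noteq> (0::complex)" for y :: real by (auto simp: complex_eq_iff)
    thus ?thesis unfolding g_def Complex_eq by (auto intro!: continuous_intros)
  qed
  hence "g integrable_on {-\<delta>..\<delta>}" by (rule integrable_continuous_real)
  hence "(g has_integral integral {-\<delta>..\<delta>} g) {-\<delta>..\<delta>}" by (rule integrable_integral)
  hence "((\<lambda>y. if y \<in> {-\<delta>..\<delta>} then g y else 0) has_integral integral {-\<delta>..\<delta>} g) {-pi..pi}"
    by (subst has_integral_restrict) (use \<delta>1 pi in auto)
  from has_integral_diff[OF h this]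
  have "norm (2 * pi * (sqrt 2 * q n) - integral {-\<delta>..\<delta>} g) \<le> B * (pi - (- pi))"
    using has_integral_bound_real[where B = B and S = "{}" and a = "-pi" and b = pi and f = "\<lambda>y. h y - (if y \<in> {-\<delta>..\<delta>} then g y else 0)"] bd
    by (simp add: B_def)
  moreover have "norm (integral {-\<delta>..\<delta>} g - 2 * pi * a * clifford (a * N)) \<le> exp (N * x) * (4 * x * exp (a * x / \<delta>\<^sup>2) + 2 * \<delta>)"
    unfolding g_def by (rule clifford_segment_integral) (use a01 N0 x0 \<delta>0 in auto)
  moreover have "exp (N * x) * (4 * x * exp (a * x / \<delta>\<^sup>2) + 2 * \<delta>) \<le> exp (v / 2) * 7"
    unfolding Nx
  proof (rule mult_left_mono)
    have "a * x \<le> 1 * \<delta>\<^sup>2"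
    proof -
      have "a * x \<le> x" using mult_right_mono[OF a01(2), of x] x0 by simp
      thus ?thesis unfolding \<delta>2 mult_1 using x0 D7 xx by linarith
    qed
    hence "a * x / \<delta>\<^sup>2 \<le> 1" using \<delta>0 by (simp add: divide_le_eq)
    hence "exp (a * x / \<delta>\<^sup>2) \<le> exp 1" by simp
    also have "\<dots> \<le> 3" by (rule exp_le)
    finally have "4 * x * exp (a * x / \<delta>\<^sup>2) \<le> 4 * 0.026 * 3" using x0 x1 by (intro mult_mono) auto
    thus "4 * x * exp (a * x / \<delta>\<^sup>2) + 2 * \<delta> \<le> 7" using \<delta>1 by simp
  qed simp
  ultimately have "norm (complex_of_real (2 * pi * (sqrt 2 * q n)) - 2 * pi * a * clifford (a * N)) \<le> B * (2 * pi) + exp (v / 2) * 7"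
    using norm_triangle_ineq[of "2 * pi * (sqrt 2 * q n) - integral {-\<delta>..\<delta>} g" "integral {-\<delta>..\<delta>} g - 2 * pi * a * clifford (a * N)"]
    by simp
  also have "complex_of_real (2 * pi * (sqrt 2 * q n)) - 2 * pi * a * clifford (a * N) = of_real (2 * pi * (sqrt 2 * q n - a * clifford (a * N)))"
    by (simp add: algebra_simps)
  also have "norm \<dots> = 2 * pi * \<bar>sqrt 2 * q n - a * clifford (a * N)\<bar>"
    unfolding norm_of_real abs_mult by simp
  \<comment> \<open>The closing sides of the rectangle are absorbed by raising 1.08 to 1.2, as
    \<open>exp (v / 18)\<close> is at least 10.\<close>
  also have "B * (2 * pi) + exp (v / 2) * 7 \<le> 2 * pi * (1.2 * exp (5 * v / 9))"
  proof -
    have e: "exp (5 * v / 9) = exp (v / 18) * exp (v / 2)" unfolding exp_add[symmetric] by simp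
    have "7 \<le> 2 * pi * (0.12 * 10)" using pi by simp
    also have "\<dots> \<le> 2 * pi * (0.12 * exp (v / 18))" using e10 pi by (intro mult_left_mono) auto
    finally have "exp (v / 2) * 7 \<le> exp (v / 2) * (2 * pi * (0.12 * exp (v / 18)))" by (intro mult_left_mono) auto
    moreover have "2 * pi * (1.2 * (exp (v / 18) * exp (v / 2))) =
        1.08 * exp (v / 18) * exp (v / 2) * (2 * pi) + exp (v / 2) * (2 * pi * (0.12 * exp (v / 18)))"
      by (simp add: algebra_simps)
    ultimately show ?thesis unfolding B_def e by linarith
  qed
  finally have "\<bar>sqrt 2 * q n - a * clifford (a * N)\<bar> \<le> 1.2 * exp (5 * v / 9)" by simp
  thus ?thesis by (simp add: N_def v_def)
qed

section \<open>A Riccati equation for ratios of Bessel functions\<close>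

definition clifford' :: "real \<Rightarrow> real" where
  "clifford' y = (\<Sum>k. y ^ k / (fact k * fact (Suc (Suc k))))"

definition clifford'' :: "real \<Rightarrow> real" where
  "clifford'' y = (\<Sum>k. y ^ k / (fact k * fact (Suc (Suc (Suc k)))))"

lemma diffs_clifford: "diffs (\<lambda>k. 1 / (fact k * fact (k + m)) :: real) = (\<lambda>k. 1 / (fact k * fact (k + Suc m)))"
proof
  fix k
  have "fact (Suc k) = real (Suc k) * fact k" by (rule fact_Suc)
  moreover have "Suc k + m = k + Suc m" by simp
  ultimately show "diffs (\<lambda>k. 1 / (fact k * fact (k + m)) :: real) k = 1 / (fact k * fact (k + Suc m))"
    unfolding diffs_def by (simp del: of_nat_Suc fact_Suc)
qed

lemma clifford_general_deriv:
  "((\<lambda>y. \<Sum>k. 1 / (fact k * fact (k + m)) * y ^ k) has_real_derivative (\<Sum>k. 1 / (fact k * fact (k + Suc m)) * y ^ k)) (at y)"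
  using termdiffs_strong_converges_everywhere[of "\<lambda>k. 1 / (fact k * fact (k + m))" y] summable_clifford_general
  unfolding diffs_clifford by simp

lemma clifford_deriv: "(clifford has_real_derivative clifford' y) (at y)"
  using clifford_general_deriv[of 1 y] by (simp add: clifford_def[abs_def] clifford'_def del: fact_Suc)

lemma clifford'_deriv: "(clifford' has_real_derivative clifford'' y) (at y)"
  using clifford_general_deriv[of 2 y] by (simp add: clifford'_def[abs_def] clifford''_def numeral_2_eq_2 numeral_3_eq_3 del: fact_Suc)

lemma clifford'_sums: "(\<lambda>k. y ^ k / (fact k * fact (Suc (Suc k)))) sums clifford' y"
  using summable_sums[OF summable_clifford_general[of 2 y]] by (simp add: clifford'_def del: fact_Suc)

lemma clifford''_sums: "(\<lambda>k. y ^ k / (fact k * fact (Suc (Suc (Suc k))))) sums clifford'' y"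
  using summable_sums[OF summable_clifford_general[of 3 y]] by (simp add: clifford''_def numeral_3_eq_3 del: fact_Suc)

text \<open>This is the modified Bessel equation of order 1 in the variable
  \<open>y = z\<^sup>2 / 4\<close>, checked coefficientwise.\<close>

lemma clifford_ode: "y * clifford'' y + 2 * clifford' y = clifford y"
proof -
  define A where "A k = (case k of 0 \<Rightarrow> 0 | Suc j \<Rightarrow> y * (y ^ j / (fact j * fact (Suc (Suc (Suc j))))))" for k
  have "(\<lambda>j. A (Suc j)) sums (y * clifford'' y)"
    unfolding A_def nat.case by (rule sums_mult[OF clifford''_sums])
  hence "A sums (y * clifford'' y + A 0)" by (rule sums_Suc)
  hence "A sums (y * clifford'' y)" by (simp add: A_def)
  from sums_add[OF this sums_mult[OF clifford'_sums, of 2]]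
  have "(\<lambda>k. A k + 2 * (y ^ k / (fact k * fact (Suc (Suc k))))) sums (y * clifford'' y + 2 * clifford' y)" .
  moreover have "A k + 2 * (y ^ k / (fact k * fact (Suc (Suc k)))) = y ^ k / (fact k * fact (Suc k))" for k
  proof (cases k)
    case (Suc j)
    define F where "F = (fact (Suc (Suc j)) :: real)"
    have F: "F > 0" by (simp add: F_def del: fact_Suc)
    have f: "fact (Suc (Suc (Suc j))) = real (j + 3) * F" "fact (Suc j) = real (Suc j) * (fact j :: real)"
      unfolding F_def by (simp_all add: field_simps)
    have pos: "real j + 3 > 0" "real j + 1 > 0" "(fact j :: real) > 0" by simp_all
    show ?thesis unfolding Suc A_def nat.case f F_def[symmetric] using F pos
      by (simp add: divide_simps del: fact_Suc) (simp add: algebra_simps)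
  qed (simp add: A_def)
  ultimately have "(\<lambda>k. y ^ k / (fact k * fact (Suc k))) sums (y * clifford'' y + 2 * clifford' y)"
    by (simp only:)
  thus ?thesis by (rule sums_unique2[OF _ clifford_sums])
qed

lemma clifford_ge_one:
  assumes "y \<ge> 0" shows "clifford y \<ge> 1"
  using sum_le_suminf[OF sums_summable[OF clifford_sums[of y]], of "{..<1}"] assms
  by (simp add: clifford_def)

lemma clifford'_nonneg:
  assumes "y \<ge> 0" shows "clifford' y \<ge> 0"
  unfolding clifford'_def by (rule suminf_nonneg[OF sums_summable[OF clifford'_sums]]) (use assms in simp)

lemma clifford'_le:
  assumes "y \<ge> 0" shows "clifford' y \<le> clifford y"
  by (rule sums_le[OF _ clifford'_sums clifford_sums])
     (use assms in \<open>auto intro!: divide_left_mono mult_left_mono fact_mono simp del: fact_Suc\<close>)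

text \<open>\<open>bessel_ratio z = I\<^sub>2(z) / I\<^sub>1(z)\<close>\<close>
definition bessel_ratio :: "real \<Rightarrow> real" where
  "bessel_ratio z = z / 2 * (clifford' (z\<^sup>2 / 4) / clifford (z\<^sup>2 / 4))"

lemma bessel_ratio_riccati:
  assumes z: "z > 0"
  shows "(bessel_ratio has_real_derivative (1 - 3 * bessel_ratio z / z - (bessel_ratio z)\<^sup>2)) (at z)"
proof -
  define y where "y = z\<^sup>2 / 4"
  define w where "w = clifford' y / clifford y"
  have y: "y > 0" using z by (simp add: y_def)
  have C0: "clifford y > 0" using clifford_ge_one[of y] y by simp
  have w'': "clifford'' y / clifford y = (1 - 2 * w) / y"
    using clifford_ode[of y] C0 y by (simp add: w_def field_simps)
  have sq: "((\<lambda>z. z\<^sup>2 / 4) has_real_derivative z / 2) (at z)"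
    by (auto intro!: derivative_eq_intros)
  have D: "((\<lambda>z. clifford (z\<^sup>2 / 4)) has_real_derivative clifford' y * (z / 2)) (at z)"
    "((\<lambda>z. clifford' (z\<^sup>2 / 4)) has_real_derivative clifford'' y * (z / 2)) (at z)"
    unfolding y_def by (rule DERIV_chain2[OF clifford_deriv sq] DERIV_chain2[OF clifford'_deriv sq])+
  have half: "((\<lambda>z :: real. z / 2) has_real_derivative 1 / 2) (at z)"
    by (auto intro!: derivative_eq_intros)
  have "clifford (z\<^sup>2 / 4) \<noteq> 0" using C0 by (simp add: y_def)
  from DERIV_mult[OF half DERIV_divide[OF D(2) D(1) this]]
  have "(bessel_ratio has_real_derivative
     (1 / 2 * w + z / 2 * (((clifford'' y * (z / 2)) * clifford y - clifford' y * (clifford' y * (z / 2))) / (clifford y * clifford y)))) (at z)"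
    unfolding bessel_ratio_def[abs_def] w_def y_def by (simp only: mult.commute add.commute)
  moreover have "((clifford'' y * (z / 2)) * clifford y - clifford' y * (clifford' y * (z / 2))) / (clifford y * clifford y)
     = z / 2 * (clifford'' y / clifford y - w\<^sup>2)"
    using C0 by (simp add: w_def field_simps power2_eq_square)
  moreover have "1 / 2 * w + z / 2 * (z / 2 * ((1 - 2 * w) / y - w\<^sup>2)) = 1 - 3 * bessel_ratio z / z - (bessel_ratio z)\<^sup>2"
  proof -
    have b: "bessel_ratio z = z / 2 * w" by (simp add: bessel_ratio_def w_def y_def)
    have "z / 2 * (z / 2) / y = 1" using z by (simp add: y_def power2_eq_square)
    moreover have "z / 2 * (z / 2 * ((1 - 2 * w) / y - w\<^sup>2)) = (z / 2 * (z / 2) / y) * (1 - 2 * w) - (z / 2 * w)\<^sup>2"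
      by (simp add: algebra_simps power2_eq_square diff_divide_distrib add_divide_distrib)
    ultimately have "z / 2 * (z / 2 * ((1 - 2 * w) / y - w\<^sup>2)) = (1 - 2 * w) - (z / 2 * w)\<^sup>2"
      by (simp only: mult_1)
    thus ?thesis unfolding b using z by (simp add: diff_divide_distrib)
  qed
  ultimately show ?thesis unfolding w'' by (simp only:)
qed

section \<open>Comparison principle and polynomial bounds for the Bessel ratio\<close>

lemma bessel_ratio_nonneg: "z \<ge> 0 \<Longrightarrow> bessel_ratio z \<ge> 0"
  unfolding bessel_ratio_def using clifford'_nonneg[of "z\<^sup>2 / 4"] clifford_ge_one[of "z\<^sup>2 / 4"] by simp

text \<open>At \<open>z = 2\<close> both \<open>z / 2\<close> and \<open>z\<^sup>2 / 4\<close> equal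
  1, so comparing coefficients suffices. This is the initial value for the upper bound.\<close>

lemma bessel_ratio_2_le: "bessel_ratio 2 \<le> 1"
  unfolding bessel_ratio_def using clifford'_le[of 1] clifford_ge_one[of 1] by simp

text \<open>The inequality of derivatives is demanded only where \<open>f\<close> exceeds
  \<open>g\<close>. After the last point with \<open>f \<le> g\<close> the difference
  \<open>f - g\<close> cannot increase, so it never becomes positive.\<close>

lemma ode_comparison:
  fixes f g f' g' :: "real \<Rightarrow> real"
  assumes f: "\<And>z. z \<ge> a \<Longrightarrow> (f has_real_derivative f' z) (at z)"
    and g: "\<And>z. z \<ge> a \<Longrightarrow> (g has_real_derivative g' z) (at z)"
    and le: "\<And>z. z \<ge> a \<Longrightarrow> f z > g z \<Longrightarrow> f' z \<le> g' z"
    and init: "f a \<le> g a" and b: "b \<ge> a"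
  shows "f b \<le> g b"
proof (rule ccontr)
  assume neg: "\<not> f b \<le> g b"
  define S where "S = {z \<in> {a..b}. f z \<le> g z}"
  have cont: "continuous_on {a..b} f" "continuous_on {a..b} g"
    using f g by (auto intro!: continuous_at_imp_continuous_on DERIV_isCont)
  have "closed S" unfolding S_def
    using continuous_closed_preimage[OF continuous_on_diff[OF cont], of "{..0}"]
    by (simp add: vimage_def Int_def)
  hence cS: "compact S" unfolding S_def
    by (metis (no_types, lifting) S_def compact_Icc compact_Int_closed inf.absorb_iff2 mem_Collect_eq subsetI)
  have aS: "a \<in> S" using init b by (simp add: S_def)
  obtain s where s: "s \<in> S" "\<And>z. z \<in> S \<Longrightarrow> z \<le> s"
    using compact_attains_sup[OF cS] aS by auto
  have sb: "s < b" using s(1) neg by (auto simp: S_def le_less)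
  have gt: "f z > g z" if "s < z" "z \<le> b" for z
  proof (rule ccontr)
    assume "\<not> f z > g z"
    hence "z \<in> S" using s(1) that by (simp add: S_def)
    with s(2)[of z] that show False by simp
  qed
  have "f b - g b \<le> f s - g s"
  proof (rule DERIV_nonpos_imp_decreasing_open[of s b "\<lambda>z. f z - g z"])
    show "s \<le> b" using sb by simp
    show "\<exists>y. ((\<lambda>z. f z - g z) has_real_derivative y) (at z) \<and> y \<le> 0" if "s < z" "z < b" for z
    proof (intro exI conjI)
      have za: "z \<ge> a" using s(1) that by (simp add: S_def)
      show "((\<lambda>z. f z - g z) has_real_derivative (f' z - g' z)) (at z)" by (intro DERIV_diff f g za)
      show "f' z - g' z \<le> 0" using le[OF za] gt that by simp
    qed
    show "continuous_on {s..b} (\<lambda>z. f z - g z)"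
      by (rule continuous_on_subset[OF continuous_on_diff[OF cont]]) (use s(1) in \<open>auto simp: S_def\<close>)
  qed
  with s(1) neg show False by (simp add: S_def)
qed

lemma bessel_ratio_upper:
  assumes U: "\<And>z. z \<ge> a \<Longrightarrow> (U has_real_derivative U' z) (at z)"
    and sup: "\<And>z. z \<ge> a \<Longrightarrow> U' z \<ge> 1 - 3 * U z / z - (U z)\<^sup>2"
    and pos: "\<And>z. z \<ge> a \<Longrightarrow> U z \<ge> 0"
    and a: "a > 0" "bessel_ratio a \<le> U a" and b: "b \<ge> a"
  shows "bessel_ratio b \<le> U b"
proof (rule ode_comparison[where f = bessel_ratio and f' = "\<lambda>z. 1 - 3 * bessel_ratio z / z - (bessel_ratio z)\<^sup>2" and g = U and g' = U' and a = a])
  fix z assume z: "z \<ge> a"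
  hence z0: "z > 0" using a by simp
  show "(bessel_ratio has_real_derivative (1 - 3 * bessel_ratio z / z - (bessel_ratio z)\<^sup>2)) (at z)"
    by (rule bessel_ratio_riccati[OF z0])
  assume gt: "U z < bessel_ratio z"
  have "3 * U z / z \<le> 3 * bessel_ratio z / z" using gt z0 by (simp add: divide_right_mono)
  moreover have "(U z)\<^sup>2 \<le> (bessel_ratio z)\<^sup>2" using gt pos[OF z] by (intro power_mono) auto
  ultimately show "1 - 3 * bessel_ratio z / z - (bessel_ratio z)\<^sup>2 \<le> U' z" using sup[OF z] by linarith
qed (use U a b in auto)

text \<open>The two Riccati right-hand sides differ by
  \<open>(U z - bessel_ratio z) * (3 / z + U z + bessel_ratio z)\<close>. The bound
  \<open>- 3 / z \<le> U z\<close> makes the second factor nonnegative and admits subsolutions that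
  start with negative values.\<close>

lemma bessel_ratio_lower:
  assumes U: "\<And>z. z \<ge> a \<Longrightarrow> (U has_real_derivative U' z) (at z)"
    and sub: "\<And>z. z \<ge> a \<Longrightarrow> U' z \<le> 1 - 3 * U z / z - (U z)\<^sup>2"
    and neg: "\<And>z. z \<ge> a \<Longrightarrow> - 3 / z \<le> U z"
    and a: "a > 0" "U a \<le> bessel_ratio a" and b: "b \<ge> a"
  shows "U b \<le> bessel_ratio b"
proof (rule ode_comparison[where g = bessel_ratio and g' = "\<lambda>z. 1 - 3 * bessel_ratio z / z - (bessel_ratio z)\<^sup>2" and f = U and f' = U' and a = a])
  fix z assume z: "z \<ge> a"
  hence z0: "z > 0" using a by simp
  show "(bessel_ratio has_real_derivative (1 - 3 * bessel_ratio z / z - (bessel_ratio z)\<^sup>2)) (at z)"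
    by (rule bessel_ratio_riccati[OF z0])
  assume gt: "U z > bessel_ratio z"
  have "0 \<le> (U z - bessel_ratio z) * (3 / z + U z + bessel_ratio z)"
    using gt neg[OF z] bessel_ratio_nonneg[of z] z0 by (intro mult_nonneg_nonneg) (auto simp: field_simps)
  also have "\<dots> = (3 * U z / z + (U z)\<^sup>2) - (3 * bessel_ratio z / z + (bessel_ratio z)\<^sup>2)"
    by (simp add: algebra_simps power2_eq_square add_divide_distrib diff_divide_distrib)
  finally show "U' z \<le> 1 - 3 * bessel_ratio z / z - (bessel_ratio z)\<^sup>2" using sub[OF z] by linarith
qed (use U a b in auto)

text \<open>With \<open>u = 1 / z\<close>, the coefficients are those of the asymptotic expansion of \<open>bessel_ratio\<close>, whose next
  coefficient is \<open>c = 63/128\<close>; \<open>c\<close> and \<open>d\<close> are free so that the polynomial can be made a super- or subsolution.\<close>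
definition ratio_poly :: "real \<Rightarrow> real \<Rightarrow> real \<Rightarrow> real" where
  "ratio_poly c d u = 1 - 3/2 * u + 3/8 * u ^ 2 + 3/8 * u ^ 3 + c * u ^ 4 + d * u ^ 5"

definition ratio_poly' :: "real \<Rightarrow> real \<Rightarrow> real \<Rightarrow> real" where
  "ratio_poly' c d u = - 3/2 + 3/4 * u + 9/8 * u ^ 2 + 4 * c * u ^ 3 + 5 * d * u ^ 4"

lemma ratio_poly_deriv:
  assumes "z > 0"
  shows "((\<lambda>z. ratio_poly c d (1 / z)) has_real_derivative (ratio_poly' c d (1 / z) * (- (1 / z)\<^sup>2))) (at z)"
proof -
  have "(ratio_poly c d has_real_derivative ratio_poly' c d u) (at u)" for u
    unfolding ratio_poly_def[abs_def] ratio_poly'_def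
    by (rule derivative_eq_intros refl | simp)+
  moreover have "((\<lambda>z. 1 / z) has_real_derivative (- (1 / z)\<^sup>2)) (at z)"
    using assms by (auto intro!: derivative_eq_intros simp: power2_eq_square)
  ultimately show ?thesis by (rule DERIV_chain2)
qed

text \<open>The subsolution vanishes at \<open>3 / 2\<close>, where nonnegativity of the ratio
  starts the comparison. Its integral is the logarithm of \<open>exp z / (z * sqrt z)\<close> up to
  a constant, the growth needed later.\<close>

lemma bessel_ratio_ge_linear:
  assumes "z \<ge> 3 / 2"
  shows "bessel_ratio z \<ge> 1 - 3 / 2 / z"
proof (rule bessel_ratio_lower[where U = "\<lambda>z. 1 - 3 / 2 / z" and U' = "\<lambda>z. 3 / 2 / z\<^sup>2" and a = "3 / 2"])
  fix z :: real assume z: "3 / 2 \<le> z"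
  show "((\<lambda>z. 1 - 3 / 2 / z) has_real_derivative 3 / 2 / z\<^sup>2) (at z)"
    using z by (auto intro!: derivative_eq_intros simp: power2_eq_square)
  show "3 / 2 / z\<^sup>2 \<le> 1 - 3 * (1 - 3 / 2 / z) / z - (1 - 3 / 2 / z)\<^sup>2"
    using z by (simp add: field_simps power2_eq_square)
  show "- 3 / z \<le> 1 - 3 / 2 / z" using z by (simp add: field_simps)
qed (use assms bessel_ratio_nonneg[of "3/2"] in auto)

text \<open>With the exact coefficients up to \<open>u ^ 4\<close> the defect in the Riccati
  equation is divisible by \<open>u ^ 5\<close>, so only the sign of a bracket matters. The value 19
  is the least integer for which the polynomial is at least 1 at \<open>z = 2\<close>.\<close>

lemma bessel_ratio_upper_poly:
  assumes "z \<ge> 2"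
  shows "bessel_ratio z \<le> ratio_poly (63/128) 19 (1 / z)"
proof (rule bessel_ratio_upper[where U' = "\<lambda>z. ratio_poly' (63/128) 19 (1 / z) * (- (1 / z)\<^sup>2)" and a = 2])
  fix z :: real assume z: "2 \<le> z"
  define u where "u = 1 / z"
  have u: "0 \<le> u" "u \<le> 1 / 2" using z by (auto simp: u_def)
  show "((\<lambda>z. ratio_poly (63/128) 19 (1 / z)) has_real_derivative ratio_poly' (63/128) 19 (1 / z) * (- (1 / z)\<^sup>2)) (at z)"
    by (rule ratio_poly_deriv) (use z in simp)
  \<comment> \<open>The tangents of \<open>u ^ 5\<close> and \<open>u ^ 2\<close> at
    \<open>2 / 5\<close>, near the minimum of the bracket, reduce its positivity to a linear
    problem.\<close>
  have "0 \<le> (u - 2/5)\<^sup>2 * (u ^ 3 + 4/5 * u ^ 2 + 12/25 * u + 32/125)"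
    using u by (intro mult_nonneg_nonneg) auto
  also have "\<dots> = u ^ 5 - 16/125 * u + 128/3125" by (simp add: algebra_simps power2_eq_square power3_eq_cube eval_nat_numeral)
  finally have u5: "u ^ 5 \<ge> 16/125 * u - 128/3125" by simp
  have u2: "u ^ 2 \<ge> 4/5 * u - 4/25" using zero_le_power2[of "u - 2/5"] by (simp add: algebra_simps power2_eq_square)
  have "0 \<le> u ^ 5 * (581/16 - 48379/512 * u + 7485/512 * u ^ 2 + 237441/16384 * u ^ 3 + 1197/64 * u ^ 4 + 361 * u ^ 5)"
  proof (rule mult_nonneg_nonneg)
    show "0 \<le> 581/16 - 48379/512 * u + 7485/512 * u ^ 2 + 237441/16384 * u ^ 3 + 1197/64 * u ^ 4 + 361 * u ^ 5"
      using u u2 u5 zero_le_power[OF u(1), of 3] zero_le_power[OF u(1), of 4] by linarith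
  qed (use u in simp)
  also have "\<dots> = ratio_poly' (63/128) 19 u * (- u\<^sup>2) - (1 - 3 * ratio_poly (63/128) 19 u * u - (ratio_poly (63/128) 19 u)\<^sup>2)"
    unfolding ratio_poly_def ratio_poly'_def by algebra
  finally show "1 - 3 * ratio_poly (63/128) 19 (1 / z) / z - (ratio_poly (63/128) 19 (1 / z))\<^sup>2 \<le> ratio_poly' (63/128) 19 (1 / z) * (- (1 / z)\<^sup>2)"
    by (simp add: u_def)
  show "0 \<le> ratio_poly (63/128) 19 (1 / z)"
    unfolding ratio_poly_def u_def[symmetric] using u by (intro add_nonneg_nonneg) auto
qed (use assms bessel_ratio_2_le in \<open>auto simp: ratio_poly_def power_divide\<close>)

text \<open>Only needed to start the comparison at \<open>z = 5\<close> in the next lemma.\<close>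
lemma bessel_ratio_lower_coarse:
  assumes "z \<ge> 5 / 2"
  shows "bessel_ratio z \<ge> ratio_poly (-20) 0 (1 / z)"
proof (rule bessel_ratio_lower[where U = "\<lambda>z. ratio_poly (-20) 0 (1 / z)" and U' = "\<lambda>z. ratio_poly' (-20) 0 (1 / z) * (- (1 / z)\<^sup>2)" and a = "5 / 2"])
  fix z :: real assume z: "5 / 2 \<le> z"
  define u where "u = 1 / z"
  have u: "0 \<le> u" "u \<le> 2 / 5" using z by (auto simp: u_def field_simps)
  show "((\<lambda>z. ratio_poly (-20) 0 (1 / z)) has_real_derivative ratio_poly' (-20) 0 (1 / z) * (- (1 / z)\<^sup>2)) (at z)"
    by (rule ratio_poly_deriv) (use z in simp)
  have u2: "u ^ 2 \<ge> 4/5 * u - 4/25" using zero_le_power2[of "u - 2/5"] by (simp add: algebra_simps power2_eq_square)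
  have u34: "u ^ 3 \<le> 4/25 * u" "u ^ 4 \<le> 2/5 * u ^ 3"
    using u mult_mono[of u "2/5" u "2/5"] mult_right_mono[of "u*u" "4/25" u] mult_right_mono[of u "2/5" "u ^ 3"]
    by (auto simp: eval_nat_numeral mult_ac)
  have "u ^ 4 * (- 2623/64 + 2569/32 * u - 951/64 * u ^ 2 - 15 * u ^ 3 + 400 * u ^ 4) \<le> 0"
  proof (rule mult_nonneg_nonpos)
    show "- 2623/64 + 2569/32 * u - 951/64 * u ^ 2 - 15 * u ^ 3 + 400 * u ^ 4 \<le> 0"
      using u u2 u34 by linarith
  qed (use u in simp)
  also have "u ^ 4 * (- 2623/64 + 2569/32 * u - 951/64 * u ^ 2 - 15 * u ^ 3 + 400 * u ^ 4) =
      ratio_poly' (-20) 0 u * (- u\<^sup>2) - (1 - 3 * ratio_poly (-20) 0 u * u - (ratio_poly (-20) 0 u)\<^sup>2)"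
    unfolding ratio_poly_def ratio_poly'_def by algebra
  finally show "ratio_poly' (-20) 0 (1 / z) * (- (1 / z)\<^sup>2) \<le> 1 - 3 * ratio_poly (-20) 0 (1 / z) / z - (ratio_poly (-20) 0 (1 / z))\<^sup>2"
    by (simp add: u_def)
  have "20 * u ^ 4 \<le> 1" using u34 u by linarith
  hence "0 \<le> ratio_poly (-20) 0 u + 3 * u"
    unfolding ratio_poly_def using u zero_le_power[OF u(1), of 2] zero_le_power[OF u(1), of 3] by linarith
  thus "- 3 / z \<le> ratio_poly (-20) 0 (1 / z)" by (simp add: u_def)
\<comment> \<open>The coefficient -20 makes the polynomial slightly negative at
  \<open>5 / 2\<close>, so nonnegativity of the ratio is enough to start.\<close>
qed (use assms bessel_ratio_nonneg[of "5/2"] in \<open>auto simp: ratio_poly_def power_divide\<close>)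

text \<open>-103 is the largest integer that keeps the polynomial below the coarse bound at
  \<open>z = 5\<close>.\<close>

lemma bessel_ratio_lower_poly:
  assumes "z \<ge> 5"
  shows "bessel_ratio z \<ge> ratio_poly (63/128) (-103) (1 / z)"
proof (rule bessel_ratio_lower[where U = "\<lambda>z. ratio_poly (63/128) (-103) (1 / z)" and U' = "\<lambda>z. ratio_poly' (63/128) (-103) (1 / z) * (- (1 / z)\<^sup>2)" and a = 5])
  fix z :: real assume z: "5 \<le> z"
  define u where "u = 1 / z"
  have u: "0 \<le> u" "u \<le> 1 / 5" using z by (auto simp: u_def field_simps)
  show "((\<lambda>z. ratio_poly (63/128) (-103) (1 / z)) has_real_derivative ratio_poly' (63/128) (-103) (1 / z) * (- (1 / z)\<^sup>2)) (at z)"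
    by (rule ratio_poly_deriv) (use z in simp)
  have u5: "u ^ 5 \<le> 1 / 3125" using power_mono[OF u(2,1), of 5] by (simp add: power_divide)
  have "u ^ 5 * (- 3323/16 + 263941/512 * u - 39363/512 * u ^ 2 - 1261695/16384 * u ^ 3 - 6489/64 * u ^ 4 + 10609 * u ^ 5) \<le> 0"
  proof (rule mult_nonneg_nonpos)
    show "- 3323/16 + 263941/512 * u - 39363/512 * u ^ 2 - 1261695/16384 * u ^ 3 - 6489/64 * u ^ 4 + 10609 * u ^ 5 \<le> 0"
      using u u5 zero_le_power[OF u(1), of 2] zero_le_power[OF u(1), of 3] zero_le_power[OF u(1), of 4]
      by linarith
  qed (use u in simp)
  also have "u ^ 5 * (- 3323/16 + 263941/512 * u - 39363/512 * u ^ 2 - 1261695/16384 * u ^ 3 - 6489/64 * u ^ 4 + 10609 * u ^ 5) =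
      ratio_poly' (63/128) (-103) u * (- u\<^sup>2) - (1 - 3 * ratio_poly (63/128) (-103) u * u - (ratio_poly (63/128) (-103) u)\<^sup>2)"
    unfolding ratio_poly_def ratio_poly'_def by algebra
  finally show "ratio_poly' (63/128) (-103) (1 / z) * (- (1 / z)\<^sup>2) \<le> 1 - 3 * ratio_poly (63/128) (-103) (1 / z) / z - (ratio_poly (63/128) (-103) (1 / z))\<^sup>2"
    by (simp add: u_def)
  have "0 \<le> ratio_poly (63/128) (-103) u + 3 * u"
    unfolding ratio_poly_def using u u5 zero_le_power[OF u(1), of 2] zero_le_power[OF u(1), of 3] zero_le_power[OF u(1), of 4]
    by linarith
  thus "- 3 / z \<le> ratio_poly (63/128) (-103) (1 / z)" by (simp add: u_def)
next
  show "ratio_poly (63/128) (-103) (1 / 5) \<le> bessel_ratio 5"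
    using bessel_ratio_lower_coarse[of 5] by (simp add: ratio_poly_def power_divide)
qed (use assms in auto)

text \<open>The worse side is the lower one: \<open>63 / 128 - 103 / 66\<close> is just above
  \<open>- 11 / 10\<close>.\<close>

lemma bessel_ratio_approx:
  assumes "z \<ge> 66"
  shows "\<bar>bessel_ratio z - ratio_poly 0 0 (1 / z)\<bar> \<le> 11/10 * (1 / z) ^ 4"
proof -
  define u where "u = 1 / z"
  have u: "0 \<le> u" "u \<le> 1 / 66" using assms by (auto simp: u_def field_simps)
  have "u ^ 5 \<le> 1 / 66 * u ^ 4" using mult_right_mono[OF u(2), of "u ^ 4"] u by (simp add: eval_nat_numeral)
  moreover have "bessel_ratio z \<le> ratio_poly (63/128) 19 u" "ratio_poly (63/128) (-103) u \<le> bessel_ratio z"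
    using bessel_ratio_upper_poly[of z] bessel_ratio_lower_poly[of z] assms by (simp_all add: u_def)
  ultimately show ?thesis unfolding ratio_poly_def u_def[symmetric] abs_le_iff
    using zero_le_power[OF u(1), of 4] by (intro conjI; linarith)
qed

section \<open>Logarithmic derivatives and growth of the main term\<close>

definition log_clifford'' :: "real \<Rightarrow> real \<Rightarrow> real" where
  "log_clifford'' a N = (let z = 2 * sqrt (a * N) in 4 * a\<^sup>2 / z\<^sup>2 * (1 - 4 * bessel_ratio z / z - (bessel_ratio z)\<^sup>2))"

lemma log_clifford_derivs:
  assumes a: "a > 0" and N: "N > 0"
  shows "((\<lambda>N. ln (clifford (a * N))) has_real_derivative (a * (clifford' (a * N) / clifford (a * N)))) (at N)"
    and "((\<lambda>N. a * (clifford' (a * N) / clifford (a * N))) has_real_derivative log_clifford'' a N) (at N)"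
proof -
  define y where "y = a * N"
  define C where "C = clifford y"
  define w where "w = clifford' y / C"
  have y: "y > 0" using a N by (simp add: y_def)
  have C0: "C > 0" using clifford_ge_one[of y] y by (simp add: C_def)
  have lin: "((\<lambda>N. a * N) has_real_derivative a) (at N)" by (auto intro!: derivative_eq_intros)
  have D: "((\<lambda>N. clifford (a * N)) has_real_derivative clifford' y * a) (at N)"
    "((\<lambda>N. clifford' (a * N)) has_real_derivative clifford'' y * a) (at N)"
    unfolding y_def by (rule DERIV_chain2[OF clifford_deriv lin] DERIV_chain2[OF clifford'_deriv lin])+
  show "((\<lambda>N. ln (clifford (a * N))) has_real_derivative (a * (clifford' (a * N) / clifford (a * N)))) (at N)"
    using DERIV_chain2[OF DERIV_ln[OF C0[unfolded C_def y_def]] D(1)]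
    by (simp add: y_def field_simps)
  define z where "z = 2 * sqrt y"
  have z: "z > 0" "z\<^sup>2 / 4 = y" using y by (simp_all add: z_def power_mult_distrib)
  have w: "bessel_ratio z = z / 2 * w" unfolding bessel_ratio_def z w_def C_def ..
  have w'': "clifford'' y / C = (1 - 2 * w) / y"
    using clifford_ode[of y] C0 y by (simp add: w_def C_def field_simps)
  have "((\<lambda>N. a * (clifford' (a * N) / clifford (a * N))) has_real_derivative
      a * ((clifford'' y * a * C - clifford' y * (clifford' y * a)) / (C * C))) (at N)"
    using DERIV_cmult[OF DERIV_divide[OF D(2) D(1)], of a] C0 by (simp add: y_def C_def)
  moreover have "a * ((clifford'' y * a * C - clifford' y * (clifford' y * a)) / (C * C)) = a\<^sup>2 * (clifford'' y / C - w\<^sup>2)"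
    using C0 by (simp add: w_def field_simps power2_eq_square)
  moreover have "a\<^sup>2 * ((1 - 2 * w) / y - w\<^sup>2) = log_clifford'' a N"
  proof -
    have "4 * a\<^sup>2 / z\<^sup>2 * (1 - 4 * (z / 2 * w) / z - (z / 2 * w)\<^sup>2) = a\<^sup>2 * ((1 - 2 * w) / (z\<^sup>2 / 4) - w\<^sup>2)"
      using z(1) by (simp add: field_simps power2_eq_square)
    thus ?thesis unfolding log_clifford''_def Let_def y_def[symmetric] z_def[symmetric] w z(2) by simp
  qed
  ultimately show "((\<lambda>N. a * (clifford' (a * N) / clifford (a * N))) has_real_derivative log_clifford'' a N) (at N)"
    unfolding w'' by simp
qed

text \<open>\<open>bessel_ratio\<close> is the logarithmic derivative of
  \<open>clifford (z\<^sup>2 / 4)\<close>, so \<open>bessel_ratio_ge_linear\<close> makes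
  \<open>L\<close> nondecreasing and the value at 2 decides.\<close>

lemma clifford_growth:
  assumes "z \<ge> 2"
  shows "clifford (z\<^sup>2 / 4) \<ge> exp z / (2 * (z * sqrt z))"
proof -
  define L where "L z = ln (clifford (z\<^sup>2 / 4)) - z + 3/2 * ln z" for z
  have "L 2 \<le> L z"
  proof (rule DERIV_nonneg_imp_nondecreasing[OF assms])
    fix x :: real assume x: "2 \<le> x" "x \<le> z"
    have C0: "clifford (x\<^sup>2 / 4) > 0" using clifford_ge_one[of "x\<^sup>2 / 4"] by simp
    have sq: "((\<lambda>z. z\<^sup>2 / 4) has_real_derivative x / 2) (at x)"
      by (auto intro!: derivative_eq_intros)
    have "((\<lambda>z. ln (clifford (z\<^sup>2 / 4))) has_real_derivative bessel_ratio x) (at x)"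
      using DERIV_chain2[OF DERIV_ln[OF C0] DERIV_chain2[OF clifford_deriv sq]] C0
      by (simp add: bessel_ratio_def field_simps)
    moreover have "((\<lambda>z. 3/2 * ln z) has_real_derivative 3/2 / x) (at x)"
      using x by (auto intro!: derivative_eq_intros)
    ultimately have "(L has_real_derivative (bessel_ratio x - 1 + 3/2 / x)) (at x)"
      unfolding L_def[abs_def] by (intro DERIV_add DERIV_diff DERIV_ident)
    moreover have "0 \<le> bessel_ratio x - 1 + 3/2 / x" using bessel_ratio_ge_linear[of x] x by simp
    ultimately show "\<exists>y. (L has_real_derivative y) (at x) \<and> 0 \<le> y" by blast
  qed
  hence "exp (L 2) \<le> exp (L z)" by simp
  have e: "exp (L x) = clifford (x\<^sup>2 / 4) * (x * sqrt x) / exp x" if "x > 0" for x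
  proof -
    have C0: "clifford (x\<^sup>2 / 4) > 0" using clifford_ge_one[of "x\<^sup>2 / 4"] by simp
    have "3/2 * ln x = ln x + ln (sqrt x)" using that by (simp add: ln_sqrt)
    thus ?thesis using that C0 by (simp only: L_def exp_add exp_diff exp_ln real_sqrt_gt_zero) simp
  qed
  \<comment> \<open>The first three terms of the series are 1, 1/2 and 1/12.\<close>
  have "clifford 1 \<ge> 19 / 12"
    using sum_le_suminf[OF sums_summable[OF clifford_sums[of 1]], of "{..<3}"]
    by (simp add: clifford_def eval_nat_numeral)
  moreover have "sqrt 2 \<ge> 1.4" by (rule real_le_rsqrt) (simp add: power2_eq_square)
  ultimately have "19/12 * (2 * 1.4) \<le> clifford 1 * (2 * sqrt 2)" by (intro mult_mono) auto
  moreover have "exp 2 \<le> (2.72 :: real) ^ 2"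
    using power_mono[of "exp 1 :: real" "2.72" 2] e_less_272 by (simp flip: exp_double)
  ultimately have "exp 2 / 2 \<le> clifford 1 * (2 * sqrt 2)" by (simp add: power2_eq_square)
  hence "1 / 2 \<le> exp (L 2)" unfolding e[of 2, simplified] by (simp add: field_simps)
  with \<open>exp (L 2) \<le> exp (L z)\<close> have "1 / 2 \<le> exp (L z)" by linarith
  moreover have "z > 0" using assms by simp
  ultimately have "1 / 2 \<le> clifford (z\<^sup>2 / 4) * (z * sqrt z) / exp z" by (simp only: e)
  thus ?thesis using assms by (simp add: field_simps)
qed

section \<open>Second differences and the final estimate\<close>

text \<open>The hypothesis concerns the sum of \<open>g''\<close> at two symmetric points, in which
  variation of odd order in \<open>s\<close> cancels; bounds for \<open>g''\<close> at single points
  would be too weak.\<close>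

lemma second_difference_le:
  fixes g g' g'' :: "real \<Rightarrow> real"
  assumes g: "\<And>x. N - 1 \<le> x \<Longrightarrow> x \<le> N + 1 \<Longrightarrow> (g has_real_derivative g' x) (at x)"
    and g': "\<And>x. N - 1 \<le> x \<Longrightarrow> x \<le> N + 1 \<Longrightarrow> (g' has_real_derivative g'' x) (at x)"
    and le: "\<And>s. 0 \<le> s \<Longrightarrow> s \<le> 1 \<Longrightarrow> g'' (N + s) + g'' (N - s) \<le> 2 * M"
  shows "g (N + 1) + g (N - 1) - 2 * g N \<le> M"
proof -
  define D where "D s = g (N + s) + g (N - s) - 2 * g N - M * s\<^sup>2" for s
  define E where "E s = g' (N + s) - g' (N - s) - 2 * M * s" for s
  have shift: "((\<lambda>s. N + s) has_real_derivative 1) (at s)" "((\<lambda>s. N - s) has_real_derivative -1) (at s)" for s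
    by (auto intro!: derivative_eq_intros)
  have D: "(D has_real_derivative E s) (at s)" if "0 \<le> s" "s \<le> 1" for s
    unfolding D_def[abs_def] E_def
    using DERIV_chain2[OF g shift(1), of s] DERIV_chain2[OF g shift(2), of s] that
    by (auto intro!: derivative_eq_intros)
  have E: "(E has_real_derivative (g'' (N + s) + g'' (N - s) - 2 * M)) (at s)" if "0 \<le> s" "s \<le> 1" for s
    unfolding E_def[abs_def]
    using DERIV_chain2[OF g' shift(1), of s] DERIV_chain2[OF g' shift(2), of s] that
    by (auto intro!: derivative_eq_intros)
  have E0: "E s \<le> 0" if s: "0 \<le> s" "s \<le> 1" for s
  proof -
    have "E s \<le> E 0"
    proof (rule DERIV_nonpos_imp_nonincreasing[OF s(1)])
      fix x assume "0 \<le> x" "x \<le> s"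
      thus "\<exists>y. (E has_real_derivative y) (at x) \<and> y \<le> 0"
        using E[of x] le[of x] s by (intro exI[of _ "g'' (N + x) + g'' (N - x) - 2 * M"]) auto
    qed
    thus ?thesis by (simp add: E_def)
  qed
  have "D 1 \<le> D 0"
    by (rule DERIV_nonpos_imp_nonincreasing) (use D E0 in auto)
  thus ?thesis by (simp add: D_def)
qed

lemma second_difference_ge:
  fixes g g' g'' :: "real \<Rightarrow> real"
  assumes g: "\<And>x. N - 1 \<le> x \<Longrightarrow> x \<le> N + 1 \<Longrightarrow> (g has_real_derivative g' x) (at x)"
    and g': "\<And>x. N - 1 \<le> x \<Longrightarrow> x \<le> N + 1 \<Longrightarrow> (g' has_real_derivative g'' x) (at x)"
    and ge: "\<And>s. 0 \<le> s \<Longrightarrow> s \<le> 1 \<Longrightarrow> g'' (N + s) + g'' (N - s) \<ge> 2 * M"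
  shows "g (N + 1) + g (N - 1) - 2 * g N \<ge> M"
proof -
  have "- g (N + 1) + - g (N - 1) - 2 * - g N \<le> - M"
  proof (rule second_difference_le[where g = "\<lambda>x. - g x" and g' = "\<lambda>x. - g' x" and g'' = "\<lambda>x. - g'' x"])
    show "- g'' (N + s) + - g'' (N - s) \<le> 2 * - M" if "0 \<le> s" "s \<le> 1" for s
      using ge[OF that] by linarith
  qed (use g g' in \<open>auto intro!: DERIV_minus\<close>)
  thus ?thesis by linarith
qed

text \<open>\<open>log_clifford''\<close> divided by \<open>4 * a\<^sup>2\<close>, expanded in
  \<open>u = 1 / \<nu> n\<close> and cut after \<open>u ^ 5\<close>. For
  \<open>a = pi\<^sup>2 / 12\<close> the factor is \<open>pi ^ 4 / 36\<close>, and the coefficients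
  become those of \<open>E\<^sub>Q\<close>.\<close>

definition sqrt_expansion :: "real \<Rightarrow> real" where
  "sqrt_expansion u = - (u ^ 3) + 3 * u ^ 4 - 9/8 * u ^ 5"

text \<open>The error of \<open>bessel_ratio_approx\<close> is multiplied by a factor close to 2,
  giving at most \<open>23 / 10 * u ^ 4\<close>; the discarded powers of \<open>u\<close> add little
  more than \<open>33 / 64 * u ^ 4\<close>. Together they stay below
  \<open>3 * u ^ 4\<close>.\<close>

lemma log_clifford''_approx:
  assumes a: "a > 0" and N: "N > 0" and z: "2 * sqrt (a * N) \<ge> 66"
  defines "u \<equiv> 1 / (2 * sqrt (a * N))"
  shows "\<bar>log_clifford'' a N - 4 * a\<^sup>2 * sqrt_expansion u\<bar> \<le> 4 * a\<^sup>2 * (3 * u ^ 6)"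
proof -
  define r where "r = bessel_ratio (2 * sqrt (a * N))"
  define e where "e = r - ratio_poly 0 0 u"
  have "1 / (2 * sqrt (a * N)) \<le> 1 / 66" by (rule divide_left_mono) (use a N z in auto)
  hence u: "0 \<le> u" "u \<le> 1 / 66" using a N by (auto simp: u_def)
  have e: "\<bar>e\<bar> \<le> 11/10 * u ^ 4" unfolding e_def r_def u_def by (rule bessel_ratio_approx[OF z])
  have u4: "u ^ 4 \<ge> 0" "u ^ 5 \<le> 1/66 * u ^ 4" "u ^ 6 \<le> 1/66 * u ^ 4" "u ^ 5 \<ge> 0" "u ^ 6 \<ge> 0" "u ^ 4 \<le> 1/66"
  proof -
    show "u ^ 5 \<le> 1/66 * u ^ 4" using mult_right_mono[OF u(2), of "u ^ 4"] u by (simp add: eval_nat_numeral)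
    have "u ^ 6 \<le> u ^ 5" using u by (intro power_decreasing) auto
    with \<open>u ^ 5 \<le> 1/66 * u ^ 4\<close> show "u ^ 6 \<le> 1/66 * u ^ 4" by simp
    show "u ^ 4 \<le> 1/66" using power_decreasing[of 1 4 u] u by simp
  qed (use u in auto)
  have R: "\<bar>ratio_poly 0 0 u\<bar> \<le> 1"
  proof -
    have "u ^ 2 \<le> u" "u ^ 3 \<le> u" using power_decreasing[of 1 2 u] power_decreasing[of 1 3 u] u by simp_all
    thus ?thesis unfolding ratio_poly_def abs_le_iff using u zero_le_power[OF u(1), of 2] zero_le_power[OF u(1), of 3]
      by (intro conjI; linarith)
  qed
  define W where "W = e * (4 * u + 2 * ratio_poly 0 0 u + e)"
  have eq: "1 - 4 * r * u - r\<^sup>2 - (- u + 3 * u\<^sup>2 - 9/8 * u ^ 3)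
     = - (33/64 * u ^ 4 + 9/32 * u ^ 5 + 9/64 * u ^ 6) - W"
  proof -
    have r: "r = ratio_poly 0 0 u + e" by (simp add: e_def)
    show ?thesis unfolding W_def r ratio_poly_def by algebra
  qed
  have W: "\<bar>W\<bar> \<le> 11/10 * u ^ 4 * (2 + 6/66)"
    unfolding W_def abs_mult
  proof (intro mult_mono e)
    have "\<bar>e\<bar> \<le> 11/10 * (1/66)" using e u4 by linarith
    thus "\<bar>4 * u + 2 * ratio_poly 0 0 u + e\<bar> \<le> 2 + 6/66" using R u unfolding abs_le_iff by linarith
  qed (use u in auto)
  have K: "\<bar>1 - 4 * r * u - r\<^sup>2 - (- u + 3 * u\<^sup>2 - 9/8 * u ^ 3)\<bar> \<le> 3 * u ^ 4"
  proof -
    have "\<bar>W\<bar> \<le> 23/10 * u ^ 4" using W by simp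
    thus ?thesis unfolding eq using u4 by linarith
  qed
  have "log_clifford'' a N = 4 * a\<^sup>2 * u\<^sup>2 * (1 - 4 * r * u - r\<^sup>2)"
    unfolding log_clifford''_def Let_def r_def u_def by (simp add: power_divide)
  hence "log_clifford'' a N - 4 * a\<^sup>2 * sqrt_expansion u = 4 * a\<^sup>2 * u\<^sup>2 * (1 - 4 * r * u - r\<^sup>2 - (- u + 3 * u\<^sup>2 - 9/8 * u ^ 3))"
    unfolding sqrt_expansion_def by algebra
  also have "\<bar>\<dots>\<bar> = 4 * a\<^sup>2 * u\<^sup>2 * \<bar>1 - 4 * r * u - r\<^sup>2 - (- u + 3 * u\<^sup>2 - 9/8 * u ^ 3)\<bar>"
    by (simp add: abs_mult)
  also have "\<dots> \<le> 4 * a\<^sup>2 * u\<^sup>2 * (3 * u ^ 4)" by (intro mult_left_mono K) simp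
  finally show ?thesis by (simp add: power_add[of u 2 4, simplified] mult_ac)
qed

lemma inverse_sqrt_bounds:
  fixes h :: real
  assumes h: "\<bar>h\<bar> \<le> 1/1000"
  shows "1 - h / 2 \<le> 1 / sqrt (1 + h)" "1 / sqrt (1 + h) \<le> 1 - h / 2 + h\<^sup>2 / 2"
proof -
  have p: "1 + h > 0" "1 - h / 2 > 0" using h by linarith+
  have h2: "h * h \<le> 1/1000 * \<bar>h\<bar>" using mult_right_mono[OF h, of "\<bar>h\<bar>"] by simp
  have "(1 - h / 2) * sqrt (1 + h) \<le> 1"
  proof (rule power2_le_imp_le)
    have "1 - (1 - h / 2)\<^sup>2 * (1 + h) = h\<^sup>2 * (3 - h) / 4" by (simp add: power2_eq_square field_simps)
    also have "\<dots> \<ge> 0" using h by simp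
    finally show "((1 - h / 2) * sqrt (1 + h))\<^sup>2 \<le> 1\<^sup>2" using p by (simp add: power_mult_distrib)
  qed simp
  thus "1 - h / 2 \<le> 1 / sqrt (1 + h)" using p by (simp add: field_simps)
  have q: "1 - h / 2 + h\<^sup>2 / 2 > 0" using p by (simp add: add_pos_nonneg)
  have "1 \<le> (1 - h / 2 + h\<^sup>2 / 2) * sqrt (1 + h)"
  proof (rule power2_le_imp_le)
    have "(1 - h / 2 + h\<^sup>2 / 2)\<^sup>2 * (1 + h) - 1 = h\<^sup>2 * (1 + 3 * h - h\<^sup>2 + h ^ 3) / 4"
      by (simp add: power2_eq_square power3_eq_cube field_simps)
    also have "\<dots> \<ge> 0"
    proof -
      have "h\<^sup>2 \<le> 1/1000" using h2 h by (simp add: power2_eq_square)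
      moreover have "\<bar>h ^ 3\<bar> \<le> 1/1000"
        using power_decreasing[of 1 3 "\<bar>h\<bar>"] h by (simp add: power_abs)
      ultimately have "1 + 3 * h - h\<^sup>2 + h ^ 3 \<ge> 0" using h by linarith
      thus ?thesis by simp
    qed
    finally show "1\<^sup>2 \<le> ((1 - h / 2 + h\<^sup>2 / 2) * sqrt (1 + h))\<^sup>2" using p by (simp add: power_mult_distrib)
  qed (use p q in simp)
  thus "1 / sqrt (1 + h) \<le> 1 - h / 2 + h\<^sup>2 / 2" using p by (simp add: field_simps)
qed

text \<open>Moving from \<open>N\<close> to \<open>N * (1 + h)\<close> or \<open>N * (1 - h)\<close>
  scales \<open>u\<close> by \<open>x\<close> or \<open>y\<close>. Writing the bounds as
  \<open>A - B\<close> and \<open>A + B\<close> cancels odd powers of \<open>B\<close> in the sums,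
  so the deviation from 2 is quadratic in \<open>h\<close>.\<close>

lemma inverse_sqrt_paired_powers:
  fixes h x y :: real
  assumes h: "0 \<le> h" "h \<le> 1/1000"
  defines "x \<equiv> 1 / sqrt (1 + h)" and "y \<equiv> 1 / sqrt (1 - h)"
  shows "2 \<le> x ^ 3 + y ^ 3" "x ^ 3 + y ^ 3 \<le> 2 + 5 * h\<^sup>2" "2 \<le> x ^ 4 + y ^ 4" "x ^ 4 + y ^ 4 \<le> 2 + 8 * h\<^sup>2"
    "2 \<le> x ^ 5 + y ^ 5" "x ^ 5 + y ^ 5 \<le> 2 + 12 * h\<^sup>2" "x ^ 6 + y ^ 6 \<le> 11/5"
proof -
  define B where "B = h / 2"
  define A where "A = 1 + h\<^sup>2 / 2"
  have x: "1 - B \<le> x" "x \<le> A - B" using inverse_sqrt_bounds[of h] h by (simp_all add: x_def A_def B_def)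
  have y: "1 + B \<le> y" "y \<le> A + B" using inverse_sqrt_bounds[of "-h"] h by (simp_all add: y_def A_def B_def)
  have B: "0 \<le> B" "B \<le> 1/2000" using h by (simp_all add: B_def)
  define k where "k = h\<^sup>2"
  have k: "0 \<le> k" "k \<le> 1/1000000" using power_mono[OF h(2,1), of 2] by (simp_all add: k_def power_divide)
  have Bk: "B\<^sup>2 = k / 4" by (simp add: B_def k_def power_divide)
  have Ak: "A = 1 + k / 2" by (simp add: A_def k_def)
  have pos: "0 \<le> 1 - B" "0 \<le> x" "0 \<le> y" using x y B by linarith+
  have lo: "(1 - B) ^ n + (1 + B) ^ n \<le> x ^ n + y ^ n" for n
    by (intro add_mono power_mono x y) (use pos B in auto)
  have hi: "x ^ n + y ^ n \<le> (A - B) ^ n + (A + B) ^ n" for n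
    by (intro add_mono power_mono x y) (use pos in auto)
  have kk: "k * k \<le> 1/1000000 * k" "k * k * k \<le> 1/1000000 * k" "k * k * k * k \<le> 1/1000000 * k" "k*k*k*k*k \<le> 1/1000000 * k"
  proof -
    show 1: "k * k \<le> 1/1000000 * k" using k by (intro mult_right_mono) auto
    show 2: "k * k * k \<le> 1/1000000 * k" using mult_right_mono[OF 1 k(1)] 1 k by linarith
    show 3: "k * k * k * k \<le> 1/1000000 * k" using mult_right_mono[OF 2 k(1)] 1 k by linarith
    show "k * k * k * k * k \<le> 1/1000000 * k" using mult_right_mono[OF 3 k(1)] 1 k by linarith
  qed
  have "(1 - B) ^ 3 + (1 + B) ^ 3 = 2 + 6 * B\<^sup>2" "(1 - B) ^ 4 + (1 + B) ^ 4 = 2 + 12 * B\<^sup>2 + 2 * (B\<^sup>2 * B\<^sup>2)"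
    "(1 - B) ^ 5 + (1 + B) ^ 5 = 2 + 20 * B\<^sup>2 + 10 * (B\<^sup>2 * B\<^sup>2)" by algebra+
  with lo[of 3] lo[of 4] lo[of 5] show "2 \<le> x ^ 3 + y ^ 3" "2 \<le> x ^ 4 + y ^ 4" "2 \<le> x ^ 5 + y ^ 5"
    using zero_le_power2[of B] mult_nonneg_nonneg[OF zero_le_power2[of B] zero_le_power2[of B]] by linarith+
  have "(A - B) ^ 3 + (A + B) ^ 3 = 2 * (A * A * A) + 6 * A * B\<^sup>2" by algebra
  also have "\<dots> = 2 + 9/2 * k + 9/4 * (k*k) + 1/4 * (k*k*k)" unfolding Bk Ak by (simp add: field_simps)
  also have "\<dots> \<le> 2 + 5 * k" using kk k by linarith
  finally show "x ^ 3 + y ^ 3 \<le> 2 + 5 * h\<^sup>2" using hi[of 3] unfolding k_def by linarith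
  have "(A - B) ^ 4 + (A + B) ^ 4 = 2 * (A * A * A * A) + 12 * (A * A) * B\<^sup>2 + 2 * (B\<^sup>2 * B\<^sup>2)" by algebra
  also have "\<dots> = 2 + 7 * k + 49/8 * (k*k) + 7/4 * (k*k*k) + 1/8 * (k*k*k*k)" unfolding Bk Ak by (simp add: field_simps)
  also have "\<dots> \<le> 2 + 8 * k" using kk k by linarith
  finally show "x ^ 4 + y ^ 4 \<le> 2 + 8 * h\<^sup>2" using hi[of 4] unfolding k_def by linarith
  have "(A - B) ^ 5 + (A + B) ^ 5 = 2 * (A * A * A * A * A) + 20 * (A * A * A) * B\<^sup>2 + 10 * A * (B\<^sup>2 * B\<^sup>2)" by algebra
  also have "\<dots> = 2 + 10 * k + 105/8 * (k*k) + 105/16 * (k*k*k) + 10/8 * (k*k*k*k) + 1/16 * (k*k*k*k*k)" unfolding Bk Ak by (simp add: field_simps)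
  also have "\<dots> \<le> 2 + 12 * k" using kk k by linarith
  finally show "x ^ 5 + y ^ 5 \<le> 2 + 12 * h\<^sup>2" using hi[of 5] unfolding k_def by linarith
  have "x \<le> 101/100" "y \<le> 101/100" using x y B k unfolding Ak by linarith+
  hence "x ^ 6 \<le> (101/100) ^ 6" "y ^ 6 \<le> (101/100) ^ 6" using pos by (intro power_mono; simp)+
  moreover have "(101/100 :: real) ^ 6 \<le> 11/10" by (simp add: eval_nat_numeral)
  ultimately show "x ^ 6 + y ^ 6 \<le> 11/5" by linarith
qed

lemma log_clifford_second_difference:
  fixes a N :: real
  assumes a: "a > 0" "4 * a \<le> 33/10" and z: "2 * sqrt (a * N) \<ge> 67"
  defines "u \<equiv> 1 / (2 * sqrt (a * N))" and "g \<equiv> \<lambda>N. ln (clifford (a * N))"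
  shows "\<bar>g (N + 1) + g (N - 1) - 2 * g N - 4 * a\<^sup>2 * sqrt_expansion u\<bar> \<le> 4 * a\<^sup>2 * (4 * u ^ 6)"
proof -
  define p where "p = 4 * a\<^sup>2"
  have p: "p > 0" using a by (simp add: p_def)
  have "sqrt (a * N) > 0" using z by linarith
  hence aN: "a * N > 0" by simp
  hence N0: "N > 0" using a by (simp add: zero_less_mult_iff)
  have "67\<^sup>2 \<le> (2 * sqrt (a * N))\<^sup>2" using z by (intro power_mono) auto
  hence aN4: "4 * (a * N) \<ge> 4489" using aN by (simp add: power_mult_distrib)
  have "4 * a * N \<le> 33/10 * N" using a N0 by (intro mult_right_mono) auto
  hence N1: "N \<ge> 1000" using aN4 by simp
  have u2: "u\<^sup>2 = 1 / (4 * (a * N))" using aN by (simp add: u_def power_divide power_mult_distrib)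
  have "1 / (2 * sqrt (a * N)) \<le> 1 / 67" by (rule divide_left_mono) (use aN z in auto)
  hence u: "0 \<le> u" "u \<le> 1 / 67" using aN by (auto simp: u_def)
  have avg: "\<bar>log_clifford'' a (N + s) + log_clifford'' a (N - s) - 2 * (p * sqrt_expansion u)\<bar> \<le> 2 * (p * (4 * u ^ 6))"
    if s: "0 \<le> s" "s \<le> 1" for s
  proof -
    define h where "h = s / N"
    have h: "0 \<le> h" "h \<le> 1/1000" using s N1 by (auto simp: h_def field_simps)
    define x y where "x = 1 / sqrt (1 + h)" and "y = 1 / sqrt (1 - h)"
    have ns: "N + s = N * (1 + h)" "N - s = N * (1 - h)" using N0 by (simp_all add: h_def field_simps)
    have ux: "1 / (2 * sqrt (a * (N + s))) = u * x" "1 / (2 * sqrt (a * (N - s))) = u * y"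
      unfolding ns by (simp_all add: u_def x_def y_def real_sqrt_mult mult.assoc[symmetric])
    have big: "2 * sqrt (a * (N + s)) \<ge> 66" "2 * sqrt (a * (N - s)) \<ge> 66"
    proof -
      \<comment> \<open>A unit step changes \<open>4 * (a * N)\<close> by at most
        \<open>33 / 10\<close>, far less than the gap between the squares of 67 and 66.\<close>
      have "a * s \<le> a" using s a by (simp add: mult_left_le)
      moreover have "0 \<le> a * s" using a s by simp
      ultimately have "1089 \<le> a * (N - s)" "a * (N - s) \<le> a * (N + s)"
        unfolding distrib_left right_diff_distrib using aN4 a by linarith+
      hence "33 \<le> sqrt (a * (N - s))" "sqrt (a * (N - s)) \<le> sqrt (a * (N + s))"
        by (auto intro!: real_le_rsqrt)
      thus "2 * sqrt (a * (N + s)) \<ge> 66" "2 * sqrt (a * (N - s)) \<ge> 66" by linarith+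
    qed
    note P = inverse_sqrt_paired_powers[OF h, folded x_def y_def]
    have A: "\<bar>log_clifford'' a (N + s) - p * sqrt_expansion (u * x)\<bar> \<le> p * (3 * (u * x) ^ 6)"
      "\<bar>log_clifford'' a (N - s) - p * sqrt_expansion (u * y)\<bar> \<le> p * (3 * (u * y) ^ 6)"
      using log_clifford''_approx[OF a(1) _ big(1)] log_clifford''_approx[OF a(1) _ big(2)] s N1
      unfolding p_def ux by auto
    define X3 X4 X5 X6 where "X3 = u ^ 3 * (x ^ 3 + y ^ 3 - 2)" and "X4 = u ^ 4 * (x ^ 4 + y ^ 4 - 2)"
      and "X5 = u ^ 5 * (x ^ 5 + y ^ 5 - 2)" and "X6 = u ^ 6 * (x ^ 6 + y ^ 6)"
    have sum: "sqrt_expansion (u * x) + sqrt_expansion (u * y) - 2 * sqrt_expansion u = - X3 + 3 * X4 - 9/8 * X5"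
      unfolding sqrt_expansion_def X3_def X4_def X5_def power_mult_distrib by (simp add: field_simps)
    \<comment> \<open>As \<open>1 / N = 4 * a * u\<^sup>2\<close>, the pairwise deviation of the
      leading term \<open>u ^ 3\<close> is of order \<open>u ^ 7\<close>.\<close>
    have hh: "h\<^sup>2 \<le> 11 * u ^ 4"
    proof -
      have "h \<le> 1 / N" using s N0 by (simp add: h_def divide_right_mono)
      also have "1 / N = 4 * a * u\<^sup>2" unfolding u2 using a by simp
      also have "\<dots> \<le> 33/10 * u\<^sup>2" using a by (intro mult_right_mono) auto
      finally have "h\<^sup>2 \<le> (33/10 * u\<^sup>2)\<^sup>2" using h by (intro power_mono) auto
      also have "\<dots> = 1089/100 * u ^ 4" by (simp add: power_mult_distrib power_divide)
      also have "\<dots> \<le> 11 * u ^ 4" using u by simp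
      finally show ?thesis .
    qed
    have "X3 \<le> u ^ 3 * (5 * (11 * u ^ 4))" unfolding X3_def
      by (rule mult_left_mono) (use P(2) hh u in auto)
    also have "\<dots> = 55 * u * u ^ 6" by (simp add: eval_nat_numeral)
    also have "\<dots> \<le> 55 * (1/67) * u ^ 6" using u by (intro mult_right_mono mult_left_mono) auto
    finally have X3: "X3 \<le> 55/67 * u ^ 6" by simp
    have "X4 \<le> u ^ 4 * (8 * (11 * u ^ 4))" unfolding X4_def
      by (rule mult_left_mono) (use P(4) hh u in auto)
    also have "\<dots> = 88 * (u * u) * u ^ 6" by (simp add: eval_nat_numeral)
    also have "\<dots> \<le> 88 * (1/67 * (1/67)) * u ^ 6" using u by (intro mult_right_mono mult_left_mono mult_mono) auto
    finally have X4: "X4 \<le> 88/4489 * u ^ 6" by simp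
    have "X5 \<le> u ^ 5 * (12 * (11 * u ^ 4))" unfolding X5_def
      by (rule mult_left_mono) (use P(6) hh u in auto)
    also have "\<dots> = 132 * (u * u * u) * u ^ 6" by (simp add: eval_nat_numeral)
    also have "\<dots> \<le> 132 * (1/67 * (1/67) * (1/67)) * u ^ 6" using u by (intro mult_right_mono mult_left_mono mult_mono) auto
    finally have X5: "X5 \<le> 132/300763 * u ^ 6" by simp
    have X6: "X6 \<le> u ^ 6 * (11/5)" unfolding X6_def
      by (rule mult_left_mono) (use P(7) u in auto)
    have Xp: "0 \<le> X3" "0 \<le> X4" "0 \<le> X5"
      unfolding X3_def X4_def X5_def using P(1,3,5) u by auto
    have u6: "0 \<le> u ^ 6" using u by simp
    define S where "S = sqrt_expansion (u * x) + sqrt_expansion (u * y)"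
    have "\<bar>S - 2 * sqrt_expansion u\<bar> \<le> u ^ 6"
      unfolding S_def sum using X3 X4 X5 Xp u6 by linarith
    hence S: "\<bar>p * S - 2 * (p * sqrt_expansion u)\<bar> \<le> p * u ^ 6"
    proof -
      have "p * S - 2 * (p * sqrt_expansion u) = p * (S - 2 * sqrt_expansion u)" by (simp add: algebra_simps)
      hence "\<bar>p * S - 2 * (p * sqrt_expansion u)\<bar> = p * \<bar>S - 2 * sqrt_expansion u\<bar>"
        using p by (simp add: abs_mult)
      also have "\<dots> \<le> p * u ^ 6" using p \<open>\<bar>S - 2 * sqrt_expansion u\<bar> \<le> u ^ 6\<close> by (intro mult_left_mono) auto
      finally show ?thesis .
    qed
    have "p * (3 * (u * x) ^ 6) + p * (3 * (u * y) ^ 6) = p * (3 * X6)"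
      by (simp add: X6_def power_mult_distrib algebra_simps)
    also have "\<dots> \<le> p * (3 * (u ^ 6 * (11/5)))" using p X6 by (intro mult_left_mono) auto
    finally have "p * (3 * (u * x) ^ 6) + p * (3 * (u * y) ^ 6) \<le> 33/5 * (p * u ^ 6)" by simp
    moreover have "p * S = p * sqrt_expansion (u * x) + p * sqrt_expansion (u * y)"
      by (simp add: S_def algebra_simps)
    moreover have "0 \<le> p * u ^ 6" using p u6 by simp
    \<comment> \<open>The total is \<open>1 + 33 / 5\<close>, below the 8 allowed for the
      pair.\<close>
    ultimately show ?thesis using A S by linarith
  qed
  have pos: "x > 0" if "N - 1 \<le> x" for x using that N1 by linarith
  have D: "(g has_real_derivative (a * (clifford' (a * x) / clifford (a * x)))) (at x)"
    "((\<lambda>x. a * (clifford' (a * x) / clifford (a * x))) has_real_derivative log_clifford'' a x) (at x)"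
    if "N - 1 \<le> x" for x
    unfolding g_def using log_clifford_derivs[OF a(1) pos[OF that]] by auto
  have "g (N + 1) + g (N - 1) - 2 * g N \<le> p * sqrt_expansion u + p * (4 * u ^ 6)"
    by (rule second_difference_le[OF D]) (use avg in \<open>force simp: abs_le_iff algebra_simps\<close>)+
  moreover have "g (N + 1) + g (N - 1) - 2 * g N \<ge> p * sqrt_expansion u - p * (4 * u ^ 6)"
    by (rule second_difference_ge[OF D]) (use avg in \<open>force simp: abs_le_iff algebra_simps\<close>)+
  ultimately show ?thesis unfolding p_def by (simp add: abs_le_iff algebra_simps)
qed

section \<open>Numerical size of the relative error\<close>

lemma power_15_2_le_exp:
  fixes v :: real
  assumes v: "v \<ge> 669/10"
  shows "v ^ 6 * (v * sqrt v) \<le> 683/100 * exp (4 * v / 9)"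
proof -
  have v0: "v > 0" using v by simp
  have e1: "(2718/1000 :: real) \<le> exp 1" using e_approx_32 by (simp add: abs_if split: if_splits)
  \<comment> \<open>The claim at the endpoint is squared to remove the square root;
    \<open>59 + 7 / 15\<close> is then twice \<open>4 / 9 * (669 / 10)\<close>.\<close>
  have "(669/10 :: real) ^ 15 \<le> (683/100)\<^sup>2 * ((2718/1000) ^ 59 * (1 + 7/15 + (7/15)\<^sup>2 / 2))"
    by (simp add: eval_nat_numeral)
  also have "\<dots> \<le> (683/100)\<^sup>2 * (exp 1 ^ 59 * exp (7/15))"
    by (intro mult_left_mono mult_mono power_mono e1 exp_lower_Taylor_quadratic) auto
  also have "exp 1 ^ 59 * exp (7/15) = exp (892/15 :: real)"
    by (simp flip: exp_of_nat_mult exp_add)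
  finally have "ln ((669/10 :: real) ^ 15) \<le> ln ((683/100)\<^sup>2 * exp (892/15))" by simp
  hence base: "15 * ln (669/10 :: real) \<le> 2 * ln (683/100) + 892/15"
    by (simp add: ln_mult ln_realpow)
  \<comment> \<open>The logarithm lies below its tangent at \<open>669 / 10\<close>, and 15/2 times
    the slope of that tangent is less than \<open>4 / 9\<close>; hence the endpoint settles all
    larger \<open>v\<close>.\<close>
  have "ln (v / (669/10)) \<le> v / (669/10) - 1" by (rule ln_le_minus_one) (use v0 in simp)
  moreover have "ln (v / (669/10)) = ln v - ln (669/10)" using v0 by (intro ln_divide_pos) auto
  ultimately have "ln v \<le> ln (669/10) + (v / (669/10) - 1)" by linarith
  hence "15/2 * ln v \<le> ln (683/100) + 4 * v / 9" using base v by simp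
  hence "exp (15/2 * ln v) \<le> exp (ln (683/100) + 4 * v / 9)" by simp
  also have "15/2 * ln v = 6 * ln v + (ln v + ln (sqrt v))" using v0 by (simp add: ln_sqrt)
  also have "exp \<dots> = v ^ 6 * (v * sqrt v)"
  proof -
    have "exp (6 * ln v) = v ^ 6" using v0 exp_of_nat_mult[of 6 "ln v"] by simp
    thus ?thesis using v0 by (simp only: exp_add exp_ln real_sqrt_gt_zero)
  qed
  finally show ?thesis by (simp add: exp_add)
qed

text \<open>The error \<open>exp (5 * w / 9)\<close> is compared with a main term of size at least
  \<open>exp w / (2 * (w * sqrt w))\<close>. Together with \<open>w ^ 6\<close> this leaves the
  power 15/2 against \<open>exp (4 * w / 9)\<close>; \<open>683 / 100\<close> is what the target 20
  and \<open>a \<ge> 82 / 100\<close> permit.\<close>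

lemma q_relative_error:
  fixes n :: nat
  defines "a \<equiv> pi\<^sup>2 / 12"
  assumes v: "\<nu> n \<ge> 669/10"
  shows "\<bar>sqrt 2 * q n / (a * clifford (a * (n + 1/24))) - 1\<bar> \<le> 20 / \<nu> n ^ 6"
proof -
  define w where "w = \<nu> n"
  define C where "C = clifford (a * (n + 1/24))"
  have w: "w \<ge> 669/10" using v by (simp add: w_def)
  have a: "a \<ge> 82/100"
    using power_mono[of "314/100" pi 2] pi_approx by (simp add: a_def power2_eq_square)
  have "w\<^sup>2 / 4 = a * (n + 1/24)"
    unfolding w_def \<nu>_def a_def by (simp add: power_divide power_mult_distrib field_simps)
  hence C: "C \<ge> exp w / (2 * (w * sqrt w))"
    using clifford_growth[of w] w by (simp add: C_def)
  have ws: "w * sqrt w > 0" using w by simp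
  hence C0: "C > 0" using C by (smt (verit) divide_pos_pos exp_gt_zero)
  have "6/5 * exp (5 * w / 9) * w ^ 6 \<le> 20 * (a * C)"
  proof -
    have "6/5 * exp (5 * w / 9) * w ^ 6 * (2 * (w * sqrt w)) = 12/5 * exp (5 * w / 9) * (w ^ 6 * (w * sqrt w))"
      by simp
    also have "\<dots> \<le> 12/5 * exp (5 * w / 9) * (683/100 * exp (4 * w / 9))"
      by (intro mult_left_mono power_15_2_le_exp w) auto
    also have "\<dots> = 2049/125 * (exp (5 * w / 9) * exp (4 * w / 9))" by simp
    also have "exp (5 * w / 9) * exp (4 * w / 9) = exp w" by (simp flip: exp_add)
    also have "2049/125 * exp w \<le> (20 * a) * exp w" using a by (intro mult_right_mono) auto
    finally have "6/5 * exp (5 * w / 9) * w ^ 6 \<le> 20 * a * exp w / (2 * (w * sqrt w))"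
      using ws by (simp add: pos_le_divide_eq)
    also have "\<dots> = 20 * a * (exp w / (2 * (w * sqrt w)))" by simp
    also have "\<dots> \<le> 20 * a * C" using C a by (intro mult_left_mono) auto
    finally show ?thesis by (simp add: mult.assoc)
  qed
  hence "6/5 * exp (5 * w / 9) / (a * C) \<le> 20 / w ^ 6"
    using C0 a w by (simp add: divide_simps mult_ac)
  moreover have "\<bar>sqrt 2 * q n - a * C\<bar> \<le> 6/5 * exp (5 * w / 9)"
    using q_clifford_approx[of n] w by (simp add: w_def C_def a_def)
  hence "\<bar>sqrt 2 * q n - a * C\<bar> / (a * C) \<le> 6/5 * exp (5 * w / 9) / (a * C)"
    using C0 a by (intro divide_right_mono) auto
  moreover have "\<bar>sqrt 2 * q n / (a * C) - 1\<bar> = \<bar>sqrt 2 * q n - a * C\<bar> / (a * C)"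
  proof -
    have "sqrt 2 * q n / (a * C) - 1 = (sqrt 2 * q n - a * C) / (a * C)"
      using C0 a by (simp add: diff_divide_distrib)
    thus ?thesis using C0 a by (simp add: abs_divide abs_mult)
  qed
  ultimately show ?thesis unfolding w_def C_def by linarith
qed

text \<open>To first order the error is \<open>4 * e\<close>; for \<open>e \<le> 1 / 100\<close> one
  more \<open>e\<close> covers the higher orders.\<close>

lemma ratio_perturbation:
  fixes x y z e :: real
  assumes "\<bar>x - 1\<bar> \<le> e" "\<bar>y - 1\<bar> \<le> e" "\<bar>z - 1\<bar> \<le> e" "e \<le> 1/100"
  shows "\<bar>x * y / z\<^sup>2 - 1\<bar> \<le> 5 * e"
proof -
  have e: "0 \<le> e" using assms(1) by linarith
  have ee: "e * e \<le> 1/100 * e" using assms(4) e by (intro mult_right_mono) auto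
  have z: "z > 0" using assms by linarith
  have lo: "(1 - e) * (1 - e) \<le> x * y" "(1 - e) * (1 - e) \<le> z\<^sup>2" 
    unfolding power2_eq_square using assms by (intro mult_mono; linarith)+
  have hi: "x * y \<le> (1 + e) * (1 + e)" "z\<^sup>2 \<le> (1 + e) * (1 + e)"
    unfolding power2_eq_square using assms e by (intro mult_mono; linarith)+
  have eee: "e * (e * e) \<le> 1/100 * e" "0 \<le> e * (e * e)" "0 \<le> e * e"
    using mult_left_mono[OF ee e] ee e assms(4) by auto
  have "(1 - 5 * e) * z\<^sup>2 \<le> (1 - 5 * e) * ((1 + e) * (1 + e))" using hi assms(4) by (intro mult_left_mono) auto
  also have "\<dots> = (1 - e) * (1 - e) - (e + 10 * (e * e) + 5 * (e * (e * e)))" by (simp add: algebra_simps)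
  also have "\<dots> \<le> (1 - e) * (1 - e)" using e eee by linarith
  finally have 1: "(1 - 5 * e) * z\<^sup>2 \<le> x * y" using lo by linarith
  have "(1 + e) * (1 + e) = (1 + 5 * e) * ((1 - e) * (1 - e)) - (e - 10 * (e * e) + 5 * (e * (e * e)))"
    by (simp add: algebra_simps)
  also have "\<dots> \<le> (1 + 5 * e) * ((1 - e) * (1 - e))" using e ee eee by linarith
  also have "\<dots> \<le> (1 + 5 * e) * z\<^sup>2" using lo e by (intro mult_left_mono) auto
  finally have 2: "x * y \<le> (1 + 5 * e) * z\<^sup>2" using hi by linarith
  have "1 - 5 * e \<le> x * y / z\<^sup>2" "x * y / z\<^sup>2 \<le> 1 + 5 * e"
    using 1 2 z by (simp_all add: pos_le_divide_eq pos_divide_le_eq)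
  thus ?thesis by (simp add: abs_le_iff)
qed


theorem theorem1p4:
  fixes n :: nat
  assumes "n > 0" and "\<nu> n \<ge> 67"
  shows "E\<^sub>Q n - 135 / \<nu> n ^ 6 < Q n \<and> Q n < E\<^sub>Q n + (126 + pi ^ 8 / 1296) / \<nu> n ^ 6"
proof -
  define a where "a = pi\<^sup>2 / 12"
  define N where "N = real n + 1/24"
  define u where "u = 1 / \<nu> n"
  define p where "p = 4 * a\<^sup>2"
  define C where "C m = clifford (a * (real m + 1/24))" for m :: nat
  define \<eta> where "\<eta> m = sqrt 2 * q m / (a * C m)" for m :: nat
  have pi: "3 < pi" "pi \<le> 3146/1000" using pi_approx by simp_all
  have pi2: "pi\<^sup>2 \<le> 99/10" using power_mono[of pi "3146/1000" 2] pi by (simp add: power2_eq_square)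
  have a: "a > 0" "4 * a \<le> 33/10" using pi2 by (simp_all add: a_def)
  have \<nu>2: "\<nu> m = 2 * sqrt (a * (real m + 1/24))" for m
  proof (rule power2_eq_imp_eq)
    show "(\<nu> m)\<^sup>2 = (2 * sqrt (a * (real m + 1/24)))\<^sup>2"
      unfolding \<nu>_def using a by (simp add: a_def power_divide power_mult_distrib field_simps)
  qed (use a in \<open>simp_all add: \<nu>_def\<close>)
  have u: "0 < u" "u \<le> 1/67" using assms(2) by (auto simp: u_def field_simps)
  have u6: "u ^ 6 > 0" "u ^ 6 \<le> 1/67 ^ 6" using u power_mono[of u "1/67" 6] by (simp_all add: power_divide)
  have C0: "C m > 0" for m
    unfolding C_def using clifford_ge_one[of "a * (real m + 1/24)"] a by simp
  define L where "L = ln (C (n + 1)) + ln (C (n - 1)) - 2 * ln (C n)"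
  \<comment> \<open>Since \<open>n > 0\<close>, the natural number \<open>n - 1\<close> does not
    truncate, and \<open>C (n - 1)\<close> is the main term at \<open>N - 1\<close>.\<close>
  have L: "\<bar>L - p * sqrt_expansion u\<bar> \<le> p * (4 * u ^ 6)"
    using log_clifford_second_difference[OF a, of N] assms
    by (simp add: L_def C_def N_def p_def u_def \<nu>2 of_nat_diff algebra_simps)
  have p: "0 < p" "p \<le> 273/100"
  proof -
    have "(4 * a)\<^sup>2 \<le> (33/10)\<^sup>2" using a by (intro power_mono) auto
    thus "p \<le> 273/100" by (simp add: p_def power2_eq_square)
  qed (use a in \<open>simp add: p_def\<close>)
  have p_pi: "p = pi ^ 4 / 36" by (simp add: p_def a_def power_divide flip: power_mult)
  have EQ: "E\<^sub>Q n = 1 + p * sqrt_expansion u"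
    by (simp add: E\<^sub>Q_def sqrt_expansion_def u_def p_pi power_divide algebra_simps)
  \<comment> \<open>These bounds show that \<open>L\<close> lies between \<open>- p * u ^ 3\<close>
    and 0, so the quadratic term of \<open>exp L\<close> is already of order
    \<open>u ^ 6\<close>.\<close>
  have m: "- (u ^ 3) \<le> sqrt_expansion u - 4 * u ^ 6" "sqrt_expansion u + 4 * u ^ 6 \<le> 0"
  proof -
    have "u ^ 4 \<le> 1/67 * u ^ 3" "u ^ 5 \<le> 1/67 * u ^ 4" "u ^ 6 \<le> 1/67 * u ^ 5"
      using u mult_right_mono[OF u(2), of "u ^ 3"] mult_right_mono[OF u(2), of "u ^ 4"] mult_right_mono[OF u(2), of "u ^ 5"]
      by (simp_all add: eval_nat_numeral)
    moreover have "0 < u ^ 3" "0 < u ^ 4" "0 < u ^ 5" using u by simp_all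
    ultimately show "- (u ^ 3) \<le> sqrt_expansion u - 4 * u ^ 6" "sqrt_expansion u + 4 * u ^ 6 \<le> 0"
      unfolding sqrt_expansion_def by linarith+
  qed
  have L0: "L \<le> 0" and L3: "- (p * u ^ 3) \<le> L"
  proof -
    have "p * (sqrt_expansion u + 4 * u ^ 6) \<le> 0" using p m by (simp add: mult_nonneg_nonpos)
    thus "L \<le> 0" using L by (simp add: abs_le_iff algebra_simps)
    have "p * - (u ^ 3) \<le> p * (sqrt_expansion u - 4 * u ^ 6)" using p m by (intro mult_left_mono) auto
    thus "- (p * u ^ 3) \<le> L" using L by (simp add: abs_le_iff algebra_simps)
  qed
  have exp_L: "exp L = C (n - 1) * C (n + 1) / (C n)\<^sup>2"
    using C0 by (simp add: L_def exp_add exp_diff exp_double)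
  have "exp L \<ge> 1 + L" by (rule exp_ge_add_one_self)
  hence R_lo: "exp L \<ge> E\<^sub>Q n - 11 * u ^ 6"
  proof -
    have "p * (4 * u ^ 6) \<le> 273/100 * (4 * u ^ 6)" using p u6 by (intro mult_right_mono) auto
    thus ?thesis using \<open>exp L \<ge> 1 + L\<close> L u6 unfolding EQ by linarith
  qed
  \<comment> \<open>About 10.9 comes from the error of \<open>L\<close> and about 3.7 from
    \<open>L\<^sup>2 / 2\<close>. The quadratic upper bound for \<open>exp L\<close> follows from
    the lower one for \<open>exp (- L)\<close>, as the two quadratics multiply to
    \<open>1 + L ^ 4 / 4\<close>.\<close>
  have R_hi: "exp L \<le> E\<^sub>Q n + 15 * u ^ 6"
  proof -
    have "1 + (- L) + (- L)\<^sup>2 / 2 \<le> exp (- L)" using L0 by (intro exp_lower_Taylor_quadratic) simp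
    have "exp L \<le> 1 + L + L\<^sup>2 / 2"
    proof -
      have "0 \<le> L\<^sup>2 * L\<^sup>2" by simp
      hence "1 \<le> (1 + L + L\<^sup>2 / 2) * (1 + (- L) + (- L)\<^sup>2 / 2)"
        by (simp add: algebra_simps power2_eq_square)
      also have "\<dots> \<le> (1 + L + L\<^sup>2 / 2) * exp (- L)"
      proof (rule mult_left_mono)
        have "0 \<le> (L + 1)\<^sup>2 + 1" by simp
        thus "0 \<le> 1 + L + L\<^sup>2 / 2" by (simp add: power2_eq_square algebra_simps)
      qed fact
      finally show ?thesis by (simp add: exp_minus field_simps)
    qed
    moreover have "L\<^sup>2 \<le> (p * u ^ 3)\<^sup>2" using L0 L3 by (intro abs_le_square_iff[THEN iffD1]) simp
    moreover have "(p * u ^ 3)\<^sup>2 = p\<^sup>2 * u ^ 6" by (simp add: power_mult_distrib flip: power_mult)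
    moreover have "p\<^sup>2 * u ^ 6 \<le> (273/100)\<^sup>2 * u ^ 6" using p u6 by (intro mult_right_mono power_mono) auto
    moreover have "p * (4 * u ^ 6) \<le> 273/100 * (4 * u ^ 6)" using p u6 by (intro mult_right_mono) auto
    moreover have "(273/100)\<^sup>2 * u ^ 6 = 74529/10000 * u ^ 6" by (simp add: power2_eq_square)
    ultimately show ?thesis using L u6 unfolding EQ by linarith
  qed
  \<comment> \<open>The step to \<open>n - 1\<close> lowers the square of \<open>\<nu>\<close> by at
    most \<open>33 / 10\<close>, so the value stays above 66.9 and the loss in the sixth power turns
    20 into at most 103/5. Five times this gives 103.\<close>
  have \<eta>: "\<bar>\<eta> m - 1\<bar> \<le> 103/5 * u ^ 6" if "n - 1 \<le> m" for m
  proof -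
    define w where "w = \<nu> m"
    define v where "v = \<nu> n"
    have v: "v \<ge> 67" using assms by (simp add: v_def)
    have "a * (real n - real m) \<le> a * 1" using that a by (intro mult_left_mono) auto
    hence "w\<^sup>2 \<ge> v\<^sup>2 - 4 * a"
      unfolding w_def v_def \<nu>2 using a by (simp add: power_mult_distrib algebra_simps)
    hence wv: "w\<^sup>2 \<ge> v\<^sup>2 - 33/10" using a by linarith
    have v2: "v\<^sup>2 \<ge> 67\<^sup>2" using v by (intro power_mono) auto
    have w0: "w \<ge> 0" unfolding w_def \<nu>2 using a by simp
    have "(669/10)\<^sup>2 \<le> w\<^sup>2" using wv v2 by (simp add: power2_eq_square)
    hence w: "w \<ge> 669/10" using w0 by (rule power2_le_imp_le)
    have "999/1000 * v\<^sup>2 \<le> w\<^sup>2" using wv v2 by simp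
    hence "(999/1000 * v\<^sup>2) ^ 3 \<le> (w\<^sup>2) ^ 3" by (intro power_mono) auto
    moreover have "(999/1000 * v\<^sup>2) ^ 3 = (999/1000) ^ 3 * v ^ 6" "(w\<^sup>2) ^ 3 = w ^ 6"
      unfolding power_mult_distrib by (simp_all flip: power_mult)
    ultimately have "(999/1000) ^ 3 * v ^ 6 \<le> w ^ 6" by (simp only:)
    moreover have "v ^ 6 > 0" "w ^ 6 > 0" using v w by simp_all
    ultimately have "20 / w ^ 6 \<le> 20 / ((999/1000) ^ 3 * v ^ 6)" by (intro divide_left_mono) auto
    also have "\<dots> = 20 / (999/1000) ^ 3 * u ^ 6" by (simp add: u_def v_def power_divide)
    also have "\<dots> \<le> 103/5 * u ^ 6" using u6 by (intro mult_right_mono) (auto simp: eval_nat_numeral)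
    finally have "20 / w ^ 6 \<le> 103/5 * u ^ 6" .
    moreover have "\<bar>\<eta> m - 1\<bar> \<le> 20 / w ^ 6"
      unfolding \<eta>_def C_def a_def w_def by (rule q_relative_error) (use w in \<open>simp add: w_def\<close>)
    ultimately show ?thesis by linarith
  qed
  have q_eq: "real (q m) = a * C m / sqrt 2 * \<eta> m" for m
    unfolding \<eta>_def using C0[of m] a by simp
  define P where "P = \<eta> (n - 1) * \<eta> (n + 1) / (\<eta> n)\<^sup>2"
  have P: "\<bar>P - 1\<bar> \<le> 103 * u ^ 6"
    using ratio_perturbation[OF \<eta>[of "n - 1"] \<eta>[of "n + 1"] \<eta>[of n]] u6
    by (simp add: P_def)
  have QP: "Q n = exp L * P"
  proof -
    have "\<eta> n \<noteq> 0" using \<eta>[of n] u6 by (auto simp: eval_nat_numeral)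
    thus ?thesis unfolding Q_def q_eq exp_L P_def using C0[of n] a
      by (simp add: field_simps power2_eq_square)
  qed
  have "exp L \<le> 1" using L0 by simp
  hence "exp L * \<bar>P - 1\<bar> \<le> 103 * u ^ 6" using mult_mono[OF _ P, of "exp L" 1] by simp
  moreover have "Q n - exp L = exp L * (P - 1)" unfolding QP by (simp add: algebra_simps)
  hence "\<bar>Q n - exp L\<bar> = exp L * \<bar>P - 1\<bar>" by (simp add: abs_mult)
  ultimately have QL: "\<bar>Q n - exp L\<bar> \<le> 103 * u ^ 6" by simp
  \<comment> \<open>The totals are 11 + 103 = 114 on the lower side and 15 + 103 = 118 on the upper
    side.\<close>
  have "E\<^sub>Q n - 135 * u ^ 6 < Q n" using R_lo QL u6 by linarith
  moreover have "Q n < E\<^sub>Q n + 126 * u ^ 6" using R_hi QL u6 by linarith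
  moreover have "126 * u ^ 6 \<le> (126 + pi ^ 8 / 1296) * u ^ 6" using u6 by (intro mult_right_mono) auto
  moreover have "c / \<nu> n ^ 6 = c * u ^ 6" for c by (simp add: u_def power_divide)
  ultimately show ?thesis by simp
qed

end
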